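(* Let $E\subset\mathbb{C}$ be a polar compact set, and let $f_\infty\in\mathcal{A}_\infty(\widehat{\mathbb{C}}\setminus E)$. Then there exists a compact set $S\in\mathcal{K}_{f_\infty}$ such that $$\operatorname{cap} S=\inf_{K\in\mathcal{K}_{f_\infty}}\operatorname{cap}K .$$
   Context: $\widehat{\mathbb{C}}$ is the Riemann sphere. For a finite non-negative Borel measure $\mu$ with compact support in $\mathbb{C}$, its logarithmic potential is $V^\mu(z)=\int\log|z-t|\,d\mu(t)$ and its energy is $E(\mu)=\int V^\mu\,d\mu$. For a compact set $K\subset\mathbb{C}$, its energy is $E(K)=\sup E(\mu)$ over Borel probability measures $\mu$ with support in $K$, and its logarithmic capacity is $\operatorname{cap}K=e^{E(K)}$ (with $e^{-\infty}=0$ and $\operatorname{cap}\varnothing=0$). $K$ is called polar if $\operatorname{cap}K=0$. An analytic germ $f_\infty$ at $\infty$ is a germ of a holomorphic function at the point $\infty\in\widehat{\mathbb{C}}$. "Continuation along a path" always means meromorphic continuation along the path (poles are allowed). For a domain $D\ni\infty$, $f_\infty\in\mathcal{M}(D)$ means that $f_\infty$ extends to a single-valued meromorphic function in $D$. $\mathcal{A}_\infty(\widehat{\mathbb{C}}\setminus E)$ is the set of all analytic germs $f_\infty$ at $\infty$ that can be meromorphically continued along an arbitrary path lying in $\widehat{\mathbb{C}}\setminus E$ and starting at $\infty$, and such that $f_\infty\notin\mathcal{M}(\widehat{\mathbb{C}}\setminus E)$. For an analytic germ $f_\infty$ at $\infty$, a compact set $K\subset\mathbb{C}$ is called admissible for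 $f_\infty$ if $\widehat{\mathbb{C}}\setminus K$ is connected and $f_\infty\in\mathcal{M}(\widehat{\mathbb{C}}\setminus K)$. $\mathcal{K}_{f_\infty}$ denotes the set of all compact sets admissible for $f_\infty$. *)

theory Defs
  imports "HOL-Probability.Probability" "HOL-Complex_Analysis.Complex_Analysis"
begin

section \<open>Logarithmic capacity\<close>

text \<open>The library has \<open>ln 0 = 0\<close>; potential theory needs \<open>log 0 = -\<infinity>\<close>.\<close>

definition log_ereal :: "real \<Rightarrow> ereal" where
  "log_ereal x = (if x \<le> 0 then -\<infinity> else ereal (ln x))"

definition exp_ereal :: "ereal \<Rightarrow> ereal" where
  "exp_ereal x = (case x of ereal r \<Rightarrow> ereal (exp r) | PInfty \<Rightarrow> \<infinity> | MInfty \<Rightarrow> 0)"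

text \<open>
  Integral of the positive part minus integral of the negative part
  (\<^const>\<open>e2ennreal\<close> maps negative values to 0). For a compactly supported finite measure, the
  positive parts of the integrands below have finite integral, so the case \<open>\<infinity> - \<infinity>\<close> does not arise.
\<close>

definition ereal_integral :: "'a measure \<Rightarrow> ('a \<Rightarrow> ereal) \<Rightarrow> ereal" where
  "ereal_integral M g =
     enn2ereal (\<integral>\<^sup>+x. e2ennreal (g x) \<partial>M) - enn2ereal (\<integral>\<^sup>+x. e2ennreal (- g x) \<partial>M)"

definition log_potential :: "complex measure \<Rightarrow> complex \<Rightarrow> ereal" where
  "log_potential \<mu> z = ereal_integral \<mu> (\<lambda>t. log_ereal (cmod (z - t)))"

definition log_energy :: "complex measure \<Rightarrow> ereal" where
  "log_energy \<mu> = ereal_integral \<mu> (log_potential \<mu>)"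

definition measure_support :: "'a::topological_space measure \<Rightarrow> 'a set" where
  "measure_support \<mu> = {z. \<forall>U. open U \<longrightarrow> z \<in> U \<longrightarrow> emeasure \<mu> U > 0}"

definition borel_probs_on :: "complex set \<Rightarrow> complex measure set" where
  "borel_probs_on K = {\<mu>. prob_space \<mu> \<and> sets \<mu> = sets borel \<and> measure_support \<mu> \<subseteq> K}"

definition set_energy :: "complex set \<Rightarrow> ereal" where
  "set_energy K = (SUP \<mu>\<in>borel_probs_on K. log_energy \<mu>)"

text \<open>
  For empty \<open>K\<close> the supremum is \<open>-\<infinity>\<close>, so the capacity is 0. For compact \<open>K\<close> the energy is
  less than \<open>\<infinity>\<close>, so the capacity is a finite non-negative number.
\<close>

definition log_capacity :: "complex set \<Rightarrow> ereal" where
  "log_capacity K = exp_ereal (set_energy K)"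

definition polar :: "complex set \<Rightarrow> bool" where
  "polar K \<longleftrightarrow> log_capacity K = 0"


section \<open>The Riemann sphere and meromorphic germs\<close>

text \<open>
  Points of the sphere are elements of \<^typ>\<open>complex option\<close>, with \<^term>\<open>None\<close> as the point at
  infinity. The complement of a plane set \<open>K\<close> in the sphere is \<open>- Some ` K\<close>.
\<close>

abbreviation riemann_sphere :: "complex option topology" where
  "riemann_sphere \<equiv> Alexandroff_compactification euclidean"

text \<open>
  As for the library's \<^const>\<open>meromorphic_on\<close>, a meromorphic function near a point is represented
  by a function \<open>complex \<Rightarrow> complex\<close> whose values at isolated points (in particular at
  poles) are irrelevant. The point at infinity is treated in the chart \<open>w = 1/z\<close>.
  Germs at \<open>p\<close> are such functions up to equality on a punctured neighbourhood of \<open>p\<close>.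
\<close>

fun punctured_nhds :: "complex option \<Rightarrow> complex filter" where
  "punctured_nhds None = at_infinity"
| "punctured_nhds (Some z) = at z"

definition same_germ :: "complex option \<Rightarrow> (complex \<Rightarrow> complex) \<Rightarrow> (complex \<Rightarrow> complex) \<Rightarrow> bool" where
  "same_germ p f g \<longleftrightarrow> eventually (\<lambda>z. f z = g z) (punctured_nhds p)"

fun meromorphic_at_point :: "(complex \<Rightarrow> complex) \<Rightarrow> complex option \<Rightarrow> bool" where
  "meromorphic_at_point f None \<longleftrightarrow> (\<lambda>w. f (inverse w)) meromorphic_on {0}"
| "meromorphic_at_point f (Some z) \<longleftrightarrow> f meromorphic_on {z}"

definition analytic_germ_at_infinity :: "(complex \<Rightarrow> complex) \<Rightarrow> bool" where
  "analytic_germ_at_infinity f \<longleftrightarrow>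
     (\<exists>g. g analytic_on {0} \<and> same_germ None f (\<lambda>z. g (inverse z)))"

text \<open>
  The germs at infinity that extend to a single-valued meromorphic function in the
  domain \<open>D\<close>, where \<open>None \<in> D\<close>.
\<close>

definition meromorphic_germs :: "complex option set \<Rightarrow> (complex \<Rightarrow> complex) set" where
  "meromorphic_germs D =
     {f. analytic_germ_at_infinity f \<and>
         (\<exists>F. (\<forall>p\<in>D. meromorphic_at_point F p) \<and> same_germ None F f)}"

text \<open>
  \<open>F t\<close> represents the germ at \<open>\<gamma> t\<close>. Being meromorphic at \<open>\<gamma> t\<close>, it is meromorphic in a
  neighbourhood of \<open>\<gamma> t\<close>, and the germs \<open>F s\<close> for \<open>s\<close> close to \<open>t\<close> are those it induces there.
\<close>

definition continuable_along :: "(real \<Rightarrow> complex option) \<Rightarrow> (complex \<Rightarrow> complex) \<Rightarrow> bool" where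
  "continuable_along \<gamma> f \<longleftrightarrow>
     (\<exists>F :: real \<Rightarrow> complex \<Rightarrow> complex.
        (\<forall>t\<in>{0..1}. meromorphic_at_point (F t) (\<gamma> t)) \<and>
        same_germ (\<gamma> 0) (F 0) f \<and>
        (\<forall>t\<in>{0..1}. \<forall>\<^sub>F s in at t within {0..1}. same_germ (\<gamma> s) (F s) (F t)))"

definition multivalued_germs :: "complex set \<Rightarrow> (complex \<Rightarrow> complex) set" where
  "multivalued_germs E =
     {f. analytic_germ_at_infinity f \<and>
         (\<forall>\<gamma>. pathin (subtopology riemann_sphere (- Some ` E)) \<gamma> \<and> \<gamma> 0 = None
               \<longrightarrow> continuable_along \<gamma> f) \<and>
         f \<notin> meromorphic_germs (- Some ` E)}"

definition admissible_compacta :: "(complex \<Rightarrow> complex) \<Rightarrow> complex set set" where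
  "admissible_compacta f =
     {K. compact K \<and> connectedin riemann_sphere (- Some ` K) \<and>
         f \<in> meromorphic_germs (- Some ` K)}"

end

theory Submission
  imports Defs "HOL-Real_Asymp.Real_Asymp" "HOL-Library.Diagonal_Subsequence"
begin

text \<open>
  The capacity \<open>cap\<close> is upper, not lower, semicontinuous under convergence of compacta, so a
  limit of a minimizing sequence may have too large a capacity: finite sets converge to a segment.
  What excludes this here is that every germ reached by continuation extends to every disc that
  misses \<open>E\<close>. If \<open>K\<close> is admissible and contains \<open>E\<close>, and a circle misses \<open>K\<close> while its disc misses
  \<open>E\<close>, then the part of \<open>K\<close> inside the circle can be deleted (\<open>admissible_Diff_ball\<close>).
  Hence a minimal admissible \<open>K \<supseteq> E\<close>, which Zorn's lemma provides, has the following property: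
  every circle whose closed disc misses \<open>E\<close> and whose open disc meets \<open>K\<close> meets \<open>K\<close> itself.

  This property controls polynomials. If \<open>p\<close> is a product of \<open>m\<close> factors \<open>z - \<zeta>\<close>, if \<open>\<bar>p\<bar> \<le> B\<close> on
  \<open>K\<close>, and if \<open>K\<close> meets all circles of radius between \<open>\<eta>\<close> and \<open>\<epsilon>\<close> about \<open>z\<close>, then
  \<open>\<bar>p z\<bar> \<le> B exp (20 m / ln (\<epsilon> / \<eta>))\<close> (\<open>polynomial_le_of_spheres_meet\<close>). Moving the zeros and
  the points of \<open>K\<close> onto one ray by \<open>\<bar>t - \<zeta>\<bar> \<ge> \<bar>\<bar>t - z\<bar> - \<bar>\<zeta> - z\<bar>\<bar>\<close> reduces this to an inequality
  for \<open>\<integral> ln \<bar>s - x\<bar> ds / s\<close>. So small polynomials on the sets of the sequence stay small on the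
  part of the limit away from \<open>E\<close>, with a loss per degree that tends to \<open>0\<close>. To turn this into
  a statement about capacity one needs that \<open>cap K\<close> is the infimum of \<open>(sup \<bar>p\<bar>)\<close> to the power
  \<open>1 / deg p\<close> over monic \<open>p\<close>, with the supremum taken over \<open>K\<close>. The bound \<open>\<le>\<close> is
  \<open>log_capacity_le_of_polynomial\<close>: a measure of finite energy yields finite sets with large
  Vandermonde product, which Lagrange interpolation bounds through \<open>p\<close>. The bound \<open>\<ge>\<close> is
  \<open>exists_polynomial_of_log_capacity_less\<close>: if no good \<open>p\<close> exists, greedily chosen (Leja)
  points are well separated, and a weak limit of their counting measures has large energy.
  The part of the limit near \<open>E\<close> is harmless, since measures of finite energy do not
  charge polar sets (\<open>log_capacity_le_of_away_from_polar\<close>).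

  The remaining points are the following. Adding \<open>E\<close> to a compactum and filling its holes does not
  change the capacity, by polarity and by the maximum modulus principle (\<open>log_capacity_Un_polar\<close>,
  \<open>log_capacity_fill\<close>), so every admissible compactum may be replaced by a minimal one that
  contains \<open>E\<close>. The circle property together with a capacity bound confines the sequence to a fixed
  disc (\<open>spheres_meet_imp_subset_cball\<close>), so a subsequence converges. The function
  extends to the unbounded component of the complement of the limit, because each compact subset of
  it is eventually disjoint from the sequence (\<open>extends_to_outside_limit_set\<close>).
\<close>

section \<open>Energy as the integral of a non-negative kernel\<close>

text \<open>
  The two halves of the integral of \<open>c - h\<close> satisfy
  \<open>h + (c - h)\<^sup>+ + c\<^sup>- = c\<^sup>+ + (c - h)\<^sup>-\<close>; all terms are non-negative and \<open>(c - h)\<^sup>+ \<le> c\<^sup>+\<close>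
  has finite integral, so integrating gives the claim also when \<open>h\<close> is not integrable.
\<close>

lemma ereal_integral_const_minus:
  assumes "prob_space M" and [measurable]: "h \<in> borel_measurable M"
    and g: "AE x in M. g x = ereal c - enn2ereal (h x)"
  shows "ereal_integral M g = ereal c - enn2ereal (\<integral>\<^sup>+x. h x \<partial>M)"
proof -
  interpret prob_space M by fact
  let ?g = "\<lambda>x. ereal c - enn2ereal (h x)"
  let ?P = "\<integral>\<^sup>+x. e2ennreal (?g x) \<partial>M" and ?N = "\<integral>\<^sup>+x. e2ennreal (- ?g x) \<partial>M"
  have PN: "(\<integral>\<^sup>+x. e2ennreal (g x) \<partial>M) = ?P" "(\<integral>\<^sup>+x. e2ennreal (- g x) \<partial>M) = ?N"
    using g by (auto intro!: nn_integral_cong_AE elim!: eventually_mono)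
  have split: "h + e2ennreal (ereal c - enn2ereal h) + ennreal (- c)
      = ennreal c + e2ennreal (- (ereal c - enn2ereal h))" for h :: ennreal
  proof (cases h rule: ennreal_cases)
    case (real r)
    then have 1: "ereal c - enn2ereal h = ereal (c - r)" by simp
    show ?thesis using real unfolding 1 e2ennreal_ereal uminus_ereal.simps
      by (cases "c \<ge> 0"; cases "c - r \<ge> 0")
        (auto simp: ennreal_neg ennreal_plus[symmetric] simp del: ennreal_plus)
  next
    case top
    then show ?thesis by simp
  qed
  have le: "e2ennreal (ereal c - enn2ereal h) \<le> ennreal c" for h :: ennreal
    by (metis e2ennreal_ereal e2ennreal_mono enn2ereal_nonneg ereal_diff_le_self)
  have Pfin: "?P \<le> ennreal c"
  proof -
    have "?P \<le> (\<integral>\<^sup>+x. ennreal c \<partial>M)"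
      by (intro nn_integral_mono le)
    then show ?thesis by (simp add: emeasure_space_1)
  qed
  have "(\<integral>\<^sup>+x. h x + e2ennreal (?g x) + ennreal (- c) \<partial>M) = (\<integral>\<^sup>+x. ennreal c + e2ennreal (- ?g x) \<partial>M)"
    by (intro nn_integral_cong split)
  then have eq: "(\<integral>\<^sup>+x. h x \<partial>M) + ?P + ennreal (- c) = ennreal c + ?N"
    by (simp add: nn_integral_add emeasure_space_1)
  obtain p where p: "?P = ennreal p" "p \<ge> 0"
    using Pfin by (cases ?P rule: ennreal_cases) (auto simp: top_unique)
  show ?thesis
  proof (cases "\<integral>\<^sup>+x. h x \<partial>M" rule: ennreal_cases)
    case (real r)
    then have eq2: "ennreal (r + p + max 0 (- c)) = ennreal c + ?N"
      using eq p real by (cases "c \<le> 0") (auto simp: max_def ennreal_neg simp flip: ennreal_plus)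
    then obtain n where n: "?N = ennreal n" "n \<ge> 0"
      by (cases ?N rule: ennreal_cases) auto
    have "ennreal (r + p + max 0 (- c)) = ennreal (max 0 c + n)"
      using eq2 n by (cases "c \<le> 0") (auto simp: max_def ennreal_neg simp flip: ennreal_plus)
    then have "r + p + max 0 (- c) = max 0 c + n"
      using real p n by (subst (asm) ennreal_inj) auto
    then show ?thesis unfolding ereal_integral_def PN using real p n by auto
  next
    case top
    then have "?N = top" using eq p ennreal_add_eq_top[of "ennreal c" ?N] by simp
    then show ?thesis unfolding ereal_integral_def PN using top p by simp
  qed
qed

text \<open>
  For points at distance at most \<open>D\<close> this is \<open>log D - log \<bar>z - w\<bar> \<in> [0, \<infinity>]\<close>. Working with this
  kernel keeps all integrals in the extended non-negative reals, where Tonelli, Fatou and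
  monotone convergence apply without integrability conditions.
\<close>

definition log_gap :: "real \<Rightarrow> complex \<Rightarrow> complex \<Rightarrow> ennreal" where
  "log_gap D z w = (if z = w then \<infinity> else ennreal (ln D - ln (cmod (z - w))))"

definition gap_energy :: "real \<Rightarrow> complex measure \<Rightarrow> ennreal" where
  "gap_energy D \<mu> = (\<integral>\<^sup>+z. \<integral>\<^sup>+w. log_gap D z w \<partial>\<mu> \<partial>\<mu>)"

lemma log_gap_commute: "log_gap D z w = log_gap D w z"
  by (simp add: log_gap_def norm_minus_commute)

lemma measurable_log_gap [measurable]:
  "(\<lambda>p. log_gap D (fst p) (snd p)) \<in> borel_measurable borel"
proof -
  have [measurable]: "(\<lambda>p::complex \<times> complex. cmod (fst p - snd p)) \<in> borel_measurable borel"
    by (intro borel_measurable_continuous_onI continuous_intros)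
  have eq: "(\<lambda>p. log_gap D (fst p) (snd p)) = (\<lambda>p. if cmod (fst p - snd p) = 0 then \<infinity>
      else ennreal (ln D - ln (cmod (fst p - snd p))))"
    by (auto simp: log_gap_def)
  show ?thesis unfolding eq by measurable
qed

lemma log_ereal_eq_gap:
  assumes "D > 0" "cmod (z - w) \<le> D"
  shows "log_ereal (cmod (z - w)) = ereal (ln D) - enn2ereal (log_gap D z w)"
  using assms by (auto simp: log_ereal_def log_gap_def)

lemma compact_diameter_bound:
  assumes "compact (K :: complex set)"
  obtains D where "D > 0" "\<And>z w. z \<in> K \<Longrightarrow> w \<in> K \<Longrightarrow> cmod (z - w) \<le> D"
proof -
  obtain D' where D': "\<And>z w. z \<in> K \<Longrightarrow> w \<in> K \<Longrightarrow> dist z w \<le> D'"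
    using compact_imp_bounded[OF assms] unfolding bounded_two_points by auto
  show ?thesis
    by (rule that[of "max 1 D'"]) (use D' in \<open>auto simp: dist_norm le_max_iff_disj\<close>)
qed

text \<open>
  The complement of the support is a countable union of null sets from a countable basis.
\<close>

lemma borel_probs_on_closed_iff:
  assumes "closed K"
  shows "\<mu> \<in> borel_probs_on K \<longleftrightarrow> prob_space \<mu> \<and> sets \<mu> = sets borel \<and> (AE z in \<mu>. z \<in> K)"
proof (cases "prob_space \<mu> \<and> sets \<mu> = sets borel")
  case True
  then interpret prob_space \<mu> by simp
  have sets[measurable_cong]: "sets \<mu> = sets borel" using True by simp
  have [simp]: "space \<mu> = UNIV" using sets_eq_imp_space_eq[OF sets] by simp
  have [measurable]: "K \<in> sets borel" using assms by simp
  have "measure_support \<mu> \<subseteq> K \<longleftrightarrow> (AE z in \<mu>. z \<in> K)"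
  proof
    assume supp: "measure_support \<mu> \<subseteq> K"
    obtain B :: "complex set set" where B: "countable B" "topological_basis B"
      using ex_countable_basis by blast
    let ?N = "{b \<in> B. emeasure \<mu> b = 0}"
    have "(\<Union>b\<in>?N. b) \<in> null_sets \<mu>"
    proof (rule null_sets_UN')
      show "countable ?N" using B(1) by (rule countable_subset[rotated]) auto
      show "b \<in> null_sets \<mu>" if "b \<in> ?N" for b
        using that topological_basis_open[OF B(2), of b] sets by (intro null_setsI) auto
    qed
    moreover have "z \<in> \<Union>?N" if "z \<notin> K" for z
    proof -
      have "z \<notin> measure_support \<mu>" using that supp by blast
      then obtain U where U: "open U" "z \<in> U" "emeasure \<mu> U = 0"
        unfolding measure_support_def mem_Collect_eq by (metis zero_less_iff_neq_zero)
      obtain b where b: "b \<in> B" "z \<in> b" "b \<subseteq> U"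
        using topological_basisE[OF B(2) U(1,2)] by metis
      have "emeasure \<mu> b \<le> emeasure \<mu> U" using b U by (intro emeasure_mono) (auto simp: sets)
      then show ?thesis using b U by auto
    qed
    ultimately show "AE z in \<mu>. z \<in> K" by (intro AE_I'[of "\<Union>b\<in>?N. b"]) auto
  next
    assume AE: "AE z in \<mu>. z \<in> K"
    have "emeasure \<mu> (- K) = 0" 
      using AE AE_iff_measurable[of "- K" \<mu> "\<lambda>z. z \<in> K"] by (auto simp: sets Compl_eq)
    then show "measure_support \<mu> \<subseteq> K"
      using assms by (auto simp: measure_support_def open_Compl)
  qed
  then show ?thesis using True by (simp add: borel_probs_on_def)
qed (auto simp: borel_probs_on_def)

lemma measurable_log_gap_integral:
  assumes "prob_space \<mu>" and sets: "sets \<mu> = sets borel"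
  shows "log_gap D z \<in> borel_measurable \<mu>"
    and "(\<lambda>z. \<integral>\<^sup>+w. log_gap D z w \<partial>\<mu>) \<in> borel_measurable \<mu>"
proof -
  interpret prob_space \<mu> by fact
  have "(\<lambda>p. log_gap D (fst p) (snd p)) \<in> borel_measurable ((borel :: complex measure) \<Otimes>\<^sub>M \<mu>)"
    by (subst measurable_cong_sets[OF sets_pair_measure_cong[OF refl sets] refl])
      (use measurable_log_gap[of D] in \<open>simp add: borel_prod\<close>)
  then have "(\<lambda>z. \<integral>\<^sup>+w. log_gap D z w \<partial>\<mu>) \<in> borel_measurable borel"
    by (intro borel_measurable_nn_integral) (simp add: split_beta')
  then show "(\<lambda>z. \<integral>\<^sup>+w. log_gap D z w \<partial>\<mu>) \<in> borel_measurable \<mu>"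
    by (simp add: measurable_cong_sets[OF sets refl])
  have "(\<lambda>w. (z, w)) \<in> borel_measurable borel" for z :: complex
    by (intro borel_measurable_continuous_onI continuous_intros)
  from measurable_compose[OF this measurable_log_gap[of D]]
  show "log_gap D z \<in> borel_measurable \<mu>"
    by (simp add: measurable_cong_sets[OF sets refl])
qed

lemma log_energy_eq_gap_energy:
  assumes "D > 0" "closed K" and mu: "\<mu> \<in> borel_probs_on K"
    and D: "\<And>z w. z \<in> K \<Longrightarrow> w \<in> K \<Longrightarrow> cmod (z - w) \<le> D"
  shows "log_energy \<mu> = ereal (ln D) - enn2ereal (gap_energy D \<mu>)"
proof -
  from mu \<open>closed K\<close> have "prob_space \<mu>" and sets[measurable_cong]: "sets \<mu> = sets borel"
    and AE: "AE z in \<mu>. z \<in> K" by (auto simp: borel_probs_on_closed_iff)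
  then interpret prob_space \<mu> by simp
  have "log_potential \<mu> z = ereal (ln D) - enn2ereal (\<integral>\<^sup>+w. log_gap D z w \<partial>\<mu>)" if "z \<in> K" for z
    unfolding log_potential_def
  proof (rule ereal_integral_const_minus[OF prob_space_axioms])
    show "log_gap D z \<in> borel_measurable \<mu>" by (rule measurable_log_gap_integral(1)[OF prob_space_axioms sets])
    show "AE w in \<mu>. log_ereal (cmod (z - w)) = ereal (ln D) - enn2ereal (log_gap D z w)"
      using AE by eventually_elim (use that assms in \<open>simp add: log_ereal_eq_gap\<close>)
  qed
  note * = this
  show ?thesis
    unfolding log_energy_def gap_energy_def
  proof (rule ereal_integral_const_minus[OF prob_space_axioms])
    show "(\<lambda>z. \<integral>\<^sup>+w. log_gap D z w \<partial>\<mu>) \<in> borel_measurable \<mu>" by (rule measurable_log_gap_integral(2)[OF prob_space_axioms sets])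
    show "AE z in \<mu>. log_potential \<mu> z = ereal (ln D) - enn2ereal (\<integral>\<^sup>+w. log_gap D z w \<partial>\<mu>)"
      using AE by eventually_elim (rule * )
  qed
qed

section \<open>Monic polynomials bound the capacity from above\<close>

lemma exists_le_nn_integral:
  assumes "prob_space M" and [measurable]: "g \<in> borel_measurable M"
    and "(\<integral>\<^sup>+x. g x \<partial>M) \<le> c" "c < \<infinity>" "AE x in M. x \<in> K"
  shows "\<exists>x\<in>K. g x \<le> c"
proof (rule ccontr)
  interpret prob_space M by fact
  assume "\<not> ?thesis"
  then have gt: "AE x in M. c < g x" using assms(5) by (auto elim!: eventually_mono simp: not_le)
  have "(\<integral>\<^sup>+x. c \<partial>M) < (\<integral>\<^sup>+x. g x \<partial>M)"
  proof (rule nn_integral_less)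
    show "(\<integral>\<^sup>+x. c \<partial>M) \<noteq> \<infinity>" using assms(4) by (simp add: emeasure_space_1)
    show "AE x in M. c \<le> g x" using gt by eventually_elim auto
    show "\<not> (AE x in M. g x \<le> c)"
    proof
      assume "AE x in M. g x \<le> c"
      with gt have "AE x in M. False" by eventually_elim auto
      then show False by simp
    qed
  qed auto
  with assms(3) show False by (simp add: emeasure_space_1)
qed

lemma sum_pairs_insert:
  fixes f :: "'a \<Rightarrow> 'a \<Rightarrow> 'b::comm_monoid_add"
  assumes "finite A" "w \<notin> A"
  shows "(\<Sum>a\<in>insert w A. \<Sum>b\<in>insert w A - {a}. f a b)
    = (\<Sum>a\<in>A. \<Sum>b\<in>A - {a}. f a b) + (\<Sum>a\<in>A. f a w) + (\<Sum>a\<in>A. f w a)"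
proof -
  have "(\<Sum>b\<in>insert w A - {a}. f a b) = f a w + (\<Sum>b\<in>A - {a}. f a b)" if "a \<in> A" for a
  proof -
    have "insert w A - {a} = insert w (A - {a})" using that assms by auto
    then show ?thesis using assms by simp
  qed
  moreover have "insert w A - {w} = A" using assms by auto
  ultimately show ?thesis using assms by (simp add: sum.distrib ac_simps)
qed

lemma prod_pairs_insert:
  fixes f :: "'a \<Rightarrow> 'a \<Rightarrow> 'b::comm_monoid_mult"
  assumes "finite A" "w \<notin> A"
  shows "(\<Prod>a\<in>insert w A. \<Prod>b\<in>insert w A - {a}. f a b)
    = (\<Prod>a\<in>A. \<Prod>b\<in>A - {a}. f a b) * (\<Prod>a\<in>A. f a w) * (\<Prod>a\<in>A. f w a)"
proof -
  have "(\<Prod>b\<in>insert w A - {a}. f a b) = f a w * (\<Prod>b\<in>A - {a}. f a b)" if "a \<in> A" for a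
  proof -
    have "insert w A - {a} = insert w (A - {a})" using that assms by auto
    then show ?thesis using assms by simp
  qed
  moreover have "insert w A - {w} = A" using assms by auto
  ultimately show ?thesis using assms by (simp add: prod.distrib ac_simps)
qed

text \<open>
  The average of the sum over \<open>n\<close> independent points is \<open>n (n - 1)\<close> times the energy, so some choice
  of points does at least as well. The points are fixed one at a time, so that only
  integrals in one variable occur: the conditional expectation of the sum, given the points already
  chosen, does not increase at a suitable next point. A finite sum forces the points to be distinct.
\<close>

lemma exists_points_gap_sum:
  assumes "prob_space \<mu>" and sets: "sets \<mu> = sets borel" and AE: "AE z in \<mu>. z \<in> K"
    and fin: "gap_energy D \<mu> < \<infinity>"
  shows "\<exists>A. finite A \<and> card A = n \<and> A \<subseteq> K \<and>
    (\<Sum>a\<in>A. \<Sum>b\<in>A - {a}. log_gap D a b) \<le> of_nat (n * (n - 1)) * gap_energy D \<mu>"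
proof -
  interpret prob_space \<mu> by fact
  define W where "W z = (\<integral>\<^sup>+w. log_gap D z w \<partial>\<mu>)" for z
  let ?I = "gap_energy D \<mu>"
  have measW: "W \<in> borel_measurable \<mu>" and measg: "\<And>z. log_gap D z \<in> borel_measurable \<mu>"
    using measurable_log_gap_integral[OF \<open>prob_space \<mu>\<close> sets, of D] by (auto simp: W_def[abs_def])
  have IW: "?I = (\<integral>\<^sup>+z. W z \<partial>\<mu>)" by (simp add: gap_energy_def W_def)
  define S where "S A = (\<Sum>a\<in>A. \<Sum>b\<in>A - {a}. log_gap D a b)" for A
  have "\<exists>A. finite A \<and> card A = k \<and> A \<subseteq> K \<and>
     S A + of_nat (2 * (n - k)) * sum W A + of_nat ((n - k) * (n - k - 1)) * ?I
       \<le> of_nat (n * (n - 1)) * ?I" if "k \<le> n" for k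
    using that
  proof (induction k)
    case 0
    show ?case by (intro exI[of _ "{}"]) (simp add: S_def)
  next
    case (Suc k)
    then obtain A where A: "finite A" "card A = k" "A \<subseteq> K"
      and le: "S A + of_nat (2 * (n - k)) * sum W A + of_nat ((n - k) * (n - k - 1)) * ?I
       \<le> of_nat (n * (n - 1)) * ?I" by auto
    obtain m where m: "n - k = Suc m" "n - Suc k = m" using Suc.prems by (cases "n - k") auto
    \<comment> \<open>The conditional expectation of the sum over all \<open>n\<close> points when \<open>w\<close> is added to \<open>A\<close>; \<open>m\<close> points
      remain to be chosen.\<close>
    define g where "g w = S A + 2 * (\<Sum>a\<in>A. log_gap D a w) + of_nat (2 * m) * (sum W A + W w)
        + of_nat (m * (m - 1)) * ?I" for w
    have measg': "g \<in> borel_measurable \<mu>" unfolding g_def using measW measg by measurable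
    have "(\<integral>\<^sup>+w. g w \<partial>\<mu>) = S A + 2 * sum W A + of_nat (2 * m) * (sum W A + ?I) + of_nat (m * (m - 1)) * ?I"
      unfolding g_def using measW measg
      by (simp add: nn_integral_add nn_integral_cmult nn_integral_sum emeasure_space_1 W_def[symmetric] IW)
    also have "\<dots> = S A + (2 + of_nat (2 * m)) * sum W A + (of_nat (2 * m) + of_nat (m * (m - 1))) * ?I"
      by (simp only: distrib_left distrib_right ac_simps)
    also have "2 + of_nat (2 * m) = (of_nat (2 * (n - k)) :: ennreal)"
      unfolding m by simp
    also have "(of_nat (2 * m) + of_nat (m * (m - 1)) :: ennreal) = of_nat ((n - k) * (n - k - 1))"
    proof -
      have "2 * m + m * (m - 1) = (n - k) * (n - k - 1)"
        unfolding m by (cases m) (auto simp: algebra_simps)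
      then show ?thesis by (metis of_nat_add)
    qed
    finally have "(\<integral>\<^sup>+w. g w \<partial>\<mu>) \<le> of_nat (n * (n - 1)) * ?I" using le by simp
    moreover have finB: "of_nat (n * (n - 1)) * ?I < \<infinity>"
      using fin by (simp add: ennreal_mult_less_top of_nat_less_top del: of_nat_mult)
    ultimately obtain w where w: "w \<in> K" "g w \<le> of_nat (n * (n - 1)) * ?I"
      using exists_le_nn_integral[OF \<open>prob_space \<mu>\<close> measg' _ _ AE] by blast
    have "g w < \<infinity>" using w(2) finB by (rule le_less_trans)
    then have "(\<Sum>a\<in>A. log_gap D a w) < \<infinity>" by (auto simp: g_def ennreal_mult_less_top)
    then have wA: "w \<notin> A" using A(1) by (auto simp: log_gap_def ennreal_sum_less_top)
    have "S (insert w A) = S A + 2 * (\<Sum>a\<in>A. log_gap D a w)"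
      unfolding S_def sum_pairs_insert[OF A(1) wA]
      by (simp add: log_gap_commute[of D w] mult_2 ac_simps)
    then have "S (insert w A) + of_nat (2 * m) * sum W (insert w A) + of_nat (m * (m - 1)) * ?I = g w"
      using A wA by (simp add: g_def ac_simps)
    then show ?case
      using A wA w by (intro exI[of _ "insert w A"]) (auto simp: m)
  qed
  from this[of n] show ?thesis by (auto simp: S_def)
qed

text \<open>
  Both sides are the coefficient of \<open>x\<^sup>n\<close> in the interpolation polynomial of \<open>P\<close> at \<open>A\<close>.
\<close>

lemma lagrange_leading_coeff:
  fixes P :: "'a::field poly"
  assumes A: "finite A" "card A = Suc n" and P: "degree P = n" "lead_coeff P = 1"
  shows "(\<Sum>a\<in>A. poly P a / (\<Prod>b\<in>A - {a}. a - b)) = 1"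
proof -
  define Q where "Q a = (\<Prod>b\<in>A - {a}. [:-b, 1:])" for a
  define c where "c a = poly P a / (\<Prod>b\<in>A - {a}. a - b)" for a
  define R where "R = (\<Sum>a\<in>A. smult (c a) (Q a))"
  have degQ: "degree (Q a) = n" if "a \<in> A" for a
    unfolding Q_def by (subst degree_prod_eq_sum_degree) (use A that in auto)
  have leadQ: "coeff (Q a) n = 1" if "a \<in> A" for a
    using degQ[OF that] lead_coeff_prod[of "\<lambda>b. [:-b, 1:]" "A - {a}"] by (simp add: Q_def)
  have polyQ: "poly (Q a) b = (if b = a then (\<Prod>b\<in>A - {a}. a - b) else 0)" if "a \<in> A" "b \<in> A" for a b
    unfolding Q_def poly_prod using A that by (auto simp: prod_zero_iff)
  have nz: "(\<Prod>b\<in>A - {a}. a - b) \<noteq> 0" if "a \<in> A" for a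
    using A by (auto simp: prod_zero_iff)
  have "poly R b = poly P b" if "b \<in> A" for b
  proof -
    have "poly R b = (\<Sum>a\<in>A. c a * poly (Q a) b)" by (simp add: R_def poly_sum)
    also have "\<dots> = (\<Sum>a\<in>A. if b = a then poly P b else 0)"
      using nz that by (intro sum.cong) (auto simp: polyQ c_def)
    finally show ?thesis using that A by simp
  qed
  moreover have "degree R \<le> n" unfolding R_def using A
    by (intro degree_sum_le) (auto simp: degQ intro: order.trans[OF degree_smult_le])
  ultimately have "R = P" using A P by (intro poly_eqI_degree[of A]) auto
  then have "1 = coeff R n" using P by simp
  also have "\<dots> = (\<Sum>a\<in>A. c a)" by (simp add: R_def coeff_sum leadQ)
  finally show ?thesis by (simp add: c_def)
qed

text \<open>
  By \<open>lagrange_leading_coeff\<close>, a set of \<open>n + 1\<close> points contains a point whose product of distances to the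
  others is at most \<open>n + 1\<close> times the norm of the polynomial of degree \<open>n\<close>. Delete that point
  and induct.
\<close>

lemma vandermonde_le:
  fixes P :: "nat \<Rightarrow> complex poly"
  assumes A: "finite A" "A \<subseteq> K" and P: "\<And>k. degree (P k) = k" "\<And>k. lead_coeff (P k) = 1"
    and B: "\<And>k z. z \<in> K \<Longrightarrow> cmod (poly (P k) z) \<le> B k"
  shows "(\<Prod>a\<in>A. \<Prod>b\<in>A - {a}. cmod (a - b)) \<le> (\<Prod>k<card A. (real (Suc k) * B k)\<^sup>2)"
  using A
proof (induction "card A" arbitrary: A)
  case 0
  then show ?case by simp
next
  case (Suc n)
  define V where "V a = (\<Prod>b\<in>A - {a}. cmod (a - b))" for a
  have Vpos: "V a > 0" for a using Suc.prems by (auto simp: V_def intro!: prod_pos)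
  obtain a0 where "a0 \<in> A" using Suc.hyps(2) by (cases "A = {}") auto
  then have Bnonneg: "B n \<ge> 0" using order.trans[OF norm_ge_zero B] Suc.prems by blast
  have "\<exists>a\<in>A. V a \<le> real (Suc n) * B n"
  proof (rule ccontr)
    assume "\<not> ?thesis"
    then have gt: "real (Suc n) * B n < V a" if "a \<in> A" for a using that by auto
    have "1 = cmod (\<Sum>a\<in>A. poly (P n) a / (\<Prod>b\<in>A - {a}. a - b))"
      using Suc P by (subst lagrange_leading_coeff[of A n]) auto
    also have "\<dots> \<le> (\<Sum>a\<in>A. cmod (poly (P n) a) / V a)"
      by (rule order.trans[OF norm_sum]) (simp add: norm_divide V_def prod_norm)
    also have "\<dots> < (\<Sum>a\<in>A. 1 / real (Suc n))"
    proof (rule sum_strict_mono)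
      fix a assume a: "a \<in> A"
      have "cmod (poly (P n) a) * real (Suc n) \<le> real (Suc n) * B n"
        using B[of a n] a Suc.prems by (simp add: mult.commute mult_left_mono subsetD)
      also have "\<dots> < V a" using gt a by simp
      finally show "cmod (poly (P n) a) / V a < 1 / real (Suc n)"
        using Vpos[of a] by (simp add: divide_simps del: of_nat_Suc)
    qed (use \<open>a0 \<in> A\<close> Suc.prems in auto)
    also have "\<dots> = 1" using Suc.hyps(2)[symmetric] by simp
    finally show False by simp
  qed
  then obtain a where a: "a \<in> A" "V a \<le> real (Suc n) * B n" by blast
  define A' where "A' = A - {a}"
  have A': "A = insert a A'" "a \<notin> A'" "finite A'" "n = card A'" "A' \<subseteq> K"
    using a Suc by (auto simp: A'_def)
  have "(\<Prod>x\<in>A. \<Prod>b\<in>A - {x}. cmod (x - b)) = (\<Prod>x\<in>A'. \<Prod>b\<in>A' - {x}. cmod (x - b)) * (V a)\<^sup>2"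
    unfolding A'(1) prod_pairs_insert[OF A'(3,2)]
    using A' by (simp add: V_def A'_def[symmetric] power2_eq_square norm_minus_commute)
  also have "\<dots> \<le> (\<Prod>k<n. (real (Suc k) * B k)\<^sup>2) * (real (Suc n) * B n)\<^sup>2"
    using Suc.hyps(1)[OF A'(4,3,5)] A'(4) a Vpos[of a]
    by (intro mult_mono power_mono) (auto intro!: prod_nonneg)
  finally show ?case using Suc.hyps(2)[symmetric] by simp
qed

lemma sum_affine_lessThan:
  "(\<Sum>k<Suc n. 2 * (a + (real k * b + c))) = real (Suc n) * (2 * a + 2 * c) + real (Suc n * n) * b"
  by (induction n) (auto simp: algebra_simps)

text \<open>
  The polynomials \<open>P\<^sup>q z\<^sup>r\<close> with \<open>r < m\<close> are monic of every degree \<open>k = q m + r\<close> and bounded by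
  a constant times \<open>M ^ k\<close>. Comparing \<open>vandermonde_le\<close> for them with the points of
  \<open>exists_points_gap_sum\<close> gives the bound up to an error of order \<open>ln n / n\<close>.
\<close>

theorem log_capacity_le_of_polynomial:
  assumes K: "compact K" and P: "degree P = m" "lead_coeff P = 1" "m \<ge> 1" and "M > 0"
    and PM: "\<And>z. z \<in> K \<Longrightarrow> cmod (poly P z) \<le> M ^ m"
  shows "log_capacity K \<le> ereal M"
proof -
  obtain D where D: "D > 0" "\<And>z w. z \<in> K \<Longrightarrow> w \<in> K \<Longrightarrow> cmod (z - w) \<le> D"
    using compact_diameter_bound[OF K] by blast
  obtain C' where C': "\<And>z. z \<in> K \<Longrightarrow> cmod z \<le> C'"
    using compact_imp_bounded[OF K] unfolding bounded_iff by auto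
  define C where "C = max M C'"
  have C: "C \<ge> M" "\<And>z. z \<in> K \<Longrightarrow> cmod z \<le> C" using C' by (auto simp: C_def le_max_iff_disj)
  define B where "B = (C / M) ^ m"
  have B1: "B \<ge> 1" unfolding B_def using C \<open>M > 0\<close> by (intro one_le_power) simp
  define Q where "Q k = P ^ (k div m) * [:0, 1:] ^ (k mod m)" for k
  have P0: "P \<noteq> 0" using P by auto
  have degQ: "degree (Q k) = k" for k
    unfolding Q_def using P P0 by (subst degree_mult_eq) (auto simp: degree_power_eq)
  have leadQ: "lead_coeff (Q k) = 1" for k
    unfolding Q_def using P by (simp only: lead_coeff_mult lead_coeff_power) simp
  have QB: "cmod (poly (Q k) z) \<le> M ^ k * B" if "z \<in> K" for k z
  proof -
    have "cmod (poly (Q k) z) = cmod (poly P z) ^ (k div m) * cmod z ^ (k mod m)"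
      by (simp add: Q_def poly_power norm_mult norm_power)
    also have "\<dots> \<le> (M ^ m) ^ (k div m) * C ^ (k mod m)"
      using PM[OF that] C(2)[OF that] \<open>M > 0\<close> by (intro mult_mono power_mono) auto
    also have "C ^ (k mod m) = M ^ (k mod m) * (C / M) ^ (k mod m)"
      using \<open>M > 0\<close> by (simp add: power_divide)
    also have "(M ^ m) ^ (k div m) * (M ^ (k mod m) * (C / M) ^ (k mod m)) = M ^ k * (C / M) ^ (k mod m)"
      by (simp add: power_mult[symmetric] power_add[symmetric] mult.assoc[symmetric])
    also have "(C / M) ^ (k mod m) \<le> B" unfolding B_def
      using C P(3) \<open>M > 0\<close> by (intro power_increasing) auto
    finally show ?thesis using \<open>M > 0\<close> by simp
  qed
  have "log_energy \<mu> \<le> ereal (ln M)" if mu: "\<mu> \<in> borel_probs_on K" for \<mu>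
  proof (cases "gap_energy D \<mu>" rule: ennreal_cases)
    case top
    then show ?thesis
      using log_energy_eq_gap_energy[OF D(1) compact_imp_closed[OF K] mu D(2)] by simp
  next
    case (real r)
    from mu have pr: "prob_space \<mu>" "sets \<mu> = sets borel" "AE z in \<mu>. z \<in> K"
      using borel_probs_on_closed_iff[OF compact_imp_closed[OF K]] by auto
    have ineq: "ln D - r \<le> ln M + (2 * ln (real (Suc n)) + 2 * ln B) / real n" if "n \<ge> 1" for n
    proof -
      let ?N = "Suc n"
      obtain A where A: "finite A" "card A = ?N" "A \<subseteq> K"
        and le: "(\<Sum>a\<in>A. \<Sum>b\<in>A - {a}. log_gap D a b) \<le> of_nat (?N * (?N - 1)) * ennreal r"
        using exists_points_gap_sum[OF pr, of D "?N"] real by auto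
      have g: "log_gap D a b = ennreal (ln D - ln (cmod (a - b)))" "ln D - ln (cmod (a - b)) \<ge> 0"
        if "a \<in> A" "b \<in> A - {a}" for a b
        using that D(2)[OF subsetD[OF A(3)] subsetD[OF A(3)], of a b] D(1) by (auto simp: log_gap_def)
      have "ennreal (\<Sum>a\<in>A. \<Sum>b\<in>A - {a}. ln D - ln (cmod (a - b)))
          = (\<Sum>a\<in>A. \<Sum>b\<in>A - {a}. log_gap D a b)"
      proof -
        have "(\<Sum>b\<in>A - {a}. log_gap D a b) = ennreal (\<Sum>b\<in>A - {a}. ln D - ln (cmod (a - b)))"
          if "a \<in> A" for a
          using g that by (subst sum_ennreal[symmetric]) (auto intro!: sum.cong)
        then have "(\<Sum>a\<in>A. \<Sum>b\<in>A - {a}. log_gap D a b)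
            = (\<Sum>a\<in>A. ennreal (\<Sum>b\<in>A - {a}. ln D - ln (cmod (a - b))))"
          by (intro sum.cong) auto
        moreover have "0 \<le> (\<Sum>b\<in>A - {a}. ln D - ln (cmod (a - b)))" if "a \<in> A" for a
          using that by (intro sum_nonneg g(2))
        ultimately show ?thesis by (simp add: sum_ennreal)
      qed
      also have "\<dots> \<le> ennreal (real (?N * n) * r)"
        using le real by (simp add: ennreal_mult'' ennreal_of_nat_eq_real_of_nat del: of_nat_mult)
      finally have "(\<Sum>a\<in>A. \<Sum>b\<in>A - {a}. ln D - ln (cmod (a - b))) \<le> real (?N * n) * r"
        using real by (subst (asm) ennreal_le_iff) auto
      moreover have "(\<Sum>a\<in>A. \<Sum>b\<in>A - {a}. ln D - ln (cmod (a - b)))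
          = real (?N * n) * ln D - ln (\<Prod>a\<in>A. \<Prod>b\<in>A - {a}. cmod (a - b))"
      proof -
        have "ln (\<Prod>b\<in>A - {a}. cmod (a - b)) = (\<Sum>b\<in>A - {a}. ln (cmod (a - b)))" for a
          using A by (subst ln_prod) auto
        then have "ln (\<Prod>a\<in>A. \<Prod>b\<in>A - {a}. cmod (a - b)) = (\<Sum>a\<in>A. \<Sum>b\<in>A - {a}. ln (cmod (a - b)))"
          using A by (subst ln_prod) (auto intro!: prod_pos)
        then show ?thesis using A by (simp add: sum_subtractf algebra_simps)
      qed
      moreover have "ln (\<Prod>a\<in>A. \<Prod>b\<in>A - {a}. cmod (a - b)) \<le> ln (\<Prod>k<?N. (real (Suc k) * (M ^ k * B))\<^sup>2)"
      proof -
        have "0 < (\<Prod>a\<in>A. \<Prod>b\<in>A - {a}. cmod (a - b))" using A(1) by (auto intro!: prod_pos)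
        moreover have "0 < (\<Prod>k<?N. (real (Suc k) * (M ^ k * B))\<^sup>2)"
          using \<open>M > 0\<close> B1 by (intro prod_pos) auto
        ultimately show ?thesis
          using vandermonde_le[OF A(1,3) degQ leadQ QB] A(2) by (subst ln_le_cancel_iff) auto
      qed
      moreover have "ln (\<Prod>k<?N. (real (Suc k) * (M ^ k * B))\<^sup>2)
          = (\<Sum>k<?N. 2 * (ln (real (Suc k)) + (real k * ln M + ln B)))"
        using \<open>M > 0\<close> B1 by (subst ln_prod) (auto simp: ln_realpow ln_mult simp del: of_nat_Suc intro!: sum.cong)
      moreover have "\<dots> \<le> (\<Sum>k<?N. 2 * (ln (real ?N) + (real k * ln M + ln B)))"
        by (intro sum_mono) auto
      moreover have "\<dots> = real ?N * (2 * ln (real ?N) + 2 * ln B) + real (?N * n) * ln M"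
        by (rule sum_affine_lessThan)
      ultimately have "real (?N * n) * (ln D - r) \<le> real ?N * (2 * ln (real ?N) + 2 * ln B) + real (?N * n) * ln M"
        by (simp add: algebra_simps)
      then have "real ?N * (real n * (ln D - r)) \<le> real ?N * (2 * ln (real ?N) + 2 * ln B + real n * ln M)"
        by (simp add: algebra_simps)
      then have "real n * (ln D - r) \<le> 2 * ln (real ?N) + 2 * ln B + real n * ln M"
        by (subst (asm) mult_le_cancel_left_pos) auto
      then show ?thesis using that by (simp add: field_simps)
    qed
    have "(\<lambda>n. ln M + (2 * ln (real (Suc n)) + 2 * ln B) / real n) \<longlonglongrightarrow> ln M"
      by real_asymp
    then have "ln D - r \<le> ln M"
      using ineq by (intro LIMSEQ_le_const) auto
    then show ?thesis using log_energy_eq_gap_energy[OF D(1) compact_imp_closed[OF K] mu D(2)] real by simp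
  qed
  then have "set_energy K \<le> ereal (ln M)" by (auto simp: set_energy_def intro: SUP_least)
  then show ?thesis using \<open>M > 0\<close>
    by (cases "set_energy K") (auto simp: log_capacity_def exp_ereal_def simp flip: ln_ge_iff)
qed

section \<open>Schoenberg's space-filling curve\<close>

text \<open>
  The part of \<open>x\<close> that is left after \<open>n\<close> binary digits, scaled back to the unit interval.
\<close>

fun binary_remainder :: "real \<Rightarrow> nat \<Rightarrow> real" where
  "binary_remainder x 0 = x"
| "binary_remainder x (Suc n) = 2 * binary_remainder x n - (if 2 * binary_remainder x n \<ge> 1 then 1 else 0)"

lemma binary_expansion:
  assumes "x \<in> {0..1::real}"
  obtains a :: "nat \<Rightarrow> real" where "range a \<subseteq> {0, 1}" "(\<lambda>k. a k / 2 ^ Suc k) sums x"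
proof -
  define a :: "nat \<Rightarrow> real" where "a k = (if 2 * binary_remainder x k \<ge> 1 then 1 else 0)" for k
  have r: "binary_remainder x n \<in> {0..1}" for n using assms by (induction n) auto
  have "(\<Sum>k<n. a k / 2 ^ Suc k) = x - binary_remainder x n / 2 ^ n" for n
    by (induction n) (auto simp: a_def field_simps)
  moreover have "(\<lambda>n. binary_remainder x n / 2 ^ n) \<longlonglongrightarrow> 0"
  proof (rule tendsto_sandwich)
    show "\<forall>\<^sub>F n in sequentially. 0 \<le> binary_remainder x n / 2 ^ n" using r by (auto intro!: always_eventually)
    show "\<forall>\<^sub>F n in sequentially. binary_remainder x n / 2 ^ n \<le> (1/2) ^ n"
      using r by (auto intro!: always_eventually simp: field_simps power_one_over)
    show "(\<lambda>n. (1/2) ^ n :: real) \<longlonglongrightarrow> 0" by (rule LIMSEQ_realpow_zero) auto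
  qed simp
  then have "(\<lambda>n. x - binary_remainder x n / 2 ^ n) \<longlonglongrightarrow> x - 0" by (intro tendsto_intros)
  ultimately have "(\<lambda>k. a k / 2 ^ Suc k) sums x" by (simp add: sums_def)
  then show ?thesis by (rule that[rotated]) (auto simp: a_def)
qed

text \<open>
  \<open>arccos (cos (\<pi> t)) / \<pi>\<close> is the triangular wave of period \<open>2\<close> that equals \<open>\<bar>t\<bar>\<close> on \<open>[-1, 1]\<close>. Thus
  \<open>tooth\<close> is \<open>0\<close> on \<open>[0, 1/3]\<close> and \<open>1\<close> on \<open>[2/3, 1]\<close>: it tells the first ternary digits \<open>0\<close> and \<open>2\<close> apart.
\<close>

definition tooth :: "real \<Rightarrow> real" where
  "tooth t = max 0 (min 1 (3 * (arccos (cos (pi * t)) / pi) - 1))"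

lemma tooth_range: "tooth t \<in> {0..1}" by (auto simp: tooth_def)

lemma continuous_tooth: "continuous_on UNIV tooth"
  unfolding tooth_def by (intro continuous_intros) auto

lemma tooth_add_even: "tooth (2 * of_int m + t) = tooth t"
proof -
  have "cos (pi * (2 * of_int m + t)) = cos (pi * t)"
    using cos.plus_of_int[of "pi * t" m] by (simp add: algebra_simps)
  then show ?thesis by (simp add: tooth_def)
qed

lemma tooth_eq:
  assumes "c = 0 \<or> c = 1" "0 \<le> r" "r \<le> 1 / 3"
  shows "tooth (2 * c / 3 + r) = c"
proof -
  have t: "0 \<le> 2 * c / 3 + r" "2 * c / 3 + r \<le> 1" using assms by auto
  then have "pi * (2 * c / 3 + r) \<le> pi" by (simp add: mult_le_cancel_left1)
  then have "arccos (cos (pi * (2 * c / 3 + r))) = pi * (2 * c / 3 + r)" using t by (intro arccos_cos) auto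
  then show ?thesis using assms by (auto simp: tooth_def)
qed

text \<open>
  Multiplication by \<open>3 ^ k\<close> shifts the ternary digits. The digits moved before the point
  contribute an even integer, which \<open>tooth\<close> does not see.
\<close>

lemma tooth_ternary:
  assumes c: "range c \<subseteq> {0, 1 :: real}"
  shows "summable (\<lambda>j. 2 * c j / 3 ^ Suc j)" "(\<Sum>j. 2 * c j / 3 ^ Suc j) \<in> {0..1}"
    "tooth (3 ^ k * (\<Sum>j. 2 * c j / 3 ^ Suc j)) = c k"
proof -
  have basic: "summable (\<lambda>j. 2 * d j / 3 ^ Suc j)" "(\<Sum>j. 2 * d j / 3 ^ Suc j) \<in> {0..1}"
    if d: "range d \<subseteq> {0, 1 :: real}" for d
  proof -
    have d': "d j = 0 \<or> d j = 1" for j using d by auto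
    have g: "(\<lambda>j. 2 / 3 * (1 / 3) ^ j) sums (2 / 3 * (1 / (1 - 1 / 3)) :: real)"
      by (intro sums_mult geometric_sums) auto
    have le: "0 \<le> 2 * d j / 3 ^ Suc j" "2 * d j / 3 ^ Suc j \<le> 2 / 3 * (1 / 3) ^ j" for j
      using d'[of j] by (auto simp: power_one_over field_simps)
    show s: "summable (\<lambda>j. 2 * d j / 3 ^ Suc j)"
    proof (rule summable_comparison_test'[OF sums_summable[OF g], of 0])
      show "norm (2 * d j / 3 ^ Suc j) \<le> 2 / 3 * (1 / 3) ^ j" for j
        using le[of j] by (simp only: real_norm_def abs_of_nonneg)
    qed
    have "(\<Sum>j. 2 * d j / 3 ^ Suc j) \<le> (\<Sum>j. 2 / 3 * (1 / 3) ^ j)"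
      by (intro suminf_le le s sums_summable[OF g])
    also have "\<dots> = 1" using sums_unique[OF g] by simp
    finally show "(\<Sum>j. 2 * d j / 3 ^ Suc j) \<in> {0..1}" using suminf_nonneg[OF s le(1)] by simp
  qed
  from basic[OF c] show "summable (\<lambda>j. 2 * c j / 3 ^ Suc j)" "(\<Sum>j. 2 * c j / 3 ^ Suc j) \<in> {0..1}" .
  show "tooth (3 ^ k * (\<Sum>j. 2 * c j / 3 ^ Suc j)) = c k"
    using c
  proof (induction k arbitrary: c)
    case 0
    have d: "range (\<lambda>j. c (Suc j)) \<subseteq> {0, 1}" using 0 by auto
    have "(\<Sum>j. 2 * c j / 3 ^ Suc j) = 2 * c 0 / 3 + (\<Sum>j. 2 * c (Suc j) / 3 ^ Suc (Suc j))"
      using suminf_split_head[OF basic(1)[OF 0]] by simp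
    also have "(\<Sum>j. 2 * c (Suc j) / 3 ^ Suc (Suc j)) = (\<Sum>j. (1 / 3) * (2 * c (Suc j) / 3 ^ Suc j))" by simp
    also have "\<dots> = (1 / 3) * (\<Sum>j. 2 * c (Suc j) / 3 ^ Suc j)" by (rule suminf_mult[OF basic(1)[OF d]])
    finally show ?case using tooth_eq[of "c 0" "1 / 3 * (\<Sum>j. 2 * c (Suc j) / 3 ^ Suc j)"] basic(2)[OF d] 0 by auto
  next
    case (Suc k)
    have d: "range (\<lambda>j. c (Suc j)) \<subseteq> {0, 1}" using Suc.prems by auto
    let ?T = "\<Sum>j. 2 * c (Suc j) / 3 ^ Suc j"
    have "(\<Sum>j. 2 * c j / 3 ^ Suc j) = 2 * c 0 / 3 + (\<Sum>j. 2 * c (Suc j) / 3 ^ Suc (Suc j))"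
      using suminf_split_head[OF basic(1)[OF Suc.prems]] by simp
    also have "(\<Sum>j. 2 * c (Suc j) / 3 ^ Suc (Suc j)) = (\<Sum>j. (1 / 3) * (2 * c (Suc j) / 3 ^ Suc j))" by simp
    also have "\<dots> = (1 / 3) * ?T" by (rule suminf_mult[OF basic(1)[OF d]])
    finally have eq: "3 ^ Suc k * (\<Sum>j. 2 * c j / 3 ^ Suc j) = 2 * (3 ^ k * c 0) + 3 ^ k * ?T"
      by (simp add: algebra_simps)
    have "c 0 = 0 \<or> c 0 = 1" using Suc.prems by auto
    then obtain m :: int where "3 ^ k * c 0 = of_int m" by (metis mult_zero_right mult_1_right of_int_0 of_int_numeral of_int_power)
    then show ?case using Suc.IH[OF d] tooth_add_even[of m "3 ^ k * ?T"] unfolding eq by simp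
  qed
qed

text \<open>
  If all ternary digits of \<open>t\<close> are \<open>0\<close> or \<open>2\<close>, the binary digits of the value for \<open>i = 0\<close> and \<open>i = 1\<close>
  are the halves of the ternary digits at the even and odd positions, respectively.
\<close>

definition schoenberg :: "nat \<Rightarrow> real \<Rightarrow> real" where
  "schoenberg i t = (\<Sum>k. tooth (3 ^ (2 * k + i) * t) / 2 ^ Suc k)"

lemma continuous_schoenberg: "continuous_on UNIV (schoenberg i)"
proof -
  have "uniform_limit UNIV (\<lambda>n t. \<Sum>k<n. tooth (3 ^ (2 * k + i) * t) / 2 ^ Suc k) (schoenberg i) sequentially"
    unfolding schoenberg_def[abs_def]
  proof (rule Weierstrass_m_test)
    show "norm (tooth (3 ^ (2 * k + i) * t) / 2 ^ Suc k) \<le> (1 / 2) ^ k" for k t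
      using tooth_range[of "3 ^ (2 * k + i) * t"] by (simp add: power_one_over field_simps)
    show "summable (\<lambda>k. (1 / 2) ^ k :: real)" by (intro summable_geometric) auto
  qed
  moreover have "continuous_on UNIV (\<lambda>t. \<Sum>k<n. tooth (3 ^ (2 * k + i) * t) / 2 ^ Suc k)" for n
    by (intro continuous_intros continuous_on_compose2[OF continuous_tooth]) auto
  ultimately show ?thesis
    by (intro uniform_limit_theorem[of _ "\<lambda>n t. \<Sum>k<n. tooth (3 ^ (2 * k + i) * t) / 2 ^ Suc k"]) auto
qed

lemma schoenberg_surj:
  assumes "x \<in> {0..1}" "y \<in> {0..1}"
  obtains t where "t \<in> {0..1}" "schoenberg 0 t = x" "schoenberg 1 t = y"
proof -
  obtain a where a: "range a \<subseteq> {0, 1::real}" "(\<lambda>k. a k / 2 ^ Suc k) sums x" using binary_expansion[OF assms(1)] .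
  obtain b where b: "range b \<subseteq> {0, 1::real}" "(\<lambda>k. b k / 2 ^ Suc k) sums y" using binary_expansion[OF assms(2)] .
  define c where "c j = (if even j then a (j div 2) else b (j div 2))" for j
  have c: "range c \<subseteq> {0, 1}" using a b by (auto simp: c_def)
  define t where "t = (\<Sum>j. 2 * c j / 3 ^ Suc j)"
  have t: "t \<in> {0..1}" "tooth (3 ^ k * t) = c k" for k
    using tooth_ternary(2,3)[OF c] unfolding t_def by auto
  show ?thesis
  proof (rule that[OF t(1)])
    show "schoenberg 0 t = x" unfolding schoenberg_def t(2) using sums_unique[OF a(2)] by (simp add: c_def)
    show "schoenberg 1 t = y" unfolding schoenberg_def t(2) using sums_unique[OF b(2)] by (simp add: c_def)
  qed
qed

text \<open>
  Such a curve transports measures from \<open>[0, 1]\<close> to a plane compactum, so that selection theorems for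
  measures on the real line become available in the plane.
\<close>

lemma compact_complex_curve:
  assumes "compact (K :: complex set)"
  obtains g :: "real \<Rightarrow> complex" where "continuous_on UNIV g" "\<And>z. z \<in> K \<Longrightarrow> \<exists>t\<in>{0..1}. g t = z"
proof -
  obtain R where R: "R > 0" "\<And>z. z \<in> K \<Longrightarrow> cmod z \<le> R"
    using compact_imp_bounded[OF assms] unfolding bounded_pos by auto
  define g where "g t = Complex (2 * R * schoenberg 0 t - R) (2 * R * schoenberg 1 t - R)" for t
  show ?thesis
  proof (rule that[of g])
    show "continuous_on UNIV g" unfolding g_def Complex_eq
      by (intro continuous_intros continuous_schoenberg)
    fix z assume "z \<in> K"
    then have "\<bar>Re z\<bar> \<le> R" "\<bar>Im z\<bar> \<le> R" using R(2) abs_Re_le_cmod abs_Im_le_cmod order.trans by blast+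
    then have "(Re z + R) / (2 * R) \<in> {0..1}" "(Im z + R) / (2 * R) \<in> {0..1}"
      using R(1) by (auto simp: field_simps)
    then obtain t where t: "t \<in> {0..1}" "schoenberg 0 t = (Re z + R) / (2 * R)" "schoenberg 1 t = (Im z + R) / (2 * R)"
      using schoenberg_surj by blast
    then have "g t = z" using R(1) by (simp add: g_def complex_eq_iff)
    then show "\<exists>t\<in>{0..1}. g t = z" using t by blast
  qed
qed

section \<open>Restriction of measures and polar sets\<close>

lemma log_capacity_le_iff:
  assumes "M > 0"
  shows "log_capacity K \<le> ereal M \<longleftrightarrow> set_energy K \<le> ereal (ln M)"
proof (cases "set_energy K")
  case (real r)
  have "exp r \<le> M \<longleftrightarrow> r \<le> ln M" using assms by (metis exp_le_cancel_iff exp_ln)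
  then show ?thesis using real by (simp add: log_capacity_def exp_ereal_def)
qed (use assms in \<open>auto simp: log_capacity_def exp_ereal_def\<close>)

lemma log_capacity_nonneg: "log_capacity K \<ge> 0"
  by (cases "set_energy K") (auto simp: log_capacity_def exp_ereal_def)

lemma exp_ereal_mono: "x \<le> y \<Longrightarrow> exp_ereal x \<le> exp_ereal y"
  by (cases x; cases y) (auto simp: exp_ereal_def)

lemma log_capacity_mono: "K \<subseteq> L \<Longrightarrow> log_capacity K \<le> log_capacity L"
  unfolding log_capacity_def set_energy_def
  by (intro exp_ereal_mono SUP_subset_mono) (auto simp: borel_probs_on_def)

lemma polar_iff_set_energy: "polar K \<longleftrightarrow> set_energy K = -\<infinity>"
  by (cases "set_energy K") (auto simp: polar_def log_capacity_def exp_ereal_def)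

text \<open>
  Normalizing the restriction to \<open>A\<close> multiplies a non-negative energy by at most \<open>\<mu>(A)\<^sup>-\<^sup>2\<close>.
\<close>

lemma gap_energy_uniform_measure_le:
  assumes "prob_space \<mu>" and sets: "sets \<mu> = sets borel" and A: "A \<in> sets borel" "emeasure \<mu> A \<noteq> 0"
  shows "gap_energy D (uniform_measure \<mu> A) \<le> gap_energy D \<mu> / emeasure \<mu> A / emeasure \<mu> A"
proof -
  interpret prob_space \<mu> by fact
  let ?a = "emeasure \<mu> A" and ?U = "uniform_measure \<mu> A"
  note m = measurable_log_gap_integral[OF \<open>prob_space \<mu>\<close> sets, of D]
  have A': "A \<in> sets \<mu>" using A sets by simp
  have U: "(\<integral>\<^sup>+x. f x \<partial>?U) = (\<integral>\<^sup>+x. f x * indicator A x \<partial>\<mu>) / ?a" if "f \<in> borel_measurable \<mu>" for f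
    using that A' by (rule nn_integral_uniform_measure)
  have le: "(\<integral>\<^sup>+x. f x \<partial>?U) \<le> (\<integral>\<^sup>+x. f x \<partial>\<mu>) / ?a" if "f \<in> borel_measurable \<mu>" for f
    unfolding U[OF that] by (intro divide_right_mono_ennreal nn_integral_mono) (auto simp: indicator_def)
  have "gap_energy D ?U \<le> (\<integral>\<^sup>+z. (\<integral>\<^sup>+w. log_gap D z w \<partial>\<mu>) / ?a \<partial>?U)"
    unfolding gap_energy_def by (intro nn_integral_mono le m)
  also have "\<dots> \<le> (\<integral>\<^sup>+z. (\<integral>\<^sup>+w. log_gap D z w \<partial>\<mu>) / ?a \<partial>\<mu>) / ?a"
    using m by (intro le) (auto intro: borel_measurable_divide_ennreal)
  also have "(\<integral>\<^sup>+z. (\<integral>\<^sup>+w. log_gap D z w \<partial>\<mu>) / ?a \<partial>\<mu>) = gap_energy D \<mu> / ?a"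
    unfolding gap_energy_def using m by (intro nn_integral_divide)
  finally show ?thesis .
qed

lemma set_energy_ge_of_restriction:
  assumes D: "D > 0" "\<And>z w. z \<in> K \<Longrightarrow> w \<in> K \<Longrightarrow> cmod (z - w) \<le> D" and "closed K"
    and mu: "\<mu> \<in> borel_probs_on K" "gap_energy D \<mu> = ennreal r" "r \<ge> 0"
    and A: "closed A" "A \<subseteq> K" "measure \<mu> A > 0"
  shows "ereal (ln D - r / (measure \<mu> A)\<^sup>2) \<le> set_energy A"
proof -
  from mu \<open>closed K\<close> have pr: "prob_space \<mu>" "sets \<mu> = sets borel"
    by (auto simp: borel_probs_on_closed_iff)
  interpret prob_space \<mu> by fact
  let ?U = "uniform_measure \<mu> A" and ?a = "measure \<mu> A"
  have a: "emeasure \<mu> A = ennreal ?a" by (simp add: emeasure_eq_measure)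
  have nz: "emeasure \<mu> A \<noteq> 0" using A a by simp
  have AE: "AE x in ?U. x \<in> A" using A pr by (intro AE_uniform_measureI) auto
  have "prob_space ?U" using nz by (intro prob_space_uniform_measure) (auto simp: a)
  then have UA: "?U \<in> borel_probs_on A"
    using A AE pr by (simp add: borel_probs_on_closed_iff)
  have gU: "gap_energy D ?U \<le> ennreal (r / ?a\<^sup>2)"
    using gap_energy_uniform_measure_le[OF pr, of A D] A nz mu
    by (simp add: a divide_ennreal power2_eq_square)
  then obtain r' where r': "gap_energy D ?U = ennreal r'" "r' \<ge> 0" "r' \<le> r / ?a\<^sup>2"
    using mu(3) by (cases "gap_energy D ?U" rule: ennreal_cases) (auto simp: top_unique)
  have "log_energy ?U = ereal (ln D - r')"
    using log_energy_eq_gap_energy[OF D(1) A(1) UA] D(2) A(2) r' by (simp add: subset_iff)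
  moreover have "log_energy ?U \<le> set_energy A" using UA by (auto simp: set_energy_def intro: SUP_upper)
  ultimately show ?thesis using r' by (metis ereal_less_eq(3) diff_left_mono order.trans)
qed

text \<open>
  Otherwise the normalized restriction to \<open>E\<close> would be a measure of finite energy on \<open>E\<close>.
\<close>

lemma finite_energy_null_polar:
  assumes "compact K" "closed E" "E \<subseteq> K" "polar E" and mu: "\<mu> \<in> borel_probs_on K" "log_energy \<mu> \<noteq> -\<infinity>"
  shows "measure \<mu> E = 0"
proof (rule ccontr)
  obtain D where D: "D > 0" "\<And>z w. z \<in> K \<Longrightarrow> w \<in> K \<Longrightarrow> cmod (z - w) \<le> D"
    using compact_diameter_bound[OF \<open>compact K\<close>] by blast
  assume "measure \<mu> E \<noteq> 0"
  then have pos: "measure \<mu> E > 0" by (simp add: less_le)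
  have cl: "closed K" using \<open>compact K\<close> by (rule compact_imp_closed)
  obtain r where r: "gap_energy D \<mu> = ennreal r" "r \<ge> 0"
    using mu(2) log_energy_eq_gap_energy[OF D(1) cl mu(1) D(2)]
    by (cases "gap_energy D \<mu>" rule: ennreal_cases) auto
  have "ereal (ln D - r / (measure \<mu> E)\<^sup>2) \<le> set_energy E"
    using D cl mu(1) r assms pos by (intro set_energy_ge_of_restriction) auto
  then show False using \<open>polar E\<close> by (simp add: polar_iff_set_energy)
qed

lemma log_capacity_Un_polar:
  assumes "compact K" "compact E" "polar E"
  shows "log_capacity (K \<union> E) = log_capacity K"
proof -
  have "log_energy \<mu> \<le> set_energy K" if mu: "\<mu> \<in> borel_probs_on (K \<union> E)" for \<mu>
  proof (cases "log_energy \<mu> = -\<infinity>")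
    case False
    then have 0: "measure \<mu> E = 0"
      using assms mu by (intro finite_energy_null_polar[of "K \<union> E"]) (auto simp: compact_imp_closed)
    have pr: "prob_space \<mu>" "sets \<mu> = sets borel" and AE: "AE z in \<mu>. z \<in> K \<union> E"
      using mu borel_probs_on_closed_iff[of "K \<union> E"] assms by (simp_all add: compact_imp_closed closed_Un)
    interpret prob_space \<mu> by fact
    have "E \<in> null_sets \<mu>"
      using 0 pr(2) assms by (intro null_setsI) (auto simp: emeasure_eq_measure compact_imp_closed)
    then have "AE z in \<mu>. z \<notin> E" by (rule AE_not_in)
    with AE have "AE z in \<mu>. z \<in> K" by eventually_elim auto
    then have "\<mu> \<in> borel_probs_on K" using pr assms by (simp add: borel_probs_on_closed_iff compact_imp_closed)
    then show ?thesis by (auto simp: set_energy_def intro: SUP_upper)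
  qed auto
  then have "set_energy (K \<union> E) \<le> set_energy K" unfolding set_energy_def[of "K \<union> E"] by (rule SUP_least)
  then have "log_capacity (K \<union> E) \<le> log_capacity K" unfolding log_capacity_def by (rule exp_ereal_mono)
  moreover have "log_capacity K \<le> log_capacity (K \<union> E)" by (intro log_capacity_mono) auto
  ultimately show ?thesis by (rule antisym)
qed

text \<open>
  A measure of finite energy gives full mass to \<open>K - E\<close>, hence mass close to \<open>1\<close> to
  \<open>K\<close> minus a small neighbourhood of \<open>E\<close>; there \<open>set_energy_ge_of_restriction\<close> applies with a loss that
  tends to \<open>0\<close>.
\<close>

lemma log_capacity_le_of_away_from_polar:
  assumes "compact K" "compact E" "E \<subseteq> K" "polar E" "M > 0"
    and away: "\<And>\<epsilon>. \<epsilon> > 0 \<Longrightarrow> log_capacity (K - (\<Union>e\<in>E. ball e \<epsilon>)) \<le> ereal M"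
  shows "log_capacity K \<le> ereal M"
proof -
  obtain D where D: "D > 0" "\<And>z w. z \<in> K \<Longrightarrow> w \<in> K \<Longrightarrow> cmod (z - w) \<le> D"
    using compact_diameter_bound[OF \<open>compact K\<close>] by blast
  have cl: "closed K" "closed E" using assms by (auto intro: compact_imp_closed)
  have "log_energy \<mu> \<le> ereal (ln M)" if mu: "\<mu> \<in> borel_probs_on K" for \<mu>
  proof (cases "log_energy \<mu> = -\<infinity>")
    case False
    have 0: "measure \<mu> E = 0" using assms mu False cl by (intro finite_energy_null_polar[of K]) auto
    obtain r where r: "gap_energy D \<mu> = ennreal r" "r \<ge> 0"
      using False log_energy_eq_gap_energy[OF D(1) cl(1) mu D(2)]
      by (cases "gap_energy D \<mu>" rule: ennreal_cases) auto
    have pr: "prob_space \<mu>" and sets: "sets \<mu> = sets borel" and AE: "AE z in \<mu>. z \<in> K"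
      using mu cl by (auto simp: borel_probs_on_closed_iff)
    interpret prob_space \<mu> by fact
    define A where "A n = K - (\<Union>e\<in>E. ball e (1 / real (Suc n)))" for n
    have Acl: "closed (A n)" for n unfolding A_def using cl by (intro closed_Diff) auto
    have "incseq A"
    proof (rule incseq_SucI)
      show "A n \<le> A (Suc n)" for n
        unfolding A_def by (intro Diff_mono order_refl UN_mono subset_ball) (auto simp: field_simps)
    qed
    then have "(\<lambda>n. measure \<mu> (A n)) \<longlonglongrightarrow> measure \<mu> (\<Union>n. A n)"
      using Acl sets by (intro finite_Lim_measure_incseq) auto
    also have "(\<Union>n. A n) = K - E"
    proof (intro equalityI subsetI)
      fix z assume z: "z \<in> K - E"
      then obtain e where e: "e > 0" "ball z e \<subseteq> - E" using cl(2) open_contains_ball by (metis Compl_iff DiffD2 open_Compl)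
      obtain n where "inverse (real (Suc n)) < e" using reals_Archimedean[OF e(1)] by blast
      then have "z \<in> A n" using z e(2) by (auto simp: A_def dist_commute inverse_eq_divide subset_iff)
      then show "z \<in> (\<Union>n. A n)" by blast
    qed (auto simp: A_def)
    also have "measure \<mu> (K - E) = 1"
    proof -
      have "E \<in> null_sets \<mu>"
        using 0 sets cl by (intro null_setsI) (auto simp: emeasure_eq_measure)
      then have "AE z in \<mu>. z \<notin> E" by (rule AE_not_in)
      with AE have "AE z in \<mu>. z \<in> K - E" by eventually_elim auto
      then show ?thesis using sets cl by (intro prob_eq_1[THEN iffD2]) auto
    qed
    finally have lim: "(\<lambda>n. measure \<mu> (A n)) \<longlonglongrightarrow> 1" .
    then have "(\<lambda>n. ln D - r / (measure \<mu> (A n))\<^sup>2) \<longlonglongrightarrow> ln D - r / 1\<^sup>2"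
      by (intro tendsto_intros) auto
    moreover have "\<forall>\<^sub>F n in sequentially. ln D - r / (measure \<mu> (A n))\<^sup>2 \<le> ln M"
    proof -
      have "\<forall>\<^sub>F n in sequentially. measure \<mu> (A n) > 0" using order_tendstoD(1)[OF lim, of 0] by simp
      then show ?thesis
      proof eventually_elim
        case (elim n)
        have "ereal (ln D - r / (measure \<mu> (A n))\<^sup>2) \<le> set_energy (A n)"
          using D cl mu r Acl elim by (intro set_energy_ge_of_restriction) (auto simp: A_def)
        also have "\<dots> \<le> ereal (ln M)"
          using away[of "1 / real (Suc n)"] \<open>M > 0\<close> by (simp add: log_capacity_le_iff A_def)
        finally show ?case by simp
      qed
    qed
    ultimately have "ln D - r / 1\<^sup>2 \<le> ln M" by (intro tendsto_upperbound) auto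
    then show ?thesis using log_energy_eq_gap_energy[OF D(1) cl(1) mu D(2)] r by simp
  qed auto
  then have "set_energy K \<le> ereal (ln M)" unfolding set_energy_def by (rule SUP_least)
  then show ?thesis using \<open>M > 0\<close> by (simp add: log_capacity_le_iff)
qed

section \<open>Monic polynomials of almost minimal norm\<close>

text \<open>
  If no monic polynomial of degree \<open>k\<close> is bounded by \<open>M ^ k\<close> on \<open>K\<close>, this holds in particular for the one
  with zeros at the points already chosen, and a point where it exceeds \<open>M ^ k\<close> is the next one.
\<close>

lemma exists_leja_points:
  assumes no: "\<And>m \<zeta>. m \<ge> 1 \<Longrightarrow> \<exists>z\<in>K. M ^ m < (\<Prod>j<m. cmod (z - \<zeta> j))"
  shows "\<exists>z :: nat \<Rightarrow> complex. (\<forall>k<n. z k \<in> K \<and> (k \<ge> 1 \<longrightarrow> M ^ k < (\<Prod>j<k. cmod (z k - z j))))"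
proof (induction n)
  case (Suc n)
  then obtain z where z: "\<And>k. k < n \<Longrightarrow> z k \<in> K"
    "\<And>k. k < n \<Longrightarrow> k \<ge> 1 \<Longrightarrow> M ^ k < (\<Prod>j<k. cmod (z k - z j))" by blast
  obtain w where w: "w \<in> K" "n \<ge> 1 \<Longrightarrow> M ^ n < (\<Prod>j<n. cmod (w - z j))"
    using no[of n z] no[of 1] by (cases "n \<ge> 1") auto
  have "(\<Prod>j<k. cmod ((z(n := w)) k - (z(n := w)) j)) = (\<Prod>j<k. cmod ((z(n := w)) k - z j))" if "k \<le> n" for k
    using that by (intro prod.cong) auto
  then show ?case
    using z w by (intro exI[of _ "z(n := w)"]) (auto simp: less_Suc_eq)
qed simp

text \<open>
  The kernel \<open>log_gap\<close> truncated at height \<open>L\<close>. Unlike \<open>log_gap\<close>, it is finite on the diagonal, where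
  counting measures have mass.
\<close>

definition cut_gap :: "real \<Rightarrow> nat \<Rightarrow> complex \<Rightarrow> complex \<Rightarrow> real" where
  "cut_gap D L z w = ln D - ln (max (cmod (z - w)) (D * exp (- real L)))"

lemma cut_gap_le:
  assumes "D > 0"
  shows "cut_gap D L z w \<le> real L" "z \<noteq> w \<Longrightarrow> cut_gap D L z w \<le> ln D - ln (cmod (z - w))"
    "cut_gap D L z w \<le> cut_gap D (Suc L) z w"
proof -
  have pos: "D * exp (- real L) > 0" "D * exp (- real (Suc L)) > 0" using assms by auto
  have "ln (D * exp (- real L)) \<le> ln (max (cmod (z - w)) (D * exp (- real L)))"
    using pos by (subst ln_le_cancel_iff) (auto simp: less_max_iff_disj)
  then show "cut_gap D L z w \<le> real L" using assms by (simp add: cut_gap_def ln_mult)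
  show "cut_gap D L z w \<le> ln D - ln (cmod (z - w))" if "z \<noteq> w"
    using that pos unfolding cut_gap_def by (simp add: less_max_iff_disj)
  have "D * exp (- real (Suc L)) \<le> D * exp (- real L)" using assms by simp
  then show "cut_gap D L z w \<le> cut_gap D (Suc L) z w"
    unfolding cut_gap_def using pos
    by (intro diff_left_mono, subst ln_le_cancel_iff) (auto simp: less_max_iff_disj intro: max.mono)
qed

lemma cut_gap_commute: "cut_gap D L z w = cut_gap D L w z"
  by (simp add: cut_gap_def norm_minus_commute)

lemma SUP_cut_gap:
  assumes "D > 0" shows "(SUP L. ennreal (cut_gap D L z w)) = log_gap D z w"
proof (rule antisym)
  show "(SUP L. ennreal (cut_gap D L z w)) \<le> log_gap D z w"
    using cut_gap_le(2)[OF assms] by (intro SUP_least) (auto simp: log_gap_def intro: ennreal_leI)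
  show "log_gap D z w \<le> (SUP L. ennreal (cut_gap D L z w))"
  proof (cases "z = w")
    case True
    then have "cut_gap D L z w = real L" for L using assms by (simp add: cut_gap_def ln_mult)
    then have "(SUP L. ennreal (cut_gap D L z w)) = (SUP L. of_nat L)" by (simp only: ennreal_of_nat_eq_real_of_nat)
    then show ?thesis by (simp only: ennreal_SUP_of_nat_eq_top top_greatest)
  next
    case False
    then have pos: "cmod (z - w) / D > 0" using assms by simp
    obtain L :: nat where L: "- ln (cmod (z - w) / D) \<le> real L" using real_arch_simple by blast
    then have "exp (- real L) \<le> exp (ln (cmod (z - w) / D))" by simp
    then have "D * exp (- real L) \<le> cmod (z - w)" using assms pos by (simp add: field_simps)
    then have "log_gap D z w = ennreal (cut_gap D L z w)" using False by (simp add: log_gap_def cut_gap_def)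
    then show ?thesis by (auto intro: SUP_upper)
  qed
qed

lemma continuous_cut_gap:
  assumes "D > 0" shows "continuous_on UNIV (\<lambda>p. cut_gap D L (fst p) (snd p))"
  unfolding cut_gap_def using assms by (intro continuous_intros) (auto simp: less_max_iff_disj max_def)

text \<open>
  By the choice of the Leja points, row \<open>k\<close> contributes at most \<open>k (ln D - ln M)\<close> on either side of the
  diagonal, and the diagonal contributes at most \<open>L\<close> per point.
\<close>

lemma leja_cut_gap_sum:
  assumes D: "D > 0" "\<And>z w. z \<in> K \<Longrightarrow> w \<in> K \<Longrightarrow> cmod (z - w) \<le> D" and M: "M > 0"
    and z: "\<And>k. k < n \<Longrightarrow> z k \<in> K" "\<And>k. k < n \<Longrightarrow> k \<ge> 1 \<Longrightarrow> M ^ k < (\<Prod>j<k. cmod (z k - z j))"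
  shows "(\<Sum>i<n. \<Sum>j<n. cut_gap D L (z i) (z j)) \<le> real n * real L + real n * real (n - 1) * (ln D - ln M)"
  using z
proof (induction n)
  case (Suc n)
  have row: "(\<Sum>j<n. cut_gap D L (z n) (z j)) \<le> real n * (ln D - ln M)"
  proof (cases "n \<ge> 1")
    case True
    then have gt: "M ^ n < (\<Prod>j<n. cmod (z n - z j))" using Suc.prems(2)[of n] by simp
    then have "(\<Prod>j<n. cmod (z n - z j)) \<noteq> 0" using M by (metis less_asym zero_less_power)
    then have ne: "z n \<noteq> z j" if "j < n" for j using that by (auto simp: prod_zero_iff)
    have "(\<Sum>j<n. cut_gap D L (z n) (z j)) \<le> (\<Sum>j<n. ln D - ln (cmod (z n - z j)))"
      using ne by (intro sum_mono cut_gap_le D) auto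
    also have "\<dots> = real n * ln D - ln (\<Prod>j<n. cmod (z n - z j))"
      using ne by (subst ln_prod) (auto simp: sum_subtractf)
    also have "ln (\<Prod>j<n. cmod (z n - z j)) \<ge> ln (M ^ n)"
      using gt M by (subst ln_le_cancel_iff) (auto intro: less_trans[OF zero_less_power])
    then have "real n * ln D - ln (\<Prod>j<n. cmod (z n - z j)) \<le> real n * ln D - real n * ln M"
      using M by (simp add: ln_realpow)
    finally show ?thesis by (simp add: algebra_simps)
  next
    case False
    then have "n = 0" by simp
    then show ?thesis by simp
  qed
  have "(\<Sum>i<Suc n. \<Sum>j<Suc n. cut_gap D L (z i) (z j))
      = (\<Sum>i<n. \<Sum>j<n. cut_gap D L (z i) (z j)) + (\<Sum>i<n. cut_gap D L (z i) (z n))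
        + (\<Sum>j<n. cut_gap D L (z n) (z j)) + cut_gap D L (z n) (z n)"
    by (simp add: sum.distrib)
  also have "(\<Sum>i<n. cut_gap D L (z i) (z n)) = (\<Sum>j<n. cut_gap D L (z n) (z j))"
    by (simp add: cut_gap_commute)
  also have "(\<Sum>i<n. \<Sum>j<n. cut_gap D L (z i) (z j)) \<le> real n * real L + real n * real (n - 1) * (ln D - ln M)"
    using Suc by simp
  also note row
  also note cut_gap_le(1)[OF D(1), of L "z n" "z n"]
  finally have "(\<Sum>i<Suc n. \<Sum>j<Suc n. cut_gap D L (z i) (z j)) \<le> real n * real L + real n * real (n - 1) * (ln D - ln M)
     + real n * (ln D - ln M) + real n * (ln D - ln M) + real L" using row by simp
  also have "\<dots> = real (Suc n) * real L + real (Suc n) * real (Suc n - 1) * (ln D - ln M)"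
    by (cases n) (auto simp: algebra_simps)
  finally show ?case .
qed simp

text \<open>
  The counting measures of the rows of \<open>z\<close> are lifted to \<open>[0, 1]\<close> along a surjective curve. There
  Helly selection gives a weakly convergent subsequence, and Skorohod's theorem replaces it by
  random variables converging pointwise. Fatou's lemma bounds the truncated energies of the limit
  measure, and the truncation is removed by monotone convergence.
\<close>

lemma energy_of_empirical_limit:
  fixes z :: "nat \<Rightarrow> nat \<Rightarrow> complex"
  assumes K: "compact K" and D: "D > 0" "\<And>z w. z \<in> K \<Longrightarrow> w \<in> K \<Longrightarrow> cmod (z - w) \<le> D"
    and z: "\<And>n i. i < Suc n \<Longrightarrow> z n i \<in> K"
    and le: "\<And>n L. (\<Sum>i<Suc n. \<Sum>j<Suc n. cut_gap D L (z n i) (z n j))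
        \<le> real (Suc n) * real L + real (Suc n) * real n * c"
    and c: "c \<ge> 0"
  shows "ereal (ln D - c) \<le> set_energy K"
proof -
  obtain g :: "real \<Rightarrow> complex" where g: "continuous_on UNIV g" "\<And>z. z \<in> K \<Longrightarrow> \<exists>t\<in>{0..1}. g t = z"
    using compact_complex_curve[OF K] by blast
  have "\<forall>n i. \<exists>t. i < Suc n \<longrightarrow> t \<in> {0..1} \<and> g t = z n i" using g(2) z by blast
  then obtain T where T: "\<And>n i. i < Suc n \<Longrightarrow> T n i \<in> {0..1::real}" "\<And>n i. i < Suc n \<Longrightarrow> g (T n i) = z n i"
    by metis
  define U where "U n = measure_pmf (pmf_of_set {..<Suc n})" for n
  define \<rho> where "\<rho> n = distr (U n) borel (T n)" for n
  have Uprob: "prob_space (U n)" for n unfolding U_def by (rule measure_pmf.prob_space_axioms)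
  have Tm: "T n \<in> measurable (U n) borel" for n by (simp add: U_def)
  have prob\<rho>: "prob_space (\<rho> n)" for n unfolding \<rho>_def using Uprob Tm by (rule prob_space.prob_space_distr)
  have AEU: "AE i in U n. i < Suc n" for n unfolding U_def by (simp add: AE_measure_pmf_iff set_pmf_of_set lessThan_empty_iff)
  have real\<rho>: "real_distribution (\<rho> n)" for n
    by (intro real_distribution.intro prob\<rho> real_distribution_axioms.intro) (simp add: \<rho>_def)
  have nn\<rho>: "(\<integral>\<^sup>+t. h t \<partial>\<rho> n) = (\<Sum>i<Suc n. h (T n i)) / of_nat (Suc n)" if "h \<in> borel_measurable borel" for h n
  proof -
    have "(\<integral>\<^sup>+t. h t \<partial>\<rho> n) = (\<integral>\<^sup>+i. h (T n i) \<partial>U n)"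
      unfolding \<rho>_def using that by (intro nn_integral_distr[OF Tm]) auto
    also have "\<dots> = (\<Sum>i<Suc n. h (T n i)) / of_nat (card {..<Suc n})"
      unfolding U_def by (intro nn_integral_pmf_of_set) (auto simp: lessThan_empty_iff)
    finally show ?thesis by simp
  qed
  have "tight \<rho>"
    unfolding tight_def
  proof (intro conjI allI impI real\<rho>)
    fix \<epsilon> :: real assume "\<epsilon> > 0"
    have "measure (\<rho> n) {-1<..1} = 1" for n
    proof -
      interpret prob_space "\<rho> n" by (rule prob\<rho>)
      have "AE i in U n. T n i \<in> {-1<..1}" using AEU
      proof eventually_elim
        case (elim i)
        then show ?case using T(1)[of i n] by simp
      qed
      then have "AE t in \<rho> n. t \<in> {-1<..1}" unfolding \<rho>_def by (subst AE_distr_iff[OF Tm]) auto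
      then show ?thesis by (intro prob_eq_1[THEN iffD2]) (auto simp: \<rho>_def)
    qed
    then show "\<exists>a b. a < b \<and> (\<forall>n. 1 - \<epsilon> < measure (\<rho> n) {a<..b})"
      using \<open>\<epsilon> > 0\<close> by (intro exI[of _ "-1"] exI[of _ 1]) auto
  qed
  from tight_imp_convergent_subsubsequence[OF this strict_mono_id]
  obtain r M where r: "strict_mono r" "real_distribution M" "weak_conv_m (\<rho> \<circ> r) M" by auto
  have "real_distribution ((\<rho> \<circ> r) n)" for n using real\<rho> by simp
  from Skorohod[OF this r(2,3)]
  obtain \<Omega> :: "real measure" and Y_seq Y where Y0: "prob_space \<Omega>" "\<forall>n. Y_seq n \<in> measurable \<Omega> borel"
    "\<forall>n. distr \<Omega> borel (Y_seq n) = (\<rho> \<circ> r) n" "Y \<in> measurable \<Omega> lborel"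
    "\<forall>x\<in>space \<Omega>. (\<lambda>n. Y_seq n x) \<longlonglongrightarrow> Y x" by blast
  have Y: "prob_space \<Omega>" "\<And>n. Y_seq n \<in> measurable \<Omega> borel"
    "\<And>n. distr \<Omega> borel (Y_seq n) = \<rho> (r n)" "Y \<in> measurable \<Omega> lborel"
    "\<And>x. x \<in> space \<Omega> \<Longrightarrow> (\<lambda>n. Y_seq n x) \<longlonglongrightarrow> Y x"
    using Y0 by (simp_all add: comp_def)
  interpret \<Omega>: prob_space \<Omega> by (rule Y(1))
  have [measurable]: "g \<in> borel_measurable borel" using g(1) by (rule borel_measurable_continuous_onI)
  have [measurable]: "Y_seq n \<in> borel_measurable \<Omega>" "Y \<in> borel_measurable \<Omega>" for n using Y(2,4) by auto
  define \<mu> where "\<mu> = distr \<Omega> borel (\<lambda>x. g (Y x))"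
  have AEn: "AE x in \<Omega>. g (Y_seq n x) \<in> K" for n
  proof -
    have [measurable]: "K \<in> sets borel" using compact_imp_closed[OF K] by simp
    have "AE i in U (r n). g (T (r n) i) \<in> K" using AEU
    proof eventually_elim
      case (elim i)
      then show ?case using T(2)[of i "r n"] z[of i "r n"] by simp
    qed
    then have "AE t in \<rho> (r n). g t \<in> K" unfolding \<rho>_def by (subst AE_distr_iff[OF Tm]) auto
    then show ?thesis unfolding Y(3)[symmetric]
      using compact_imp_closed[OF K] by (subst (asm) AE_distr_iff) auto
  qed
  have lim: "(\<lambda>n. g (Y_seq n x)) \<longlonglongrightarrow> g (Y x)" if "x \<in> space \<Omega>" for x
    using g(1) Y(5)[OF that] by (metis UNIV_I continuous_on_tendsto_compose eventually_sequentiallyI)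
  have "AE x in \<Omega>. \<forall>n. g (Y_seq n x) \<in> K" using AEn by (simp add: AE_all_countable)
  then have AEK: "AE x in \<Omega>. g (Y x) \<in> K"
    using AE_space
  proof eventually_elim
    case (elim x)
    then show ?case using closed_sequentially[OF compact_imp_closed[OF K], of "\<lambda>n. g (Y_seq n x)"] lim by auto
  qed
  have mu: "\<mu> \<in> borel_probs_on K"
    unfolding borel_probs_on_closed_iff[OF compact_imp_closed[OF K]]
  proof (intro conjI)
    show "prob_space \<mu>" unfolding \<mu>_def by (rule \<Omega>.prob_space_distr) measurable
    show "AE z in \<mu>. z \<in> K" unfolding \<mu>_def
      using AEK compact_imp_closed[OF K] by (subst AE_distr_iff) auto
  qed (simp add: \<mu>_def)
  have cm: "(\<lambda>p. cut_gap D L (fst p) (snd p)) \<in> borel_measurable borel" for L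
    using continuous_cut_gap[OF D(1)] by (rule borel_measurable_continuous_onI)
  have cg[measurable (raw)]: "(\<lambda>x. cut_gap D L (a x) (b x)) \<in> borel_measurable N"
    if "a \<in> borel_measurable N" "b \<in> borel_measurable N" for a b L and N :: "'c measure"
    using measurable_compose[OF borel_measurable_Pair[OF that] cm] by simp
  have bound: "(\<integral>\<^sup>+x. \<integral>\<^sup>+y. ennreal (cut_gap D L (g (Y x)) (g (Y y))) \<partial>\<Omega> \<partial>\<Omega>) \<le> ennreal c" for L
  proof -
    define k where "k s t = ennreal (cut_gap D L (g s) (g t))" for s t
    have km[measurable (raw)]: "(\<lambda>x. k (a x) (b x)) \<in> borel_measurable N"
      if "a \<in> borel_measurable N" "b \<in> borel_measurable N" for a b and N :: "'c measure"
      unfolding k_def using that by measurable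
    have klim: "(\<lambda>n. k (Y_seq n x) (Y_seq n y)) \<longlonglongrightarrow> k (Y x) (Y y)" if "x \<in> space \<Omega>" "y \<in> space \<Omega>" for x y
      unfolding k_def
    proof (rule tendsto_ennrealI)
      have "(\<lambda>n. (g (Y_seq n x), g (Y_seq n y))) \<longlonglongrightarrow> (g (Y x), g (Y y))"
        using lim that by (intro tendsto_Pair)
      then show "(\<lambda>n. cut_gap D L (g (Y_seq n x)) (g (Y_seq n y))) \<longlonglongrightarrow> cut_gap D L (g (Y x)) (g (Y y))"
        using continuous_on_tendsto_compose[OF continuous_cut_gap[OF D(1), of L], of "\<lambda>n. (g (Y_seq n x), g (Y_seq n y))" "(g (Y x), g (Y y))" sequentially]
        by simp
    qed
    \<comment> \<open>The diagonal contributes at most \<open>L\<close> for each of the \<open>N\<close> points, which is negligible against \<open>N\<^sup>2\<close>.\<close>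
    have In: "(\<integral>\<^sup>+x. \<integral>\<^sup>+y. k (Y_seq n x) (Y_seq n y) \<partial>\<Omega> \<partial>\<Omega>) \<le> ennreal (real L / real (Suc (r n)) + c)" for n
    proof -
      let ?n = "r n"
      let ?N = "real (Suc ?n)" and ?S = "\<Sum>i<Suc ?n. \<Sum>j<Suc ?n. cut_gap D L (z ?n i) (z ?n j)"
      let ?s = "\<lambda>i. \<Sum>j<Suc ?n. cut_gap D L (z ?n i) (z ?n j)"
      have "(\<integral>\<^sup>+x. \<integral>\<^sup>+y. k (Y_seq n x) (Y_seq n y) \<partial>\<Omega> \<partial>\<Omega>) = (\<integral>\<^sup>+x. \<integral>\<^sup>+t. k (Y_seq n x) t \<partial>\<rho> ?n \<partial>\<Omega>)"
        unfolding Y(3)[symmetric] by (subst nn_integral_distr) auto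
      also have "\<dots> = (\<integral>\<^sup>+x. (\<Sum>j<Suc ?n. k (Y_seq n x) (T ?n j)) / of_nat (Suc ?n) \<partial>\<Omega>)"
        by (intro nn_integral_cong nn\<rho>) measurable
      also have "\<dots> = (\<integral>\<^sup>+s. (\<Sum>j<Suc ?n. k s (T ?n j)) / of_nat (Suc ?n) \<partial>\<rho> ?n)"
        unfolding Y(3)[symmetric] by (subst nn_integral_distr) auto
      also have "\<dots> = (\<Sum>i<Suc ?n. (\<Sum>j<Suc ?n. k (T ?n i) (T ?n j)) / of_nat (Suc ?n)) / of_nat (Suc ?n)"
        by (intro nn\<rho>) measurable
      also have "\<dots> = ennreal (?S / ?N / ?N)"
      proof -
        have Npos: "0 < ?N" by simp
        have nonneg: "0 \<le> cut_gap D L (z ?n i) (z ?n j)" if "i < Suc ?n" "j < Suc ?n" for i j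
          unfolding cut_gap_def using D(2)[OF z z, OF that] D(1)
          by (simp add: less_max_iff_disj mult_le_cancel_left1)
        have inner: "(\<Sum>j<Suc ?n. k (T ?n i) (T ?n j)) / of_nat (Suc ?n)
            = ennreal ((?s i) / ?N)" if "i < Suc ?n" for i
        proof -
          have "(\<Sum>j<Suc ?n. k (T ?n i) (T ?n j)) = (\<Sum>j<Suc ?n. ennreal (cut_gap D L (z ?n i) (z ?n j)))"
            using that by (intro sum.cong refl) (auto simp: k_def T simp del: sum.lessThan_Suc)
          also have "\<dots> = ennreal (?s i)"
            using nonneg that by (intro sum_ennreal) auto
          finally have eq: "(\<Sum>j<Suc ?n. k (T ?n i) (T ?n j))
              = ennreal (?s i)" .
          have "0 \<le> (?s i)"
            using nonneg that by (intro sum_nonneg) auto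
          from divide_ennreal[OF this Npos] show ?thesis
            unfolding eq unfolding ennreal_of_nat_eq_real_of_nat .
        qed
        have "(\<Sum>i<Suc ?n. (\<Sum>j<Suc ?n. k (T ?n i) (T ?n j)) / of_nat (Suc ?n))
            = (\<Sum>i<Suc ?n. ennreal ((?s i) / ?N))"
          using inner by (intro sum.cong refl) auto
        also have "\<dots> = ennreal (\<Sum>i<Suc ?n. (?s i) / ?N)"
          using nonneg by (intro sum_ennreal divide_nonneg_nonneg sum_nonneg) auto
        also have "(\<Sum>i<Suc ?n. (?s i) / ?N)
            = ?S / ?N"
          by (rule sum_divide_distrib[symmetric])
        finally have eq: "(\<Sum>i<Suc ?n. (\<Sum>j<Suc ?n. k (T ?n i) (T ?n j)) / of_nat (Suc ?n))
            = ennreal (?S / ?N)" .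
        have "0 \<le> ?S / ?N"
          using nonneg by (intro divide_nonneg_nonneg sum_nonneg) auto
        from divide_ennreal[OF this Npos] show ?thesis
          unfolding eq unfolding ennreal_of_nat_eq_real_of_nat .
      qed
      also have "\<dots> \<le> ennreal (real L / ?N + c)"
      proof (rule ennreal_leI)
        have N: "?N > 0" by simp
        have "real ?n * c \<le> ?N * c" using c by (intro mult_right_mono) auto
        then have "?N * real ?n * c \<le> ?N * (?N * c)" using N by (simp only: mult.assoc mult_left_mono less_imp_le)
        then have "?S \<le> ?N * real L + ?N * (?N * c)"
          using le[where n = ?n and L = L] by linarith
        then have "?S / ?N / ?N
            \<le> (?N * real L + ?N * (?N * c)) / ?N / ?N" using N by (intro divide_right_mono) auto
        also have "\<dots> = real L / ?N + c" using N by (simp add: add_divide_distrib del: of_nat_Suc)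
        finally show "?S / ?N / ?N \<le> real L / ?N + c" .
      qed
      finally show ?thesis .
    qed
    have "(\<integral>\<^sup>+x. \<integral>\<^sup>+y. k (Y x) (Y y) \<partial>\<Omega> \<partial>\<Omega>)
        \<le> (\<integral>\<^sup>+x. liminf (\<lambda>n. \<integral>\<^sup>+y. k (Y_seq n x) (Y_seq n y) \<partial>\<Omega>) \<partial>\<Omega>)"
    proof (rule nn_integral_mono)
      fix x assume x: "x \<in> space \<Omega>"
      have "(\<integral>\<^sup>+y. k (Y x) (Y y) \<partial>\<Omega>) = (\<integral>\<^sup>+y. liminf (\<lambda>n. k (Y_seq n x) (Y_seq n y)) \<partial>\<Omega>)"
        by (intro nn_integral_cong lim_imp_Liminf[symmetric] klim[OF x]) simp_all
      also have "\<dots> \<le> liminf (\<lambda>n. \<integral>\<^sup>+y. k (Y_seq n x) (Y_seq n y) \<partial>\<Omega>)"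
        by (intro nn_integral_liminf) measurable
      finally show "(\<integral>\<^sup>+y. k (Y x) (Y y) \<partial>\<Omega>) \<le> liminf (\<lambda>n. \<integral>\<^sup>+y. k (Y_seq n x) (Y_seq n y) \<partial>\<Omega>)" .
    qed
    also have "\<dots> \<le> liminf (\<lambda>n. \<integral>\<^sup>+x. \<integral>\<^sup>+y. k (Y_seq n x) (Y_seq n y) \<partial>\<Omega> \<partial>\<Omega>)"
      by (intro nn_integral_liminf) measurable
    also have "\<dots> \<le> liminf (\<lambda>n. ennreal (real L / real (Suc (r n)) + c))"
      by (intro Liminf_mono always_eventually allI In)
    also have "\<dots> = ennreal c"
    proof (intro lim_imp_Liminf)
      have "(\<lambda>n. real L / real (Suc n) + c) \<longlonglongrightarrow> c" by real_asymp
      from LIMSEQ_subseq_LIMSEQ[OF this r(1)]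
      show "(\<lambda>n. ennreal (real L / real (Suc (r n)) + c)) \<longlonglongrightarrow> ennreal c"
        by (intro tendsto_ennrealI) (simp add: comp_def)
    qed simp
    finally show ?thesis by (simp add: k_def)
  qed
  have "gap_energy D \<mu> = (\<integral>\<^sup>+x. \<integral>\<^sup>+y. log_gap D (g (Y x)) (g (Y y)) \<partial>\<Omega> \<partial>\<Omega>)"
  proof -
    have pr: "prob_space \<mu>" "sets \<mu> = sets borel" using mu by (auto simp: borel_probs_on_def)
    note m = measurable_log_gap_integral[OF pr, of D]
    have m': "log_gap D w \<in> borel_measurable borel" "(\<lambda>z. \<integral>\<^sup>+w. log_gap D z w \<partial>\<mu>) \<in> borel_measurable borel" for w
      using m pr(2) by (auto simp: measurable_cong_sets[OF pr(2) refl])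
    have "gap_energy D \<mu> = (\<integral>\<^sup>+x. \<integral>\<^sup>+w. log_gap D (g (Y x)) w \<partial>\<mu> \<partial>\<Omega>)"
      unfolding gap_energy_def using m'(2) by (subst (1) \<mu>_def, subst nn_integral_distr) auto
    also have "\<dots> = (\<integral>\<^sup>+x. \<integral>\<^sup>+y. log_gap D (g (Y x)) (g (Y y)) \<partial>\<Omega> \<partial>\<Omega>)"
      unfolding \<mu>_def using m'(1) by (subst nn_integral_distr) auto
    finally show ?thesis .
  qed
  also have "\<dots> = (SUP L. \<integral>\<^sup>+x. \<integral>\<^sup>+y. ennreal (cut_gap D L (g (Y x)) (g (Y y))) \<partial>\<Omega> \<partial>\<Omega>)"
  proof -
    have "(\<integral>\<^sup>+y. log_gap D (g (Y x)) (g (Y y)) \<partial>\<Omega>)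
        = (SUP L. \<integral>\<^sup>+y. ennreal (cut_gap D L (g (Y x)) (g (Y y))) \<partial>\<Omega>)" for x
      unfolding SUP_cut_gap[OF D(1), symmetric]
      by (intro nn_integral_monotone_convergence_SUP incseq_SucI le_funI ennreal_leI cut_gap_le(3) D(1)) measurable
    then show ?thesis
      by (simp only:) (intro nn_integral_monotone_convergence_SUP incseq_SucI le_funI nn_integral_mono ennreal_leI cut_gap_le(3) D(1); measurable)
  qed
  also have "\<dots> \<le> ennreal c" using bound by (intro SUP_least)
  finally have gc: "gap_energy D \<mu> \<le> ennreal c" .
  then have "enn2ereal (gap_energy D \<mu>) \<le> ereal c"
    using c by (metis enn2ereal_ennreal less_eq_ennreal.rep_eq)
  moreover have "log_energy \<mu> = ereal (ln D) - enn2ereal (gap_energy D \<mu>)"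
    by (rule log_energy_eq_gap_energy[OF D(1) compact_imp_closed[OF K] mu D(2)])
  ultimately have "ereal (ln D) - ereal c \<le> log_energy \<mu>"
    using ereal_minus_mono[OF order_refl[of "ereal (ln D)"]] by (simp only:)
  also have "\<dots> \<le> set_energy K" using mu by (auto simp: set_energy_def intro: SUP_upper)
  finally show ?thesis by simp
qed

theorem exists_polynomial_of_log_capacity_less:
  assumes K: "compact K" and less: "log_capacity K < ereal M"
  shows "\<exists>m\<ge>1. \<exists>\<zeta> :: nat \<Rightarrow> complex. \<forall>z\<in>K. (\<Prod>j<m. cmod (z - \<zeta> j)) \<le> M ^ m"
proof (rule ccontr)
  assume "\<not> ?thesis"
  then have no: "\<exists>z\<in>K. M ^ m < (\<Prod>j<m. cmod (z - \<zeta> j))" if "m \<ge> 1" for m and \<zeta> :: "nat \<Rightarrow> complex"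
    using that unfolding not_le[symmetric] by blast
  have "0 < ereal M" using log_capacity_nonneg less by (rule le_less_trans)
  then have M: "M > 0" by simp
  obtain D where D: "D > 0" "\<And>z w. z \<in> K \<Longrightarrow> w \<in> K \<Longrightarrow> cmod (z - w) \<le> D"
    using compact_diameter_bound[OF K] by blast
  have "\<forall>n. \<exists>z :: nat \<Rightarrow> complex. \<forall>k<Suc n. z k \<in> K \<and> (k \<ge> 1 \<longrightarrow> M ^ k < (\<Prod>j<k. cmod (z k - z j)))"
    using exists_leja_points[of K M] no by blast
  then obtain z :: "nat \<Rightarrow> nat \<Rightarrow> complex"
    where z: "\<And>n k. k < Suc n \<Longrightarrow> z n k \<in> K"
      "\<And>n k. k < Suc n \<Longrightarrow> k \<ge> 1 \<Longrightarrow> M ^ k < (\<Prod>j<k. cmod (z n k - z n j))" by metis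
  have "M < cmod (z 1 1 - z 1 0)" using z(2)[of 1 1] by simp
  also have "\<dots> \<le> D" using z(1) by (intro D) auto
  finally have "ln M \<le> ln D" using M by simp
  have "ereal (ln D - (ln D - ln M)) \<le> set_energy K"
  proof (rule energy_of_empirical_limit[OF K D, of z])
    show "z n i \<in> K" if "i < Suc n" for n i using that by (rule z(1))
    show "(\<Sum>i<Suc n. \<Sum>j<Suc n. cut_gap D L (z n i) (z n j))
        \<le> real (Suc n) * real L + real (Suc n) * real n * (ln D - ln M)" for n L
      using leja_cut_gap_sum[OF D M, where n = "Suc n" and z = "z n" and L = L] z by (simp only: diff_Suc_1)
    show "0 \<le> ln D - ln M" using \<open>ln M \<le> ln D\<close> by simp
  qed
  then have "exp_ereal (ereal (ln M)) \<le> log_capacity K" unfolding log_capacity_def by (intro exp_ereal_mono) simp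
  then show False using less M by (simp add: exp_ereal_def)
qed

section \<open>Polynomials near sets that meet all small circles\<close>

text \<open>
  Only finiteness matters, so \<open>- ln u\<close> is estimated by the integrable function \<open>2 / sqrt u\<close>.
\<close>

lemma nn_integral_neg_ln_abs_le:
  "(\<integral>\<^sup>+u. ennreal (max 0 (- ln \<bar>u\<bar>)) \<partial>lborel) \<le> 8"
proof -
  define f :: "real \<Rightarrow> ennreal" where "f u = indicator {0..1} u * ennreal (u powr (-1/2))" for u
  have [measurable]: "f \<in> borel_measurable borel" unfolding f_def by measurable
  have "((\<lambda>u. u powr (-1/2)) has_integral (1 powr (-1/2 + 1) / (-1/2 + 1))) {0..1::real}"
    by (intro has_integral_powr_from_0) auto
  then have "((\<lambda>u. u powr (-1/2)) has_integral 2) {0..1::real}" by simp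
  then have "((\<lambda>u. if u \<in> {0..1} then u powr (-1/2) else 0) has_integral 2) (UNIV :: real set)"
    by (subst has_integral_restrict_UNIV)
  moreover have "(\<lambda>u. if u \<in> {0..1} then u powr (-1/2) else 0) = (\<lambda>u::real. indicator {0..1} u * u powr (-1/2))"
    by (auto simp: indicator_def)
  ultimately have "(\<integral>\<^sup>+u. ennreal (indicator {0..1} u * u powr (-1/2)) \<partial>lborel) = ennreal 2"
    by (intro nn_integral_has_integral_lborel) auto
  moreover have "ennreal (indicator {0..1} u * u powr (-1/2)) = f u" for u
    by (auto simp: f_def indicator_def)
  ultimately have f: "(\<integral>\<^sup>+u. f u \<partial>lborel) = 2" by simp
  have "(\<integral>\<^sup>+u. f u \<partial>lborel) = (\<integral>\<^sup>+u. f (- u) \<partial>lborel)"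
    by (subst nn_integral_real_affine[where c = "-1" and t = 0]) auto
  then have f': "(\<integral>\<^sup>+u. f (- u) \<partial>lborel) = 2" using f by simp
  have le: "ennreal (max 0 (- ln \<bar>u\<bar>)) \<le> 2 * f u + 2 * f (- u)" for u :: real
  proof (cases "u = 0 \<or> \<bar>u\<bar> > 1")
    case False
    have "ln (\<bar>u\<bar> powr (-1/2)) \<le> \<bar>u\<bar> powr (-1/2) - 1" using False by (intro ln_le_minus_one) auto
    then have "max 0 (- ln \<bar>u\<bar>) \<le> 2 * \<bar>u\<bar> powr (-1/2)" using False by (auto simp: ln_powr)
    then have *: "ennreal (max 0 (- ln \<bar>u\<bar>)) \<le> 2 * ennreal (\<bar>u\<bar> powr (-1/2))"
      by (metis ennreal_leI ennreal_mult' ennreal_numeral powr_ge_zero zero_le_numeral)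
    show ?thesis
    proof (cases "u > 0")
      case True
      then have "f u = ennreal (\<bar>u\<bar> powr (-1/2))" using False by (auto simp: f_def)
      then show ?thesis using * by (metis add_increasing2 zero_le)
    next
      case False2: False
      then have "f (- u) = ennreal (\<bar>u\<bar> powr (-1/2))" using False by (auto simp: f_def)
      then show ?thesis using * by (metis add_increasing zero_le)
    qed
  next
    case True
    then have "max 0 (- ln \<bar>u\<bar>) = 0" by auto
    then show ?thesis by simp
  qed
  have "(\<integral>\<^sup>+u. ennreal (max 0 (- ln \<bar>u\<bar>)) \<partial>lborel) \<le> (\<integral>\<^sup>+u. 2 * f u + 2 * f (- u) \<partial>lborel)"
    by (intro nn_integral_mono le)
  also have "\<dots> = 8" by (simp add: nn_integral_add nn_integral_cmult f f')
  finally show ?thesis .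
qed

text \<open>
  Near \<open>0\<close> the singularity of \<open>1 / v\<close> is compensated by \<open>- ln (1 - v) \<le> 2 v\<close>, near \<open>1\<close> the logarithm is
  integrable, and beyond \<open>2\<close> the integrand vanishes.
\<close>

lemma nn_integral_neg_ln_one_minus_le:
  "(\<integral>\<^sup>+v. ennreal (max 0 (- ln \<bar>v - 1\<bar>) * (indicator {0<..} v / v)) \<partial>lborel) \<le> 20"
proof -
  have le: "ennreal (max 0 (- ln \<bar>v - 1\<bar>) * (indicator {0<..} v / v))
      \<le> 2 * indicator {0..2} v + 2 * ennreal (max 0 (- ln \<bar>v - 1\<bar>))" for v :: real
  proof -
    have "max 0 (- ln \<bar>v - 1\<bar>) * (indicator {0<..} v / v)
      \<le> 2 * indicator {0..2} v + 2 * max 0 (- ln \<bar>v - 1\<bar>)"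
    proof (cases "v > 0 \<and> v < 1/2")
      case True
      have "ln (1 / (1 - v)) \<le> 1 / (1 - v) - 1" using True by (intro ln_le_minus_one) auto
      also have "\<dots> \<le> 2 * v" using True by (simp add: field_simps)
      finally have "- ln (1 - v) \<le> 2 * v" using True by (simp add: ln_div)
      then have "max 0 (- ln \<bar>v - 1\<bar>) \<le> 2 * v" using True by (auto simp: abs_if)
      moreover define Y where "Y = max 0 (- ln \<bar>v - 1\<bar>)"
      ultimately have Y: "Y \<le> 2 * v" "Y \<ge> 0" by simp_all
      then have "Y / v \<le> 2" using True by (subst pos_divide_le_eq) auto
      with Y have "Y * (indicator {0<..} v / v) \<le> 2 * indicator {0..2} v + 2 * Y" using True by simp
      then show ?thesis by (simp only: Y_def)
    next
      case False
      show ?thesis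
      proof (cases "v > 0")
        case True
        then have "1 / v \<le> 2" using False by (simp add: field_simps)
        then have "max 0 (- ln \<bar>v - 1\<bar>) * (1 / v) \<le> max 0 (- ln \<bar>v - 1\<bar>) * 2"
          by (intro mult_left_mono) auto
        then show ?thesis using True by (simp add: indicator_def mult.commute)
      qed auto
    qed
    then have "ennreal (max 0 (- ln \<bar>v - 1\<bar>) * (indicator {0<..} v / v))
       \<le> ennreal (2 * indicator {0..2} v + 2 * max 0 (- ln \<bar>v - 1\<bar>))" by (rule ennreal_leI)
    also have "\<dots> = 2 * indicator {0..2} v + 2 * ennreal (max 0 (- ln \<bar>v - 1\<bar>))"
      by (simp add: ennreal_plus ennreal_mult indicator_def)
    finally show ?thesis .
  qed
  have "(\<integral>\<^sup>+v. ennreal (max 0 (- ln \<bar>v - 1\<bar>)) \<partial>lborel) = (\<integral>\<^sup>+v. ennreal (max 0 (- ln \<bar>v\<bar>)) \<partial>lborel)"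
    by (subst (2) nn_integral_real_affine[where c = 1 and t = "-1"]) auto
  with nn_integral_neg_ln_abs_le
  have *: "(\<integral>\<^sup>+v. ennreal (max 0 (- ln \<bar>v - 1\<bar>)) \<partial>lborel) \<le> 8" by simp
  have "(\<integral>\<^sup>+v. ennreal (max 0 (- ln \<bar>v - 1\<bar>) * (indicator {0<..} v / v)) \<partial>lborel)
     \<le> (\<integral>\<^sup>+v. 2 * indicator {0..2} v + 2 * ennreal (max 0 (- ln \<bar>v - 1\<bar>)) \<partial>lborel)"
    by (intro nn_integral_mono le)
  also have "\<dots> = 4 + 2 * (\<integral>\<^sup>+v. ennreal (max 0 (- ln \<bar>v - 1\<bar>)) \<partial>lborel)"
    by (simp add: nn_integral_add nn_integral_cmult)
  also have "\<dots> \<le> 4 + 2 * 8" by (intro add_mono mult_mono *) auto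
  finally show ?thesis by simp
qed

text \<open>
  The finitely many exceptional points are there for the zeros of a polynomial, where the convention
  \<open>ln 0 = 0\<close> breaks pointwise inequalities between logarithms.
\<close>

lemma weighted_average_le:
  fixes w :: "real \<Rightarrow> real" and \<phi> :: "nat \<Rightarrow> real \<Rightarrow> real"
  assumes [measurable]: "w \<in> borel_measurable borel" "\<And>j. \<phi> j \<in> borel_measurable borel"
    and A: "(\<integral>\<^sup>+s. ennreal (w s) * indicator {a..b} s \<partial>lborel) = ennreal A" "A \<ge> 0"
    and \<phi>: "\<And>j s. \<phi> j s \<ge> 0" "\<And>j. j < m \<Longrightarrow> (\<integral>\<^sup>+s. ennreal (\<phi> j s) \<partial>lborel) \<le> ennreal B" "B \<ge> 0"
    and w: "\<And>s. a < s \<Longrightarrow> s < b \<Longrightarrow> w s \<ge> 0" and "finite X"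
    and le: "\<And>s. a < s \<Longrightarrow> s < b \<Longrightarrow> s \<notin> X \<Longrightarrow> G * w s \<le> (\<Sum>j<m. \<phi> j s)"
  shows "G * A \<le> real m * B"
proof -
  have "ennreal G * ennreal A = (\<integral>\<^sup>+s. ennreal G * (ennreal (w s) * indicator {a..b} s) \<partial>lborel)"
    using A(1) by (subst nn_integral_cmult) auto
  also have "\<dots> \<le> (\<integral>\<^sup>+s. (\<Sum>j<m. ennreal (\<phi> j s)) \<partial>lborel)"
  proof (rule nn_integral_mono_AE)
    have "AE s in lborel. s \<notin> {a, b} \<union> X"
      using \<open>finite X\<close> by (intro AE_not_in finite_imp_null_set_lborel) simp
    then show "AE s in lborel. ennreal G * (ennreal (w s) * indicator {a..b} s) \<le> (\<Sum>j<m. ennreal (\<phi> j s))"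
    proof eventually_elim
      case (elim s)
      show ?case
      proof (cases "s \<in> {a..b}")
        case True
        then have s: "a < s" "s < b" "s \<notin> X" using elim by auto
        have "ennreal G * ennreal (w s) = ennreal (G * w s)" using w[OF s(1,2)] by (simp add: ennreal_mult'')
        also have "\<dots> \<le> ennreal (\<Sum>j<m. \<phi> j s)" using le[OF s] by (rule ennreal_leI)
        finally show ?thesis using True \<phi>(1) by (simp add: sum_ennreal)
      qed auto
    qed
  qed
  also have "\<dots> = (\<Sum>j<m. (\<integral>\<^sup>+s. ennreal (\<phi> j s) \<partial>lborel))" by (intro nn_integral_sum) auto
  also have "\<dots> \<le> (\<Sum>j<m. ennreal B)" by (intro sum_mono \<phi>(2)) auto
  also have "\<dots> = ennreal (real m * B)" using \<phi>(3) by (simp add: ennreal_mult ennreal_of_nat_eq_real_of_nat)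
  finally have "ennreal (G * A) \<le> ennreal (real m * B)" using A(2) by (simp add: ennreal_mult'')
  then show ?thesis using \<phi>(3) by (subst (asm) ennreal_le_iff) auto
qed

text \<open>
  Average the hypothesis against \<open>ds / s\<close> on \<open>(\<eta>, R)\<close>, whose total mass is \<open>ln (R / \<eta>)\<close>. Since this
  measure is invariant under scaling, each zero \<open>x\<close> costs at most the integral of the negative part of
  \<open>ln \<bar>1 - s / x\<bar>\<close> against \<open>ds / s\<close>, a constant independent of \<open>x\<close>.
\<close>

lemma sum_ln_le_of_annulus:
  fixes x :: "nat \<Rightarrow> real"
  assumes x: "\<And>j. j < m \<Longrightarrow> x j > 0" and \<eta>: "0 < \<eta>" "\<eta> < R"
    and C: "\<And>s. \<eta> < s \<Longrightarrow> s < R \<Longrightarrow> s \<notin> x ` {..<m} \<Longrightarrow> (\<Sum>j<m. ln \<bar>s - x j\<bar>) \<le> C"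
  shows "(\<Sum>j<m. ln (x j)) \<le> C + real m * (20 / ln (R / \<eta>))"
proof -
  define G where "G = (\<Sum>j<m. ln (x j)) - C"
  define N :: "real \<Rightarrow> real" where "N v = max 0 (- ln \<bar>v - 1\<bar>)" for v
  have [measurable]: "N \<in> borel_measurable borel" unfolding N_def by measurable
  have L: "ln (R / \<eta>) > 0" using \<eta> by simp
  have le: "G \<le> (\<Sum>j<m. N (s / x j))" if s: "\<eta> < s" "s < R" "s \<notin> x ` {..<m}" for s
  proof -
    have "G \<le> (\<Sum>j<m. ln (x j)) - (\<Sum>j<m. ln \<bar>s - x j\<bar>)" using C[OF s] by (simp add: G_def)
    also have "\<dots> = (\<Sum>j<m. - ln \<bar>s / x j - 1\<bar>)"
      unfolding sum_subtractf[symmetric]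
    proof (intro sum.cong refl)
      fix j assume j: "j \<in> {..<m}"
      then have "\<bar>s / x j - 1\<bar> = \<bar>s - x j\<bar> / x j" "s \<noteq> x j"
        using x[of j] s by (auto simp: field_simps abs_if)
      then show "ln (x j) - ln \<bar>s - x j\<bar> = - ln \<bar>s / x j - 1\<bar>"
        using x[of j] j by (simp add: ln_div)
    qed
    also have "\<dots> \<le> (\<Sum>j<m. N (s / x j))" by (intro sum_mono) (simp add: N_def)
    finally show ?thesis .
  qed
  define \<phi> where "\<phi> j s = N (s / x j) * (indicator {0<..} s / s)" for j s
  have [measurable]: "\<phi> j \<in> borel_measurable borel" for j unfolding \<phi>_def by measurable
  have "G * ln (R / \<eta>) \<le> real m * 20"
  proof (rule weighted_average_le[where w = "\<lambda>s. 1 / s" and \<phi> = \<phi> and a = \<eta> and b = R and X = "x ` {..<m}"])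
    have "(\<integral>\<^sup>+s. ennreal (1 / s) * indicator {\<eta>..R} s \<partial>lborel) = ennreal (ln R - ln \<eta>)"
      using \<eta> by (intro nn_integral_FTC_Icc) (auto intro!: derivative_eq_intros)
    then show "(\<integral>\<^sup>+s. ennreal (1 / s) * indicator {\<eta>..R} s \<partial>lborel) = ennreal (ln (R / \<eta>))"
      using \<eta> by (simp add: ln_div)
    show "0 \<le> \<phi> j s" for j s by (auto simp: \<phi>_def N_def indicator_def)
    show "G * (1 / s) \<le> (\<Sum>j<m. \<phi> j s)" if s: "\<eta> < s" "s < R" "s \<notin> x ` {..<m}" for s
    proof -
      have "G / s \<le> (\<Sum>j<m. N (s / x j)) / s" using le[OF s] s(1) \<eta>(1) by (intro divide_right_mono) auto
      then show ?thesis using s(1) \<eta>(1) by (simp add: \<phi>_def sum_divide_distrib)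
    qed
    fix j assume j: "j < m"
    have "(\<integral>\<^sup>+s. ennreal (\<phi> j s) \<partial>lborel) = ennreal \<bar>x j\<bar> * (\<integral>\<^sup>+v. ennreal (\<phi> j (0 + x j * v)) \<partial>lborel)"
      using x[OF j] by (intro nn_integral_real_affine) auto
    also have "\<dots> = (\<integral>\<^sup>+v. ennreal (x j) * ennreal (\<phi> j (x j * v)) \<partial>lborel)"
      using x[OF j] by (subst nn_integral_cmult) auto
    also have "\<dots> = (\<integral>\<^sup>+v. ennreal (N v * (indicator {0<..} v / v)) \<partial>lborel)"
      using x[OF j]
      by (intro nn_integral_cong) (auto simp: \<phi>_def indicator_def zero_less_mult_iff ennreal_mult'[symmetric])
    finally show "(\<integral>\<^sup>+s. ennreal (\<phi> j s) \<partial>lborel) \<le> ennreal 20"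
      using nn_integral_neg_ln_one_minus_le by (simp add: N_def)
  qed (use \<eta> L in auto)
  then have "G \<le> real m * (20 / ln (R / \<eta>))" using L by (simp add: field_simps)
  then show ?thesis by (simp add: G_def)
qed

text \<open>
  This is the averaging argument of \<open>sum_ln_le_of_annulus\<close> with Lebesgue measure on \<open>(0, d)\<close>, which is
  translation invariant.
\<close>

lemma ln_length_le_of_interval:
  fixes x :: "nat \<Rightarrow> real"
  assumes "m \<ge> 1" "d > 0"
    and C: "\<And>s. 0 < s \<Longrightarrow> s < d \<Longrightarrow> s \<notin> x ` {..<m} \<Longrightarrow> (\<Sum>j<m. ln \<bar>s - x j\<bar>) \<le> real m * c"
  shows "ln d \<le> c + 8"
proof -
  define G where "G = real m * (ln d - c)"
  define N :: "real \<Rightarrow> real" where "N u = max 0 (- ln \<bar>u\<bar>)" for u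
  have [measurable]: "N \<in> borel_measurable borel" unfolding N_def by measurable
  have le: "G \<le> (\<Sum>j<m. N ((s - x j) / d))" if s: "0 < s" "s < d" "s \<notin> x ` {..<m}" for s
  proof -
    have "G \<le> (\<Sum>j<m. ln d) - (\<Sum>j<m. ln \<bar>s - x j\<bar>)" using C[OF s] by (simp add: G_def algebra_simps)
    also have "\<dots> = (\<Sum>j<m. - ln \<bar>(s - x j) / d\<bar>)"
      unfolding sum_subtractf[symmetric] using s \<open>d > 0\<close>
      by (intro sum.cong refl) (auto simp: ln_div abs_divide)
    also have "\<dots> \<le> (\<Sum>j<m. N ((s - x j) / d))" by (intro sum_mono) (simp add: N_def)
    finally show ?thesis .
  qed
  have "G * d \<le> real m * (d * 8)"
  proof (rule weighted_average_le[where w = "\<lambda>s. 1" and \<phi> = "\<lambda>j s. N ((s - x j) / d)" and a = 0 and b = d and X = "x ` {..<m}"])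
    fix j
    have "(\<integral>\<^sup>+s. ennreal (N ((s - x j) / d)) \<partial>lborel) = ennreal \<bar>d\<bar> * (\<integral>\<^sup>+v. ennreal (N ((x j + d * v - x j) / d)) \<partial>lborel)"
      using \<open>d > 0\<close> by (intro nn_integral_real_affine) auto
    also have "\<dots> = ennreal d * (\<integral>\<^sup>+v. ennreal (N v) \<partial>lborel)" using \<open>d > 0\<close> by simp
    also have "\<dots> \<le> ennreal d * 8"
      using nn_integral_neg_ln_abs_le by (intro mult_left_mono) (auto simp: N_def)
    finally show "(\<integral>\<^sup>+s. ennreal (N ((s - x j) / d)) \<partial>lborel) \<le> ennreal (d * 8)"
      using \<open>d > 0\<close> by (simp add: ennreal_mult')
  qed (use le \<open>d > 0\<close> in \<open>auto simp: N_def\<close>)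
  then have "(real m * d) * (ln d - c) \<le> (real m * d) * 8" by (simp add: G_def algebra_simps)
  then have "ln d - c \<le> 8" using assms(1,2) by (subst (asm) mult_le_cancel_left_pos) auto
  then show ?thesis by simp
qed

text \<open>
  Rotating the points of \<open>K\<close> and the zeros about \<open>z\<close> onto one ray does not increase distances.
\<close>

lemma sum_ln_radial_le:
  fixes \<zeta> :: "nat \<Rightarrow> complex"
  assumes B: "\<And>t. t \<in> K \<Longrightarrow> (\<Prod>j<m. cmod (t - \<zeta> j)) \<le> B" and "sphere z s \<inter> K \<noteq> {}"
    and s: "s \<notin> (\<lambda>j. cmod (\<zeta> j - z)) ` {..<m}"
  shows "(\<Sum>j<m. ln \<bar>s - cmod (\<zeta> j - z)\<bar>) \<le> ln B"
proof -
  obtain t where "t \<in> K" "t \<in> sphere z s" using assms(2) by blast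
  then have t: "t \<in> K" "cmod (t - z) = s" by (simp_all add: dist_norm norm_minus_commute)
  have pos: "\<bar>s - cmod (\<zeta> j - z)\<bar> > 0" if "j < m" for j using s that by auto
  have le: "\<bar>s - cmod (\<zeta> j - z)\<bar> \<le> cmod (t - \<zeta> j)" for j
    using norm_triangle_ineq3[of "t - z" "\<zeta> j - z"] t by simp
  have "(\<Prod>j<m. \<bar>s - cmod (\<zeta> j - z)\<bar>) \<le> (\<Prod>j<m. cmod (t - \<zeta> j))" by (intro prod_mono) (auto simp: le)
  also have "\<dots> \<le> B" by (rule B[OF t(1)])
  finally have le': "(\<Prod>j<m. \<bar>s - cmod (\<zeta> j - z)\<bar>) \<le> B" .
  have pos': "0 < (\<Prod>j<m. \<bar>s - cmod (\<zeta> j - z)\<bar>)" using pos by (intro prod_pos) auto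
  then have "0 < B" using le' by (rule less_le_trans)
  with le' pos' have "ln (\<Prod>j<m. \<bar>s - cmod (\<zeta> j - z)\<bar>) \<le> ln B" by (simp only: ln_le_cancel_iff)
  then show ?thesis using pos by (subst (asm) ln_prod) auto
qed

text \<open>
  This is a Bernstein-Walsh estimate in which connectedness of \<open>K\<close> is replaced by its consequence that
  \<open>K\<close> meets the circles about \<open>z\<close>. The growth factor per degree tends to \<open>1\<close> as \<open>\<eta> / R \<rightarrow> 0\<close>.
\<close>

lemma polynomial_le_of_spheres_meet:
  fixes \<zeta> :: "nat \<Rightarrow> complex"
  assumes B: "\<And>t. t \<in> K \<Longrightarrow> (\<Prod>j<m. cmod (t - \<zeta> j)) \<le> B" and "B > 0" "0 < \<eta>" "\<eta> < R"
    and meet: "\<And>s. \<eta> < s \<Longrightarrow> s < R \<Longrightarrow> sphere z s \<inter> K \<noteq> {}"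
  shows "(\<Prod>j<m. cmod (z - \<zeta> j)) \<le> B * exp (real m * (20 / ln (R / \<eta>)))"
proof (cases "\<exists>j<m. \<zeta> j = z")
  case True
  then obtain i where "i < m" "\<zeta> i = z" by blast
  then have "(\<Prod>j<m. cmod (z - \<zeta> j)) = 0" by (intro prod_zero bexI[of _ i]) auto
  with \<open>B > 0\<close> show ?thesis by (metis exp_gt_zero less_le mult_pos_pos)
next
  case False
  then have "(\<Sum>j<m. ln (cmod (\<zeta> j - z))) \<le> ln B + real m * (20 / ln (R / \<eta>))"
    using assms by (intro sum_ln_le_of_annulus sum_ln_radial_le[OF B]) auto
  moreover have "(\<Sum>j<m. ln (cmod (\<zeta> j - z))) = ln (\<Prod>j<m. cmod (z - \<zeta> j))"
    using False by (subst ln_prod) (auto simp: norm_minus_commute)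
  ultimately have "exp (ln (\<Prod>j<m. cmod (z - \<zeta> j))) \<le> exp (ln B + real m * (20 / ln (R / \<eta>)))" by simp
  moreover have "(\<Prod>j<m. cmod (z - \<zeta> j)) > 0" using False by (intro prod_pos) auto
  ultimately show ?thesis using \<open>B > 0\<close> by (simp add: exp_add)
qed

text \<open>
  A set that meets all circles of radius less than \<open>d\<close> about a point has capacity at least a constant
  times \<open>d\<close>; this is the polynomial form of that fact.
\<close>

lemma radius_le_of_spheres_meet:
  fixes \<zeta> :: "nat \<Rightarrow> complex"
  assumes B: "\<And>t. t \<in> K \<Longrightarrow> (\<Prod>j<m. cmod (t - \<zeta> j)) \<le> M ^ m" and "M > 0" "m \<ge> 1" "d > 0"
    and meet: "\<And>s. 0 < s \<Longrightarrow> s < d \<Longrightarrow> sphere z s \<inter> K \<noteq> {}"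
  shows "d \<le> M * exp 8"
proof -
  have "ln d \<le> ln M + 8"
    using sum_ln_radial_le[OF B meet] \<open>M > 0\<close>
    by (intro ln_length_le_of_interval[OF \<open>m \<ge> 1\<close> \<open>d > 0\<close>, of "\<lambda>j. cmod (\<zeta> j - z)"]) (simp add: ln_realpow)
  then have "exp (ln d) \<le> exp (ln M + 8)" by simp
  then show ?thesis using assms by (simp add: exp_add)
qed

section \<open>Gluing meromorphic functions and continuation in a disc\<close>

lemma eventually_at_imp_eventually_eventually_at:
  fixes z :: "'a::t1_space"
  assumes "eventually P (at z)"
  shows "eventually (\<lambda>w. eventually P (at w)) (nhds z)"
proof -
  obtain S where S: "open S" "z \<in> S" "\<And>w. w \<in> S \<Longrightarrow> w \<noteq> z \<Longrightarrow> P w"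
    using assms unfolding eventually_at_topological by blast
  have "eventually P (at w)" if "w \<in> S" for w
  proof (cases "w = z")
    case False
    then have "eventually (\<lambda>v. v \<in> S - {z}) (at w)"
      using S(1) that by (intro eventually_at_in_open') auto
    then show ?thesis by eventually_elim (use S in auto)
  qed (use assms in simp)
  moreover have "eventually (\<lambda>w. w \<in> S) (nhds z)" using S by (intro eventually_nhds_in_open)
  ultimately show ?thesis by (auto elim: eventually_mono)
qed

text \<open>
  This is \<open>same_germ (Some z)\<close>, for use with plain points of the plane.
\<close>

definition germ_eq :: "complex \<Rightarrow> (complex \<Rightarrow> complex) \<Rightarrow> (complex \<Rightarrow> complex) \<Rightarrow> bool" where
  "germ_eq z f g \<longleftrightarrow> (\<forall>\<^sub>F w in at z. f w = g w)"

lemma germ_eq_refl [simp]: "germ_eq z f f" by (simp add: germ_eq_def)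

lemma germ_eq_sym: "germ_eq z f g \<Longrightarrow> germ_eq z g f"
  unfolding germ_eq_def by (auto elim: eventually_mono)

lemma germ_eq_trans: "germ_eq z f g \<Longrightarrow> germ_eq z g h \<Longrightarrow> germ_eq z f h"
  unfolding germ_eq_def by (auto elim: eventually_elim2)

text \<open>
  Zeros of the difference cannot accumulate at \<open>z\<close> unless the difference vanishes near \<open>z\<close>.
\<close>

lemma meromorphic_germ_dichotomy:
  assumes "f meromorphic_on {z}" "g meromorphic_on {z}"
  shows "germ_eq z f g \<or> (\<forall>\<^sub>F w in at z. f w \<noteq> g w)"
proof -
  have "(\<lambda>w. f w - g w) meromorphic_on {z}" using assms by (intro meromorphic_intros)
  then have "isolated_singularity_at (\<lambda>w. f w - g w) z" "not_essential (\<lambda>w. f w - g w) z"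
    by (simp_all add: meromorphic_at_iff)
  from not_essential_frequently_0_imp_eventually_0[OF this]
  show ?thesis unfolding germ_eq_def frequently_def by auto
qed

lemma germ_eq_locally_constant:
  assumes "f meromorphic_on {z}" "g meromorphic_on {z}"
  shows "\<forall>\<^sub>F w in nhds z. germ_eq w f g \<longleftrightarrow> germ_eq z f g"
  using meromorphic_germ_dichotomy[OF assms]
proof
  assume "germ_eq z f g"
  then show ?thesis
    using eventually_at_imp_eventually_eventually_at[of "\<lambda>w. f w = g w" z]
    by (auto simp: germ_eq_def elim: eventually_mono)
next
  assume ne: "\<forall>\<^sub>F w in at z. f w \<noteq> g w"
  have *: "\<not> germ_eq w f g" if "\<forall>\<^sub>F w in at w. f w \<noteq> g w" for w
  proof
    assume "germ_eq w f g"
    with that have "\<forall>\<^sub>F w in at w. False" unfolding germ_eq_def by eventually_elim simp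
    then show False by simp
  qed
  show ?thesis
    using eventually_at_imp_eventually_eventually_at[OF ne] *[OF ne] by (auto elim!: eventually_mono simp: *)
qed

lemma meromorphic_at_point_subset: "f meromorphic_on U \<Longrightarrow> z \<in> U \<Longrightarrow> f meromorphic_on {z}"
  by (erule meromorphic_on_subset) auto

lemma germ_eq_on_connected:
  assumes "connected U" "f meromorphic_on U" "g meromorphic_on U"
    and "z \<in> U" "germ_eq z f g" "w \<in> U"
  shows "germ_eq w f g"
proof -
  have "germ_eq z f g = germ_eq w f g"
  proof (rule connected_local_const[OF assms(1,4,6)])
    show "\<forall>a\<in>U. \<forall>\<^sub>F b in at a within U. germ_eq a f g = germ_eq b f g"
    proof
      fix a assume "a \<in> U"
      then have "\<forall>\<^sub>F b in nhds a. germ_eq b f g = germ_eq a f g"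
        using assms meromorphic_at_point_subset by (intro germ_eq_locally_constant) blast+
      then show "\<forall>\<^sub>F b in at a within U. germ_eq a f g = germ_eq b f g"
        by (auto simp: eventually_at_filter elim: eventually_mono)
    qed
  qed
  with assms show ?thesis by simp
qed

text \<open>
  Uniqueness of continuation along a path: the set of parameters at which the two germs agree is
  open and closed.
\<close>

lemma germ_eq_along_path:
  fixes x :: "real \<Rightarrow> complex"
  assumes x: "continuous_on {a..b} x"
    and F: "\<And>t. t \<in> {a..b} \<Longrightarrow> F t meromorphic_on {x t}"
    and Fc: "\<And>t. t \<in> {a..b} \<Longrightarrow> \<forall>\<^sub>F s in at t within {a..b}. germ_eq (x s) (F s) (F t)"
    and g: "\<And>t. t \<in> {a..b} \<Longrightarrow> g meromorphic_on {x t}"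
    and eq: "t \<in> {a..b}" "germ_eq (x t) (F t) g" and u: "u \<in> {a..b}"
  shows "germ_eq (x u) (F u) g"
proof -
  have "germ_eq (x t) (F t) g = germ_eq (x u) (F u) g"
  proof (rule connected_local_const[of "{a..b}"])
    show "\<forall>t\<in>{a..b}. \<forall>\<^sub>F s in at t within {a..b}. germ_eq (x t) (F t) g = germ_eq (x s) (F s) g"
    proof
      fix t assume t: "t \<in> {a..b}"
      have "(x \<longlongrightarrow> x t) (at t within {a..b})" using x t by (simp add: continuous_on_def)
      then have "\<forall>\<^sub>F s in at t within {a..b}. germ_eq (x s) (F t) g \<longleftrightarrow> germ_eq (x t) (F t) g"
        using germ_eq_locally_constant[OF F[OF t] g[OF t]] by (rule eventually_compose_filterlim[rotated])
      with Fc[OF t] show "\<forall>\<^sub>F s in at t within {a..b}. germ_eq (x t) (F t) g = germ_eq (x s) (F s) g"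
        by eventually_elim (meson germ_eq_sym germ_eq_trans)
    qed
  qed (use eq u in auto)
  with eq show ?thesis by simp
qed

text \<open>
  Values at isolated points are irrelevant for the given functions, so they need not agree
  pointwise. The function \<open>remove_sings\<close> turns each germ into a canonical value, and
  canonical values do agree.
\<close>

lemma glue_meromorphic:
  assumes op: "\<And>U F. (U, F) \<in> \<F> \<Longrightarrow> open U" and mero: "\<And>U F. (U, F) \<in> \<F> \<Longrightarrow> F meromorphic_on U"
    and agree: "\<And>U F V G z. (U, F) \<in> \<F> \<Longrightarrow> (V, G) \<in> \<F> \<Longrightarrow> z \<in> U \<Longrightarrow> z \<in> V \<Longrightarrow> germ_eq z F G"
  obtains H where "H meromorphic_on (\<Union>(U, F)\<in>\<F>. U)"
    and "\<And>U F z. (U, F) \<in> \<F> \<Longrightarrow> z \<in> U \<Longrightarrow> H z = remove_sings F z"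
    and "\<And>U F z. (U, F) \<in> \<F> \<Longrightarrow> z \<in> U \<Longrightarrow> germ_eq z H F"
proof -
  define H where "H z = remove_sings (snd (SOME P. P \<in> \<F> \<and> z \<in> fst P)) z" for z
  have H: "H z = remove_sings F z" if UF: "(U, F) \<in> \<F>" "z \<in> U" for U F z
  proof -
    let ?P = "SOME P. P \<in> \<F> \<and> z \<in> fst P"
    have "?P \<in> \<F> \<and> z \<in> fst ?P" by (rule someI[of _ "(U, F)"]) (use UF in auto)
    then have "germ_eq z (snd ?P) F" using agree[of "fst ?P" "snd ?P" U F z] UF by auto
    then show ?thesis unfolding H_def germ_eq_def by (rule remove_sings_cong) simp
  qed
  have germ: "germ_eq z H F" if UF: "(U, F) \<in> \<F>" "z \<in> U" for U F z
  proof -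
    have "isolated_singularity_at F z"
      using meromorphic_at_point_subset[OF mero[OF UF(1)] UF(2)] by (simp add: meromorphic_at_iff)
    then have "\<forall>\<^sub>F w in at z. remove_sings F w = F w" by (rule eventually_remove_sings_eq_at)
    moreover have "\<forall>\<^sub>F w in at z. w \<in> U" using op[OF UF(1)] UF(2) by (intro eventually_at_in_open') auto
    ultimately show ?thesis unfolding germ_eq_def by eventually_elim (simp add: H[OF UF(1)])
  qed
  have "H meromorphic_on {z}" if UF: "(U, F) \<in> \<F>" "z \<in> U" for U F z
    using meromorphic_on_cong[of "{z}" H F "{z}"] germ[OF UF] meromorphic_at_point_subset[OF mero[OF UF(1)] UF(2)]
    by (auto simp: germ_eq_def)
  then have "H meromorphic_on (\<Union>(U, F)\<in>\<F>. U)"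
    by (subst meromorphic_on_meromorphic_at) auto
  then show ?thesis using that H germ by blast
qed

definition continuable_on_segment :: "complex \<Rightarrow> complex \<Rightarrow> (complex \<Rightarrow> complex) \<Rightarrow> bool" where
  "continuable_on_segment p q g \<longleftrightarrow>
     (\<exists>H. (\<forall>t\<in>{0..1}. H t meromorphic_on {p + complex_of_real t * (q - p)}) \<and> germ_eq p (H 0) g \<and>
       (\<forall>t\<in>{0..1}. \<forall>\<^sub>F s in at t within {0..1}. germ_eq (p + complex_of_real s * (q - p)) (H s) (H t)))"

text \<open>
  The discs \<open>B r\<close> are the images of the disc under the homotheties with centre \<open>p\<close>. Continuation along
  the segment from \<open>p\<close> to a boundary point \<open>q\<close> of \<open>B r\<close> yields a germ at \<open>q\<close> that continues \<open>G\<close>. The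
  germs at two boundary points agree where their discs overlap: by strict convexity the
  overlap contains a point of \<open>B r\<close>, where both agree with \<open>G\<close>. By compactness of the boundary the
  union of these discs contains a larger \<open>B r'\<close>.
\<close>

lemma monodromy_disc_enlarge:
  fixes p c :: complex and R :: real
  defines "B \<equiv> \<lambda>r. ball (p + complex_of_real r * (c - p)) (r * R)"
  assumes p: "dist p c < R"
    and cont: "\<And>q. q \<in> ball c R \<Longrightarrow> continuable_on_segment p q g"
    and r: "0 < r" "r < 1" and G: "G meromorphic_on B r" "germ_eq p G g"
  shows "\<exists>r'. r < r' \<and> r' \<le> 1 \<and> (\<exists>G. G meromorphic_on B r' \<and> germ_eq p G g)"
proof -
  define x where "x q t = p + complex_of_real t * (q - p)" for q t
  let ?c = "p + complex_of_real r * (c - p)"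
  have pc: "cmod (c - p) < R" using p by (simp add: dist_norm norm_minus_commute)
  then have R: "R > 0" by (meson norm_ge_zero le_less_trans)
  have pB: "dist ?c p < r * R" using pc r by (simp add: dist_norm norm_mult)
  have qB: "q \<in> ball c R" if "q \<in> sphere ?c (r * R)" for q
  proof -
    have "c - q = (?c - q) + complex_of_real (1 - r) * (c - p)" by (simp add: algebra_simps)
    then have "cmod (c - q) \<le> cmod (?c - q) + (1 - r) * cmod (c - p)"
      using norm_triangle_ineq[of "?c - q" "complex_of_real (1 - r) * (c - p)"] r
      by (simp only: norm_mult norm_of_real; simp)
    also have "\<dots> < r * R + (1 - r) * R" using that pc r by (intro add_le_less_mono) (auto simp: dist_norm)
    finally show ?thesis by (simp add: dist_norm algebra_simps)
  qed
  have "\<exists>\<epsilon> h. \<epsilon> > 0 \<and> h meromorphic_on ball q \<epsilon> \<and> (\<forall>z\<in>ball q \<epsilon> \<inter> B r. germ_eq z h G)"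
    if q: "q \<in> sphere ?c (r * R)" for q
  proof -
    from cont[OF qB[OF q], unfolded continuable_on_segment_def, folded x_def]
    obtain H where H': "\<forall>t\<in>{0..1}. H t meromorphic_on {x q t}" "germ_eq p (H 0) g"
      "\<forall>t\<in>{0..1}. \<forall>\<^sub>F s in at t within {0..1}. germ_eq (x q s) (H s) (H t)"
      by (elim exE conjE)
    note H = bspec[OF H'(1)] H'(2) bspec[OF H'(3)]
    have xB: "x q t \<in> B r" if t: "0 \<le> t" "t < 1" for t
    proof -
      have "?c - x q t = complex_of_real (1 - t) * (?c - p) + complex_of_real t * (?c - q)"
        by (simp add: x_def algebra_simps)
      then have "cmod (?c - x q t) \<le> (1 - t) * cmod (?c - p) + t * cmod (?c - q)"
        using norm_triangle_ineq[of "complex_of_real (1 - t) * (?c - p)" "complex_of_real t * (?c - q)"] t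
        by (simp only: norm_mult norm_of_real; simp)
      also have "\<dots> < (1 - t) * (r * R) + t * (r * R)" using q pB t
        by (intro add_less_le_mono mult_strict_left_mono mult_left_mono) (auto simp: dist_norm)
      finally show ?thesis by (simp add: B_def dist_norm algebra_simps)
    qed
    have x1: "x q 1 = q" by (simp add: x_def)
    obtain V where V: "open V" "{q} \<subseteq> V" "H 1 meromorphic_on V"
      using meromorphic_on_open_nhd[OF H(1)[of 1]] x1 by auto
    then obtain \<epsilon> where \<epsilon>: "\<epsilon> > 0" "ball q \<epsilon> \<subseteq> V" by (metis insert_subset openE)
    have xcont: "continuous_on S (x q)" for S unfolding x_def by (intro continuous_intros)
    have "(x q \<longlongrightarrow> q) (at 1 within {0..1})"
      using xcont[of UNIV] x1 by (metis UNIV_I continuous_on_eq_continuous_within continuous_within tendsto_within_subset top_greatest)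
    then have "\<forall>\<^sub>F s in at 1 within {0..1}. x q s \<in> ball q \<epsilon>"
      using \<epsilon> by (intro topological_tendstoD) auto
    moreover have "\<forall>\<^sub>F s in at 1 within {0..1::real}. s \<in> {0..1} \<and> s \<noteq> 1"
      by (auto simp: eventually_at_filter)
    moreover have "\<forall>\<^sub>F s in at 1 within {0..1}. germ_eq (x q s) (H s) (H 1)" by (rule H(3)) auto
    ultimately have "\<forall>\<^sub>F s in at 1 within {0..1}. x q s \<in> ball q \<epsilon> \<and> 0 \<le> s \<and> s < 1 \<and> germ_eq (x q s) (H s) (H 1)"
      by eventually_elim auto
    moreover have "at 1 within {0..1::real} \<noteq> bot" by (simp add: at_within_Icc_at_left)
    ultimately obtain s where s: "x q s \<in> ball q \<epsilon>" "0 \<le> s" "s < 1" "germ_eq (x q s) (H s) (H 1)"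
      using eventually_happens by fast
    have "germ_eq (x q s) (H s) G"
    proof (rule germ_eq_along_path[where x = "x q" and F = H and a = 0 and b = s and t = 0])
      fix t assume t: "t \<in> {0..s}"
      then show "H t meromorphic_on {x q t}" using H(1) s by auto
      have "at t within {0..s} \<le> at t within {0..1}" using s by (intro at_le) auto
      moreover have "\<forall>\<^sub>F u in at t within {0..1}. germ_eq (x q u) (H u) (H t)" using t s by (intro H(3)) auto
      ultimately show "\<forall>\<^sub>F u in at t within {0..s}. germ_eq (x q u) (H u) (H t)" by (rule filter_leD)
      show "G meromorphic_on {x q t}" using xB[of t] t s by (intro meromorphic_at_point_subset[OF G(1)]) auto
    next
      show "germ_eq (x q 0) (H 0) G" using H(2) G(2) by (simp add: x_def) (meson germ_eq_sym germ_eq_trans)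
    qed (use s xcont in auto)
    then have HG: "germ_eq (x q s) (H 1) G" using s(4) by (meson germ_eq_sym germ_eq_trans)
    have "germ_eq z (H 1) G" if "z \<in> ball q \<epsilon> \<inter> B r" for z
    proof (rule germ_eq_on_connected[of "ball q \<epsilon> \<inter> B r" "H 1" G "x q s"])
      show "connected (ball q \<epsilon> \<inter> B r)" unfolding B_def by (intro convex_connected convex_Int convex_ball)
      show "H 1 meromorphic_on ball q \<epsilon> \<inter> B r" using \<epsilon> by (intro meromorphic_on_subset[OF V(3)]) auto
      show "G meromorphic_on ball q \<epsilon> \<inter> B r" by (intro meromorphic_on_subset[OF G(1)]) auto
    qed (use that s xB[of s] HG in auto)
    moreover have "H 1 meromorphic_on ball q \<epsilon>" using \<epsilon> by (intro meromorphic_on_subset[OF V(3)])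
    ultimately show ?thesis using \<epsilon> by blast
  qed
  then obtain \<epsilon> h where \<epsilon>: "\<And>q. q \<in> sphere ?c (r * R) \<Longrightarrow> \<epsilon> q > 0"
    and h: "\<And>q. q \<in> sphere ?c (r * R) \<Longrightarrow> h q meromorphic_on ball q (\<epsilon> q)"
    and hG: "\<And>q z. q \<in> sphere ?c (r * R) \<Longrightarrow> z \<in> ball q (\<epsilon> q) \<Longrightarrow> z \<in> B r \<Longrightarrow> germ_eq z (h q) G"
    by (metis IntI)
  have hh: "germ_eq z (h q) (h q')"
    if q: "q \<in> sphere ?c (r * R)" "q' \<in> sphere ?c (r * R)" and z: "z \<in> ball q (\<epsilon> q)" "z \<in> ball q' (\<epsilon> q')" for q q' z
  proof (cases "q = q'")
    case False
    \<comment> \<open>The point dividing the segment from \<open>q\<close> to \<open>q'\<close> in the ratio of the radii lies in both discs.\<close>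
    define l where "l = \<epsilon> q / (\<epsilon> q + \<epsilon> q')"
    have l: "0 < l" "l < 1" using \<epsilon> q by (auto simp: l_def add_pos_pos)
    define w where "w = q + complex_of_real l * (q' - q)"
    have d: "dist q q' < \<epsilon> q + \<epsilon> q'" using z dist_triangle_less_add[of q z "\<epsilon> q" q' "\<epsilon> q'"]
      by (auto simp: dist_commute)
    have pos: "\<epsilon> q > 0" "\<epsilon> q' > 0" using \<epsilon> q by auto
    have "dist q w = l * dist q q'" using l by (simp add: w_def dist_norm norm_mult norm_minus_commute)
    also have "\<dots> < l * (\<epsilon> q + \<epsilon> q')" using d l by simp
    finally have w1: "w \<in> ball q (\<epsilon> q)" using pos by (simp add: l_def)
    have "q' - w = complex_of_real (1 - l) * (q' - q)" by (simp add: w_def algebra_simps)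
    then have "dist q' w = (1 - l) * dist q q'" using l
      by (simp only: dist_norm norm_mult norm_of_real) (simp add: norm_minus_commute)
    also have "\<dots> < (1 - l) * (\<epsilon> q + \<epsilon> q')" using d l by simp
    also have "\<dots> = \<epsilon> q'" using pos by (simp add: l_def field_simps)
    finally have w2: "w \<in> ball q' (\<epsilon> q')" by simp
    have "w \<in> open_segment q q'" using l False
      by (auto simp: in_segment w_def scaleR_conv_of_real algebra_simps intro!: exI[of _ l])
    then have "dist ?c w < r * R" using dist_decreases_open_segment[of w q q' ?c] q by auto
    then have w3: "w \<in> B r" by (simp add: B_def)
    have "germ_eq w (h q) (h q')"
      using hG[OF q(1) w1 w3] hG[OF q(2) w2 w3] by (meson germ_eq_sym germ_eq_trans)
    moreover have "connected (ball q (\<epsilon> q) \<inter> ball q' (\<epsilon> q'))" by (intro convex_connected convex_Int convex_ball)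
    moreover have "h q meromorphic_on ball q (\<epsilon> q) \<inter> ball q' (\<epsilon> q')"
      by (intro meromorphic_on_subset[OF h[OF q(1)]]) auto
    moreover have "h q' meromorphic_on ball q (\<epsilon> q) \<inter> ball q' (\<epsilon> q')"
      by (intro meromorphic_on_subset[OF h[OF q(2)]]) auto
    ultimately show ?thesis using w1 w2 z germ_eq_on_connected by blast
  qed simp
  define \<F> where "\<F> = insert (B r, G) ((\<lambda>q. (ball q (\<epsilon> q), h q)) ` sphere ?c (r * R))"
  obtain K where K: "K meromorphic_on (\<Union>(U, F)\<in>\<F>. U)"
    "\<And>U F z. (U, F) \<in> \<F> \<Longrightarrow> z \<in> U \<Longrightarrow> germ_eq z K F"
  proof (rule glue_meromorphic[of \<F>])
    show "open U" if "(U, F) \<in> \<F>" for U F using that by (auto simp: \<F>_def B_def)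
    show "F meromorphic_on U" if "(U, F) \<in> \<F>" for U F using that G h by (auto simp: \<F>_def)
    show "germ_eq z F G'" if "(U, F) \<in> \<F>" "(V, G') \<in> \<F>" "z \<in> U" "z \<in> V" for U F V G' z
    proof -
      have "U = B r \<and> F = G \<or> (\<exists>q\<in>sphere ?c (r * R). U = ball q (\<epsilon> q) \<and> F = h q)"
        "V = B r \<and> G' = G \<or> (\<exists>q\<in>sphere ?c (r * R). V = ball q (\<epsilon> q) \<and> G' = h q)"
        using that(1,2) by (auto simp: \<F>_def)
      then show ?thesis
        using that(3,4) hG hh by (elim disjE bexE conjE; hypsubst) (simp | rule germ_eq_sym, assumption | blast intro: germ_eq_sym)+
    qed
  qed blast
  let ?W = "\<Union>(U, F)\<in>\<F>. U"
  have "open ?W" by (auto simp: \<F>_def B_def)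
  moreover have "cball ?c (r * R) \<subseteq> ?W"
  proof
    fix z assume z: "z \<in> cball ?c (r * R)"
    show "z \<in> ?W"
    proof (cases "z \<in> B r")
      case True then show ?thesis by (auto simp: \<F>_def)
    next
      case False
      then have zS: "z \<in> sphere ?c (r * R)" using z by (auto simp: B_def)
      then have "(ball z (\<epsilon> z), h z) \<in> \<F>" by (simp add: \<F>_def)
      moreover have "z \<in> ball z (\<epsilon> z)" using \<epsilon>[OF zS] by simp
      ultimately show ?thesis by blast
    qed
  qed
  ultimately obtain \<delta> where \<delta>: "\<delta> > 0" "(\<Union>z\<in>cball ?c (r * R). ball z \<delta>) \<subseteq> ?W"
    using compact_subset_open_imp_ball_epsilon_subset[of "cball ?c (r * R)" ?W] by auto
  define e where "e = min (1 - r) (\<delta> / (3 * R))"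
  have e: "e > 0" "r + e \<le> 1" using r R \<delta> by (auto simp: e_def)
  have "e \<le> \<delta> / (3 * R)" by (simp add: e_def)
  then have eR: "2 * e * R < \<delta>" using R \<delta> by (simp add: field_simps)
  have "B (r + e) \<subseteq> ?W"
  proof
    fix z assume z: "z \<in> B (r + e)"
    define y where "y = p + complex_of_real (r / (r + e)) * (z - p)"
    have re: "r + e > 0" using r e by simp
    have dz: "cmod (z - (p + complex_of_real (r + e) * (c - p))) < (r + e) * R"
      using z by (simp add: B_def dist_norm norm_minus_commute)
    have "y - ?c = complex_of_real (r / (r + e)) * (z - (p + complex_of_real (r + e) * (c - p)))"
    proof -
      have "complex_of_real (r / (r + e)) * complex_of_real (r + e) = complex_of_real r"
      proof -
        have "r / (r + e) * (r + e) = r" using re by simp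
        then show ?thesis by (metis of_real_mult)
      qed
      moreover have "(p + a * (z - p)) - (p + d * (c - p)) = a * (z - (p + b * (c - p)))"
        if "a * b = d" for a b d :: complex
        using that by (auto simp: algebra_simps)
      ultimately show ?thesis unfolding y_def by blast
    qed
    then have "cmod (y - ?c) = \<bar>r / (r + e)\<bar> * cmod (z - (p + complex_of_real (r + e) * (c - p)))"
      by (simp only: norm_mult norm_of_real)
    also have "\<bar>r / (r + e)\<bar> = r / (r + e)" using r re by simp
    also have "r / (r + e) * cmod (z - (p + complex_of_real (r + e) * (c - p))) \<le> r / (r + e) * ((r + e) * R)"
      by (intro mult_left_mono less_imp_le[OF dz]) (use r re in auto)
    finally have y: "y \<in> cball ?c (r * R)" using re by (simp add: dist_norm norm_minus_commute)
    have "z - y = complex_of_real (e / (r + e)) * (z - p)"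
    proof -
      have "r / (r + e) + e / (r + e) = 1" using re by (simp add: add_divide_distrib[symmetric])
      then have "complex_of_real (r / (r + e)) + complex_of_real (e / (r + e)) = 1"
        by (metis of_real_1 of_real_add)
      then have "(complex_of_real (r / (r + e)) + complex_of_real (e / (r + e))) * (z - p) = z - p" by simp
      then show ?thesis unfolding y_def by (simp only: distrib_right) (simp add: algebra_simps)
    qed
    then have "cmod (z - y) = \<bar>e / (r + e)\<bar> * cmod (z - p)" by (simp only: norm_mult norm_of_real)
    also have "\<bar>e / (r + e)\<bar> = e / (r + e)" using e re by simp
    finally have 1: "cmod (z - y) = e / (r + e) * cmod (z - p)" .
    have "cmod (z - p) \<le> cmod (z - (p + complex_of_real (r + e) * (c - p))) + cmod (complex_of_real (r + e) * (c - p))"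
      using norm_triangle_sub[of "z - p" "complex_of_real (r + e) * (c - p)"] unfolding diff_diff_eq by linarith
    also have "cmod (complex_of_real (r + e) * (c - p)) = (r + e) * cmod (c - p)"
      using re by (simp only: norm_mult norm_of_real abs_of_pos)
    also have "cmod (z - (p + complex_of_real (r + e) * (c - p))) + (r + e) * cmod (c - p) \<le> (r + e) * R + (r + e) * R"
      by (intro add_mono mult_left_mono less_imp_le[OF dz] less_imp_le[OF pc]) (use re in auto)
    finally have "e / (r + e) * cmod (z - p) \<le> e / (r + e) * ((r + e) * R + (r + e) * R)"
      by (intro mult_left_mono) (use e re in auto)
    with 1 have "cmod (z - y) \<le> e / (r + e) * ((r + e) * R + (r + e) * R)" by simp
    also have "\<dots> = 2 * e * R" using re by (simp add: field_simps)
    finally have "cmod (z - y) < \<delta>" using eR by simp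
    then have "z \<in> ball y \<delta>" by (simp add: dist_norm norm_minus_commute)
    then show "z \<in> ?W" using \<delta>(2) y by blast
  qed
  then have "K meromorphic_on B (r + e)" using K(1) by (rule meromorphic_on_subset[rotated])
  moreover have "germ_eq p K g"
    using K(2)[of "B r" G p] pB G(2) by (auto simp: \<F>_def B_def intro: germ_eq_trans)
  ultimately show ?thesis using e by (intro exI[of _ "r + e"]) auto
qed

text \<open>
  A monodromy theorem for discs. Consider the ratios for which the germ at \<open>p\<close> extends to the image of the
  disc under the homothety with centre \<open>p\<close>. Their supremum is attained, because the extensions glue, and it
  is \<open>1\<close> by \<open>monodromy_disc_enlarge\<close>.
\<close>

lemma monodromy_disc:
  fixes p c :: complex and R :: real
  assumes p: "dist p c < R" and g: "g meromorphic_on {p}"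
    and cont: "\<And>q. q \<in> ball c R \<Longrightarrow> continuable_on_segment p q g"
  shows "\<exists>G. G meromorphic_on ball c R \<and> germ_eq p G g"
proof -
  define B where "B r = ball (p + complex_of_real r * (c - p)) (r * R)" for r
  define T where "T = {r. 0 < r \<and> r \<le> 1 \<and> (\<exists>G. G meromorphic_on B r \<and> germ_eq p G g)}"
  have pc: "cmod (c - p) < R" using p by (simp add: dist_norm norm_minus_commute)
  then have R: "R > 0" by (meson norm_ge_zero le_less_trans)
  have pB: "p \<in> B r" if "r > 0" for r using pc that by (simp add: B_def dist_norm norm_mult)
  have mono: "B r \<subseteq> B r'" if "0 < r" "r \<le> r'" for r r'
  proof
    fix z assume "z \<in> B r"
    then have dz: "cmod (z - (p + complex_of_real r * (c - p))) < r * R" by (simp add: B_def dist_norm norm_minus_commute)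
    have "z - (p + complex_of_real r' * (c - p)) = (z - (p + complex_of_real r * (c - p))) - complex_of_real (r' - r) * (c - p)"
      by (simp add: algebra_simps)
    then have "cmod (z - (p + complex_of_real r' * (c - p))) \<le> cmod (z - (p + complex_of_real r * (c - p))) + (r' - r) * cmod (c - p)"
      using norm_triangle_ineq4[of "z - (p + complex_of_real r * (c - p))" "complex_of_real (r' - r) * (c - p)"] that
      by (simp only: norm_mult norm_of_real; simp)
    also have "\<dots> < r * R + (r' - r) * R" using dz pc that by (intro add_less_le_mono mult_left_mono) auto
    finally show "z \<in> B r'" by (simp add: B_def dist_norm norm_minus_commute algebra_simps)
  qed
  obtain V where V: "open V" "{p} \<subseteq> V" "g meromorphic_on V" using meromorphic_on_open_nhd[OF g] by metis
  then obtain \<epsilon> where \<epsilon>: "\<epsilon> > 0" "ball p \<epsilon> \<subseteq> V" by (metis insert_subset openE)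
  define r0 where "r0 = min 1 (\<epsilon> / (2 * R))"
  have r0: "r0 > 0" "r0 \<le> 1" using \<epsilon> R by (auto simp: r0_def)
  have "r0 \<le> \<epsilon> / (2 * R)" by (simp add: r0_def)
  then have r0R: "2 * r0 * R \<le> \<epsilon>" using R by (simp add: field_simps)
  have "B r0 \<subseteq> ball p \<epsilon>"
  proof
    fix z assume "z \<in> B r0"
    then have dz: "cmod (z - (p + complex_of_real r0 * (c - p))) < r0 * R" by (simp add: B_def dist_norm norm_minus_commute)
    have "cmod (z - p) \<le> cmod (z - (p + complex_of_real r0 * (c - p))) + r0 * cmod (c - p)"
      using norm_triangle_ineq[of "z - (p + complex_of_real r0 * (c - p))" "complex_of_real r0 * (c - p)"] r0
      by (simp only: norm_mult norm_of_real; simp)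
    also have "\<dots> < r0 * R + r0 * R" using dz pc r0 by (intro add_less_le_mono mult_left_mono) auto
    also have "\<dots> \<le> \<epsilon>" using r0R by (simp add: mult.commute mult.left_commute)
    finally show "z \<in> ball p \<epsilon>" by (simp add: dist_norm norm_minus_commute)
  qed
  then have "g meromorphic_on B r0" using \<epsilon> by (intro meromorphic_on_subset[OF V(3)]) blast
  then have r0T: "r0 \<in> T" using r0 by (auto simp: T_def intro!: exI[of _ g])
  have bdd: "bdd_above T" by (auto simp: T_def)
  define r where "r = Sup T"
  have r: "r0 \<le> r" unfolding r_def by (rule cSup_upper[OF r0T bdd])
  have r1: "r \<le> 1" unfolding r_def
  proof (rule cSup_least)
    show "T \<noteq> {}" using r0T by blast
    show "t \<le> 1" if "t \<in> T" for t using that by (simp add: T_def)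
  qed
  have "\<exists>F. \<forall>s\<in>T. F s meromorphic_on B s \<and> germ_eq p (F s) g" by (rule bchoice) (auto simp: T_def)
  then obtain F where F: "\<And>s. s \<in> T \<Longrightarrow> F s meromorphic_on B s" "\<And>s. s \<in> T \<Longrightarrow> germ_eq p (F s) g" by blast
  define \<F> where "\<F> = (\<lambda>s. (B s, F s)) ` T"
  obtain K where K: "K meromorphic_on (\<Union>(U, F)\<in>\<F>. U)"
    "\<And>U F z. (U, F) \<in> \<F> \<Longrightarrow> z \<in> U \<Longrightarrow> germ_eq z K F"
  proof (rule glue_meromorphic[of \<F>])
    show "open U" if "(U, F) \<in> \<F>" for U F using that by (auto simp: \<F>_def B_def)
    show "F' meromorphic_on U" if "(U, F') \<in> \<F>" for U F' using that F by (auto simp: \<F>_def)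
    show "germ_eq z F1 F2" if UV: "(U, F1) \<in> \<F>" "(V, F2) \<in> \<F>" "z \<in> U" "z \<in> V" for U F1 V F2 z
    proof -
      obtain s where s: "s \<in> T" "U = B s" "F1 = F s" using UV(1) by (auto simp: \<F>_def)
      obtain t where t: "t \<in> T" "V = B t" "F2 = F t" using UV(2) by (auto simp: \<F>_def)
      note st = s t
      have "germ_eq p F1 F2" using F(2) st by (meson germ_eq_sym germ_eq_trans)
      moreover have "p \<in> U \<inter> V" using st pB by (auto simp: T_def)
      moreover have "connected (U \<inter> V)"
        unfolding st B_def by (intro convex_connected convex_Int convex_ball)
      moreover have "F1 meromorphic_on U \<inter> V" unfolding st
        by (intro meromorphic_on_subset[OF F(1)[OF st(1)]]) auto
      moreover have "F2 meromorphic_on U \<inter> V" unfolding st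
        by (intro meromorphic_on_subset[OF F(1)[OF st(4)]]) auto
      ultimately show ?thesis using that germ_eq_on_connected by blast
    qed
  qed blast
  have "B r \<subseteq> (\<Union>(U, F)\<in>\<F>. U)"
  proof
    fix z assume "z \<in> B r"
    then have "0 < r * R - dist (p + complex_of_real r * (c - p)) z" by (simp add: B_def)
    moreover have "((\<lambda>s. s * R - dist (p + complex_of_real s * (c - p)) z) \<longlongrightarrow> r * R - dist (p + complex_of_real r * (c - p)) z) (at r)"
      by (intro tendsto_intros)
    ultimately have "\<forall>\<^sub>F s in at r. 0 < s * R - dist (p + complex_of_real s * (c - p)) z"
      by (rule order_tendstoD(1)[rotated])
    then obtain d where d: "d > 0" "\<And>s. s \<noteq> r \<Longrightarrow> dist s r < d \<Longrightarrow> z \<in> B s"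
      by (auto simp: eventually_at B_def)
    obtain s where s: "s \<in> T" "r - d < s" using less_cSupD[of T "r - d"] r0T d by (auto simp: r_def)
    then have "s \<le> r" using cSup_upper[OF _ bdd] by (simp add: r_def)
    then have "z \<in> B s" using d s \<open>z \<in> B r\<close> by (cases "s = r") (auto simp: dist_real_def)
    then show "z \<in> (\<Union>(U, F)\<in>\<F>. U)" using s by (auto simp: \<F>_def)
  qed
  then have KB: "K meromorphic_on B r" using K(1) by (rule meromorphic_on_subset[rotated])
  have Kp: "germ_eq p K g"
    using K(2)[of "B r0" "F r0" p] F(2)[OF r0T] r0T pB r0 by (auto simp: \<F>_def intro: germ_eq_trans)
  have "r = 1"
  proof (rule ccontr)
    assume "r \<noteq> 1"
    then have "r < 1" "0 < r" using r r1 r0 by auto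
    from monodromy_disc_enlarge[OF p cont this(2,1) KB[unfolded B_def] Kp]
    obtain r' G' where r'G: "r < r'" "r' \<le> 1" "G' meromorphic_on B r'" "germ_eq p G' g"
      unfolding B_def by blast
    then have "r' \<in> T" using \<open>0 < r\<close> unfolding T_def by auto
    note r' = r'G(1) this
    then show False using cSup_upper[OF r'(2) bdd] by (simp add: r_def)
  qed
  then show ?thesis using KB Kp by (auto simp: B_def)
qed

section \<open>Admissible compacta in the plane\<close>

lemma compl_Some_image: "- Some ` K = insert None (Some ` (- K))"
proof (rule set_eqI)
  show "p \<in> - Some ` K \<longleftrightarrow> p \<in> insert None (Some ` (- K))" for p by (cases p) auto
qed

text \<open>
  A separation of the complement of a plane compactum extends to the sphere: the point at infinity
  is added to the part that contains a neighbourhood of infinity.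
\<close>

lemma sphere_separation_absurd:
  fixes A B S :: "complex set"
  assumes con: "connectedin riemann_sphere (- Some ` (- S))" and "open S"
    and AB: "open A" "open B" "A \<inter> B \<inter> S = {}" "S \<subseteq> A \<union> B" "B \<inter> S \<noteq> {}"
    and far: "bounded (- (A \<inter> S))"
  shows False
proof -
  have "closed (- (A \<inter> S))" using AB \<open>open S\<close> by (intro closed_Compl open_Int)
  then have "compact (- (A \<inter> S))" using far by (simp only: compact_eq_bounded_closed)
  then have "openin riemann_sphere (insert None (Some ` (A \<inter> S)))"
    unfolding openin_Alexandroff_compactification
    by (intro disjI2 exI[of _ "- (A \<inter> S)"]) (auto simp: compact_imp_closed)
  moreover have "openin riemann_sphere (Some ` (B \<inter> S))" using AB \<open>open S\<close> by (simp add: open_Int)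
  moreover have "insert None (Some ` S) \<subseteq> insert None (Some ` (A \<inter> S)) \<union> Some ` (B \<inter> S)"
    "insert None (Some ` (A \<inter> S)) \<inter> Some ` (B \<inter> S) \<inter> insert None (Some ` S) = {}"
    "insert None (Some ` (A \<inter> S)) \<inter> insert None (Some ` S) \<noteq> {}"
    "Some ` (B \<inter> S) \<inter> insert None (Some ` S) \<noteq> {}"
    using AB by auto
  ultimately show False
    using con unfolding connectedin compl_Some_image double_complement by blast
qed

text \<open>
  The point at infinity lies in the closure of the complement of \<open>K\<close>, so adding it preserves
  connectedness; the converse is \<open>sphere_separation_absurd\<close>.
\<close>

lemma connectedin_sphere_iff:
  assumes K: "compact (K :: complex set)"
  shows "connectedin riemann_sphere (- Some ` K) \<longleftrightarrow> connected (- K)"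
proof
  note eq = compl_Some_image[of K]
  have opn: "open (- K)" using K by (simp add: compact_imp_closed open_Compl)
  obtain R where R: "K \<subseteq> ball 0 R" using compact_imp_bounded[OF K] bounded_subset_ballD by metis
  {
    assume con: "connected (- K)"
    then have "connectedin euclidean (- K)" by simp
    then have "connectedin riemann_sphere (Some ` (- K))"
      by (rule connectedin_continuous_map_image[OF continuous_map_Some])
    moreover have "None \<in> riemann_sphere closure_of (Some ` (- K))"
      unfolding in_closure_of
    proof (intro conjI allI impI)
      fix T assume T: "None \<in> T \<and> openin riemann_sphere T"
      then obtain C where C: "compact C" "T = insert None (Some ` (- C))"
        unfolding openin_Alexandroff_compactification by (auto simp: Compl_eq_Diff_UNIV)
      have "bounded (K \<union> C)" using C K by (simp add: compact_imp_bounded)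
      then have "K \<union> C \<noteq> UNIV" using not_bounded_UNIV[where 'a=complex] by metis
      then obtain z where "z \<notin> K" "z \<notin> C" by auto
      then show "\<exists>y. y \<in> Some ` (- K) \<and> y \<in> T" using C by (intro exI[of _ "Some z"]) auto
    qed simp
    moreover have "Some ` (- K) \<subseteq> riemann_sphere closure_of (Some ` (- K))"
      by (intro closure_of_subset) auto
    ultimately show "connectedin riemann_sphere (- Some ` K)"
      unfolding eq
      using connectedin_intermediate_closure_of[of riemann_sphere "Some ` (- K)" "insert None (Some ` (- K))"]
      by blast
  }
  {
    assume con: "connectedin riemann_sphere (- Some ` K)"
    show "connected (- K)"
    proof (rule connectedI)
      fix A B assume AB: "open A" "open B" "A \<inter> - K \<noteq> {}" "B \<inter> - K \<noteq> {}" "A \<inter> B \<inter> - K = {}" "- K \<subseteq> A \<union> B"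
      have N: "connected (- ball (0::complex) R)" by (intro connected_complement_bounded_convex) auto
      have sub: "- ball 0 R \<subseteq> - K" using R by auto
      consider "- ball 0 R \<subseteq> A" | "- ball 0 R \<subseteq> B"
        using connectedD[OF N AB(1,2)] AB sub by blast
      then show False
      proof cases
        case 1
        then have "- (A \<inter> - K) \<subseteq> ball 0 R" using sub by blast
        then have "bounded (- (A \<inter> - K))" using bounded_ball bounded_subset by blast
        then show False using sphere_separation_absurd[of "- K" A B] con opn AB by simp
      next
        case 2
        then have "- (B \<inter> - K) \<subseteq> ball 0 R" using sub by blast
        then have "bounded (- (B \<inter> - K))" using bounded_ball bounded_subset by blast
        then show False using sphere_separation_absurd[of "- K" B A] con opn AB by (simp add: Int_commute Un_commute)
      qed
    qed
  }
qed

text \<open>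
  No condition at infinity is imposed on \<open>F\<close>: for an analytic germ \<open>f\<close> it is implied by the
  agreement near infinity.
\<close>

definition extends_to :: "(complex \<Rightarrow> complex) \<Rightarrow> complex set \<Rightarrow> bool" where
  "extends_to f U \<longleftrightarrow> (\<exists>F. F meromorphic_on U \<and> (\<forall>\<^sub>F z in at_infinity. F z = f z))"

lemma extends_to_subset: "extends_to f U \<Longrightarrow> V \<subseteq> U \<Longrightarrow> extends_to f V"
  unfolding extends_to_def by (meson meromorphic_on_subset)

lemma analytic_germ_analytic_outside:
  assumes "analytic_germ_at_infinity f"
  obtains R where "R > 0" "f analytic_on {z. R < cmod z}"
proof -
  obtain g where g: "g analytic_on {0}" "\<forall>\<^sub>F z in at_infinity. f z = g (inverse z)"
    using assms by (auto simp: analytic_germ_at_infinity_def same_germ_def)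
  obtain S where S: "open S" "0 \<in> S" "g holomorphic_on S" using g(1) by (auto simp: analytic_at)
  obtain d where d: "d > 0" "ball 0 d \<subseteq> S" using S openE by metis
  obtain b where b: "\<And>z. b \<le> cmod z \<Longrightarrow> f z = g (inverse z)" using g(2) by (auto simp: eventually_at_infinity)
  define R where "R = max b (1 / d)"
  have R: "R > 0" "b \<le> R" "1 / d \<le> R" using d by (auto simp: R_def less_max_iff_disj)
  have sub: "inverse z \<in> ball 0 d" if "R < cmod z" for z
  proof -
    have "1 / d < cmod z" using R(3) that by linarith
    then have "1 < cmod z * d" using d by (simp add: pos_divide_less_eq)
    moreover have "cmod z > 0" using that R(1) by linarith
    ultimately show ?thesis by (simp add: norm_divide inverse_eq_divide pos_divide_less_eq mult.commute)
  qed
  have "(g \<circ> inverse) holomorphic_on {z. R < cmod z}"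
  proof (rule holomorphic_on_compose)
    show "inverse holomorphic_on {z. R < cmod z}" using R(1) by (intro holomorphic_intros) auto
    show "g holomorphic_on inverse ` {z. R < cmod z}"
      using sub d(2) by (intro holomorphic_on_subset[OF S(3)]) blast
  qed
  then have "f holomorphic_on {z. R < cmod z}"
    by (rule holomorphic_transform) (use b R in auto)
  moreover have "open {z::complex. R < cmod z}" by (intro open_Collect_less continuous_intros)
  ultimately show ?thesis using that R by (simp add: analytic_on_open)
qed

lemma in_meromorphic_germs_iff:
  "f \<in> meromorphic_germs (- Some ` K) \<longleftrightarrow> analytic_germ_at_infinity f \<and> extends_to f (- K)"
proof
  assume "f \<in> meromorphic_germs (- Some ` K)"
  then obtain F where f: "analytic_germ_at_infinity f"
    and F: "\<And>p. p \<in> - Some ` K \<Longrightarrow> meromorphic_at_point F p" "same_germ None F f"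
    by (auto simp: meromorphic_germs_def)
  have "F meromorphic_on {z}" if "z \<in> - K" for z using F(1)[of "Some z"] that by auto
  then have "F meromorphic_on - K" by (subst meromorphic_on_meromorphic_at) auto
  then show "analytic_germ_at_infinity f \<and> extends_to f (- K)"
    using f F(2) by (auto simp: extends_to_def same_germ_def)
next
  assume *: "analytic_germ_at_infinity f \<and> extends_to f (- K)"
  then obtain F where F: "F meromorphic_on - K" "\<forall>\<^sub>F z in at_infinity. F z = f z"
    by (auto simp: extends_to_def)
  obtain g where g: "g analytic_on {0}" "\<forall>\<^sub>F z in at_infinity. f z = g (inverse z)"
    using * by (auto simp: analytic_germ_at_infinity_def same_germ_def)
  have "\<forall>\<^sub>F z in at_infinity. F z = g (inverse z)" using F(2) g(2) by eventually_elim simp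
  then have "\<forall>\<^sub>F w in at 0. F (inverse w) = g (inverse (inverse w))"
    using filterlim_inverse_at_infinity by (rule eventually_compose_filterlim)
  then have "(\<lambda>w. F (inverse w)) meromorphic_on {0} \<longleftrightarrow> g meromorphic_on {0}"
    by (intro meromorphic_on_cong) auto
  then have "meromorphic_at_point F None" using g(1) by (simp add: analytic_on_imp_meromorphic_on)
  moreover have "meromorphic_at_point F (Some z)" if "z \<notin> K" for z
    using F(1) that by (auto intro: meromorphic_at_point_subset)
  ultimately have "\<forall>p\<in>- Some ` K. meromorphic_at_point F p"
  proof (intro ballI)
    show "meromorphic_at_point F p" if N: "meromorphic_at_point F None"
      and S: "\<And>z. z \<notin> K \<Longrightarrow> meromorphic_at_point F (Some z)" and p: "p \<in> - Some ` K" for p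
    proof (cases p)
      case None then show ?thesis using N by simp
    next
      case (Some z) then show ?thesis using S[of z] p by auto
    qed
  qed
  then show "f \<in> meromorphic_germs (- Some ` K)"
    using * F(2) by (auto simp: meromorphic_germs_def same_germ_def)
qed

lemma admissible_compacta_iff:
  "K \<in> admissible_compacta f \<longleftrightarrow>
     compact K \<and> connected (- K) \<and> analytic_germ_at_infinity f \<and> extends_to f (- K)"
  by (auto simp: admissible_compacta_def in_meromorphic_germs_iff connectedin_sphere_iff)

lemma eventually_at_infinity_germ_eq:
  assumes "\<forall>\<^sub>F z in at_infinity. F z = G z"
  shows "\<forall>\<^sub>F z in at_infinity. germ_eq z F G"
proof -
  obtain b where b: "\<And>z. b \<le> cmod z \<Longrightarrow> F z = G z" using assms by (auto simp: eventually_at_infinity)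
  have "germ_eq z F G" if "b + 1 \<le> cmod z" for z
  proof -
    have "\<forall>\<^sub>F w in nhds z. w \<in> {w. b < cmod w}"
      using that by (intro eventually_nhds_in_open open_Collect_less continuous_intros) auto
    then show ?thesis unfolding germ_eq_def eventually_at_filter by eventually_elim (auto intro: b)
  qed
  then show ?thesis unfolding eventually_at_infinity by blast
qed

lemma remove_sings_eq_at_infinity:
  assumes "analytic_germ_at_infinity f" "\<forall>\<^sub>F z in at_infinity. F z = f z"
  shows "\<forall>\<^sub>F z in at_infinity. remove_sings F z = f z"
proof -
  obtain R where R: "R > 0" "f analytic_on {z. R < cmod z}"
    using analytic_germ_analytic_outside[OF assms(1)] .
  have "\<forall>\<^sub>F z in at_infinity. R + 1 \<le> cmod z" unfolding eventually_at_infinity by blast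
  with eventually_at_infinity_germ_eq[OF assms(2)] show ?thesis
  proof eventually_elim
    case (elim z)
    then have "remove_sings F z = remove_sings f z" by (intro remove_sings_cong) (auto simp: germ_eq_def)
    also have "f analytic_on {z}" using R(2) by (rule analytic_on_subset) (use elim in auto)
    then have "remove_sings f z = f z" by simp
    finally show ?case .
  qed
qed

lemma cobounded_eventually_at_infinity:
  fixes U :: "complex set"
  assumes "bounded (- U)" shows "\<forall>\<^sub>F z in at_infinity. z \<in> U"
proof -
  obtain B where "\<And>z. z \<in> - U \<Longrightarrow> cmod z \<le> B" using assms by (auto simp: bounded_iff)
  then have "z \<in> U" if "B + 1 \<le> cmod z" for z using that by fastforce
  then show ?thesis unfolding eventually_at_infinity by blast
qed

lemma extensions_germ_eq:
  fixes U :: "complex set"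
  assumes "connected U" "bounded (- U)" "F meromorphic_on U" "G meromorphic_on U"
    and "\<forall>\<^sub>F z in at_infinity. F z = f z" "\<forall>\<^sub>F z in at_infinity. G z = f z" "z \<in> U"
  shows "germ_eq z F G"
proof -
  have "\<forall>\<^sub>F z in at_infinity. F z = G z" using assms(5,6) by eventually_elim simp
  then have "\<forall>\<^sub>F z in at_infinity. germ_eq z F G \<and> z \<in> U"
    using eventually_at_infinity_germ_eq cobounded_eventually_at_infinity[OF assms(2)]
    by (simp add: eventually_conj_iff)
  then obtain w where "germ_eq w F G" "w \<in> U"
    using eventually_happens[of _ "at_infinity :: complex filter"] trivial_limit_at_infinity[where 'a=complex]
    by fast
  then show ?thesis using assms germ_eq_on_connected by blast
qed

text \<open>
  Two members of the chain share the smaller one, which is connected and reaches infinity, so the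
  extensions agree there and can be glued.
\<close>

lemma extends_to_chain_Union:
  assumes f: "analytic_germ_at_infinity f" and ne: "\<U> \<noteq> {}"
    and U: "\<And>U. U \<in> \<U> \<Longrightarrow> open U" "\<And>U. U \<in> \<U> \<Longrightarrow> connected U" "\<And>U. U \<in> \<U> \<Longrightarrow> bounded (- U)"
      "\<And>U. U \<in> \<U> \<Longrightarrow> extends_to f U"
    and chain: "\<And>U V. U \<in> \<U> \<Longrightarrow> V \<in> \<U> \<Longrightarrow> U \<subseteq> V \<or> V \<subseteq> U"
  shows "extends_to f (\<Union>\<U>)"
proof -
  have "\<exists>F. \<forall>U\<in>\<U>. F U meromorphic_on U \<and> (\<forall>\<^sub>F z in at_infinity. F U z = f z)"
    by (rule bchoice) (use U(4) in \<open>auto simp: extends_to_def\<close>)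
  then obtain F where F: "\<And>U. U \<in> \<U> \<Longrightarrow> F U meromorphic_on U"
    "\<And>U. U \<in> \<U> \<Longrightarrow> \<forall>\<^sub>F z in at_infinity. F U z = f z" by blast
  define \<F> where "\<F> = (\<lambda>U. (U, F U)) ` \<U>"
  have \<F>: "(U, G) \<in> \<F> \<longleftrightarrow> U \<in> \<U> \<and> G = F U" for U G by (auto simp: \<F>_def)
  have sub: "germ_eq z (F U) (F V)" if UV: "U \<in> \<U>" "V \<in> \<U>" "U \<subseteq> V" "z \<in> U" for U V z
    using U F UV meromorphic_on_subset[OF F(1)[OF UV(2)] UV(3)]
    by (intro extensions_germ_eq[of U _ _ f]) auto
  obtain H where H: "H meromorphic_on (\<Union>(U, F)\<in>\<F>. U)"
    "\<And>U F z. (U, F) \<in> \<F> \<Longrightarrow> z \<in> U \<Longrightarrow> H z = remove_sings F z"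
  proof (rule glue_meromorphic[of \<F>])
    show "open U" if "(U, G) \<in> \<F>" for U G using that U by (simp add: \<F>)
    show "G meromorphic_on U" if "(U, G) \<in> \<F>" for U G using that F by (simp add: \<F>)
    show "germ_eq z G1 G2" if UV: "(U, G1) \<in> \<F>" "(V, G2) \<in> \<F>" "z \<in> U" "z \<in> V" for U G1 V G2 z
    proof -
      have *: "U \<in> \<U>" "V \<in> \<U>" "G1 = F U" "G2 = F V" using UV by (auto simp: \<F>)
      from chain[OF *(1,2)] show ?thesis
        using sub[OF *(1,2)] sub[OF *(2,1)] UV(3,4) germ_eq_sym unfolding *(3,4) by blast
    qed
  qed blast
  have "(\<Union>(U, F)\<in>\<F>. U) = \<Union>\<U>" by (auto simp: \<F>_def)
  moreover have "\<forall>\<^sub>F z in at_infinity. H z = f z"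
  proof -
    obtain U where UU: "U \<in> \<U>" using ne by blast
    have "\<forall>\<^sub>F z in at_infinity. remove_sings (F U) z = f z"
      by (intro remove_sings_eq_at_infinity f F UU)
    with cobounded_eventually_at_infinity[OF U(3)[OF UU]] show ?thesis
      by eventually_elim (use H(2)[of U "F U"] UU in \<open>simp add: \<F>\<close>)
  qed
  ultimately show ?thesis using H(1) by (auto simp: extends_to_def)
qed

text \<open>
  Zorn's lemma for the complements: the union of a chain of admissible domains is admissible by
  \<open>extends_to_chain_Union\<close>.
\<close>

lemma exists_minimal_admissible:
  assumes K: "K \<in> admissible_compacta f" "E \<subseteq> K"
  obtains K' where "K' \<in> admissible_compacta f" "E \<subseteq> K'" "K' \<subseteq> K"
    "\<And>L. L \<in> admissible_compacta f \<Longrightarrow> E \<subseteq> L \<Longrightarrow> L \<subseteq> K' \<Longrightarrow> L = K'"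
proof -
  define \<A> where "\<A> = {U. - U \<in> admissible_compacta f \<and> E \<subseteq> - U \<and> - U \<subseteq> K}"
  have Kc: "compact K" using K by (simp add: admissible_compacta_iff)
  have "\<exists>M\<in>\<A>. \<forall>X\<in>\<A>. M \<subseteq> X \<longrightarrow> X = M"
  proof (rule subset_Zorn_nonempty)
    show "\<A> \<noteq> {}" using K by (auto simp: \<A>_def intro!: exI[of _ "- K"])
    fix \<C> assume \<C>: "\<C> \<noteq> {}" "subset.chain \<A> \<C>"
    then have sub: "\<C> \<subseteq> \<A>" and chain: "\<And>U V. U \<in> \<C> \<Longrightarrow> V \<in> \<C> \<Longrightarrow> U \<subseteq> V \<or> V \<subseteq> U"
      by (auto simp: subset.chain_def)
    have C: "compact (- U)" "connected U" "extends_to f U" "analytic_germ_at_infinity f" "E \<subseteq> - U" "- U \<subseteq> K" if "U \<in> \<C>" for U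
      using sub that by (auto simp: \<A>_def admissible_compacta_iff)
    have opn: "open U" if "U \<in> \<C>" for U using C(1)[OF that] by (metis compact_imp_closed open_closed)
    obtain U0 where U0: "U0 \<in> \<C>" using \<C>(1) by blast
    have "open (\<Union>\<C>)" using opn by blast
    moreover have "- (\<Union>\<C>) \<subseteq> K" using C(6)[OF U0] U0 by blast
    ultimately have "compact (- (\<Union>\<C>))"
      using Kc by (metis closed_Compl compact_Int_closed inf.absorb_iff2)
    moreover have "connected (\<Union>\<C>)"
    proof -
      obtain b where b: "b \<notin> K"
        using compact_imp_bounded[OF Kc] not_bounded_UNIV[where 'a=complex] by (metis UNIV_eq_I)
      then have "b \<in> U" if "U \<in> \<C>" for U using C(6)[OF that] by auto
      then show ?thesis using C(2) by (intro connected_Union) auto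
    qed
    moreover have "extends_to f (\<Union>\<C>)"
      using C(2,3) opn compact_imp_bounded[OF C(1)] chain
      by (intro extends_to_chain_Union C(4)[OF U0] \<C>(1)) auto
    ultimately show "\<Union>\<C> \<in> \<A>"
      using C(4)[OF U0] C(5) \<open>- (\<Union>\<C>) \<subseteq> K\<close> by (auto simp: \<A>_def admissible_compacta_iff)
  qed
  then obtain M where M: "M \<in> \<A>" "\<And>X. X \<in> \<A> \<Longrightarrow> M \<subseteq> X \<Longrightarrow> X = M" by blast
  show ?thesis
  proof (rule that[of "- M"])
    show "- M \<in> admissible_compacta f" "E \<subseteq> - M" "- M \<subseteq> K" using M(1) by (auto simp: \<A>_def)
    fix L assume L: "L \<in> admissible_compacta f" "E \<subseteq> L" "L \<subseteq> - M"
    then have "- L \<in> \<A>" using \<open>- M \<subseteq> K\<close> by (auto simp: \<A>_def)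
    then have "- L = M" using L by (intro M(2)) auto
    then show "L = - M" by auto
  qed
qed

section \<open>Removing a disc from an admissible compactum\<close>

text \<open>
  The germ is continued along a path that runs from infinity to a point \<open>b\<close> on a ray, from \<open>b\<close> to \<open>p\<close>
  inside the complement of \<open>K\<close>, and from \<open>p\<close> to \<open>q\<close> on the segment. On the first two pieces
  uniqueness of continuation identifies it with \<open>F\<close>. The second and third pieces occupy the parameter
  intervals \<open>[1/2, 3/4]\<close> and \<open>[3/4, 1]\<close>.
\<close>

lemma continuation_on_segment:
  assumes E: "E \<subseteq> K" and cont: "\<And>\<gamma>. pathin (subtopology riemann_sphere (- Some ` E)) \<gamma> \<Longrightarrow> \<gamma> 0 = None
        \<Longrightarrow> continuable_along \<gamma> f"
    and K: "compact K" "connected (- K)" and F: "F meromorphic_on - K" "\<forall>\<^sub>F z in at_infinity. F z = f z"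
    and p: "p \<notin> K" and seg: "closed_segment p q \<inter> E = {}"
  shows "continuable_on_segment p q F"
proof -
  have opn: "open (- K)" using K by (simp add: compact_imp_closed open_Compl)
  obtain R where R: "R > 0" "\<And>z. z \<in> K \<Longrightarrow> cmod z \<le> R"
    using compact_imp_bounded[OF K(1)] unfolding bounded_pos by auto
  define b where "b = complex_of_real (R + 1)"
  have nb: "cmod b = R + 1" using R(1) unfolding b_def norm_of_real by simp
  have "b \<notin> K" using R nb by fastforce
  have "path_connected (- K)" using opn K(2) by (simp add: connected_open_path_connected)
  then obtain \<gamma> where \<gamma>: "path \<gamma>" "path_image \<gamma> \<subseteq> - K" "pathstart \<gamma> = b" "pathfinish \<gamma> = p"
    using p \<open>b \<notin> K\<close> unfolding path_connected_def by (metis ComplI)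
  define y where "y = \<gamma> +++ linepath p q"
  have y: "path y" "y 0 = b"
    using \<gamma> by (simp add: y_def, simp add: y_def pathstart_def joinpaths_def)
  have y1: "y t \<notin> K" if "0 \<le> t" "t \<le> 1 / 2" for t
  proof -
    have "y t = \<gamma> (2 * t)" using that by (simp add: y_def joinpaths_def)
    moreover have "2 * t \<in> {0..1}" using that by auto
    ultimately show ?thesis using \<gamma>(2) unfolding path_image_def by blast
  qed
  have y2: "y (1 / 2 + t / 2) = p + complex_of_real t * (q - p)" if "0 \<le> t" for t
  proof (cases "t = 0")
    case True
    then show ?thesis using \<gamma>(4) by (simp add: y_def joinpaths_def pathfinish_def)
  next
    case False
    then show ?thesis using that
      by (simp add: y_def joinpaths_def linepath_def scaleR_conv_of_real algebra_simps)
  qed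
  define X where "X t = (if t \<le> 1 / 2 then b / complex_of_real (2 * t) else y (2 * t - 1))" for t :: real
  define \<Gamma> where "\<Gamma> t = (if t \<le> 0 then None else Some (X t))" for t :: real
  have Xcont: "continuous_on {a..1} X" if "a > 0" for a
  proof -
    have "continuous_on ({a..1/2} \<union> {1/2..1}) X"
      unfolding X_def
    proof (rule continuous_on_If)
      show "continuous_on {a..1/2} (\<lambda>t. b / complex_of_real (2 * t))" using that by (intro continuous_intros) auto
      show "continuous_on {1/2..1} (\<lambda>t. y (2 * t - 1))"
      proof (rule continuous_on_compose2[of "{0..1}" y "{1/2..1}" "\<lambda>t. 2 * t - 1"])
        show "continuous_on {0..1} y" using y(1) by (simp only: path_def)
        show "continuous_on {1/2..1} (\<lambda>t::real. 2 * t - 1)" by (intro continuous_intros)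
      qed auto
      show "b / complex_of_real (2 * t) = y (2 * t - 1)" if "t \<in> {1/2..1}" "t \<le> 1/2" for t
      proof -
        have "t = 1/2" using that by auto
        with y(2) show ?thesis by (simp only:) simp
      qed
    qed auto
    then show ?thesis by (rule continuous_on_subset) auto
  qed
  have Xbig: "cmod (X t) = (R + 1) / (2 * t)" if "0 < t" "t \<le> 1 / 2" for t
    using that nb unfolding X_def by (simp add: norm_divide norm_mult)
  have XK: "X t \<notin> K" if "0 < t" "t \<le> 3 / 4" for t
  proof (cases "t \<le> 1 / 2")
    case True
    have "R < (R + 1) / (2 * t)"
    proof -
      have "R * (2 * t) \<le> R * 1" using True R(1) by (intro mult_left_mono) auto
      then show ?thesis using that by (simp add: pos_less_divide_eq)
    qed
    then show ?thesis using Xbig[OF that(1) True] R(2)[of "X t"] by fastforce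
  next
    case False
    then show ?thesis using y1[of "2 * t - 1"] that by (simp add: X_def)
  qed
  have Xseg: "X (3 / 4 + t / 4) = p + complex_of_real t * (q - p)" if "0 \<le> t" for t
  proof -
    have "2 * (3 / 4 + t / 4) - 1 = 1 / 2 + t / 2" by simp
    moreover have "\<not> 3 / 4 + t / 4 \<le> 1 / 2" using that by simp
    ultimately show ?thesis using y2[OF that] by (simp only: X_def if_False)
  qed
  have XE: "X t \<notin> E" if "0 < t" "t \<le> 1" for t
  proof (cases "t \<le> 3 / 4")
    case True then show ?thesis using XK that E by blast
  next
    case False
    define u where "u = 4 * t - 3"
    have u: "0 \<le> u" "u \<le> 1" "t = 3 / 4 + u / 4" using False that by (auto simp: u_def field_simps)
    then have "X t = p + complex_of_real u * (q - p)" using Xseg by simp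
    also have "\<dots> \<in> closed_segment p q"
      using u unfolding in_segment by (intro exI[of _ u]) (simp add: scaleR_conv_of_real algebra_simps)
    finally show ?thesis using seg by blast
  qed
  have "pathin riemann_sphere \<Gamma>"
    unfolding pathin_def continuous_map
  proof (intro conjI allI impI)
    show "\<Gamma> ` topspace (top_of_set {0..1}) \<subseteq> topspace riemann_sphere" by (auto simp: UNIV_option_conv[symmetric])
    fix V assume "openin riemann_sphere V"
    then consider U where "open U" "V = Some ` U" | C where "compact C" "V = insert None (Some ` (- C))"
      unfolding openin_Alexandroff_compactification by (auto simp: Compl_eq_Diff_UNIV)
    then have "openin (top_of_set {0..1}) ({0..1} \<inter> \<Gamma> -` V)"
    proof cases
      case 1
      have "\<exists>W. open W \<and> t \<in> W \<and> W \<inter> {0..1} \<subseteq> \<Gamma> -` V" if t: "t \<in> {0..1} \<inter> \<Gamma> -` V" for t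
      proof -
        have t0: "t > 0" using t 1 by (auto simp: \<Gamma>_def split: if_splits)
        have "openin (top_of_set {t/2..1}) ({t/2..1} \<inter> X -` U)"
          using Xcont[of "t/2"] t0 1 by (intro continuous_openin_preimage_gen) auto
        then obtain W where W: "open W" "{t/2..1} \<inter> X -` U = {t/2..1} \<inter> W" by (auto simp: openin_open)
        have "X t \<in> U" using t t0 1 by (auto simp: \<Gamma>_def)
        then have "t \<in> {t/2..1} \<inter> X -` U" using t t0 by simp
        then have "t \<in> W" unfolding W(2) by blast
        moreover have "(W \<inter> {t/2<..}) \<inter> {0..1} \<subseteq> \<Gamma> -` V"
        proof
          fix s assume s: "s \<in> (W \<inter> {t/2<..}) \<inter> {0..1}"
          then have "s \<in> {t/2..1} \<inter> X -` U" unfolding W(2) by auto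
          then show "s \<in> \<Gamma> -` V" using s t0 1 by (auto simp: \<Gamma>_def)
        qed
        ultimately show ?thesis using W(1) t0 by (intro exI[of _ "W \<inter> {t/2<..}"]) auto
      qed
      then obtain W where W: "\<And>t. t \<in> {0..1} \<inter> \<Gamma> -` V \<Longrightarrow> open (W t) \<and> t \<in> W t \<and> W t \<inter> {0..1} \<subseteq> \<Gamma> -` V"
        by metis
      have "{0..1} \<inter> \<Gamma> -` V = {0..1} \<inter> (\<Union>t\<in>{0..1} \<inter> \<Gamma> -` V. W t)"
        using W by (intro equalityI subsetI) blast+
      moreover have "open (\<Union>t\<in>{0..1} \<inter> \<Gamma> -` V. W t)" using W by blast
      ultimately show ?thesis unfolding openin_open by blast
    next
      case 2
      obtain B where B: "B > 0" "\<And>z. z \<in> C \<Longrightarrow> cmod z \<le> B"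
        using compact_imp_bounded[OF 2(1)] unfolding bounded_pos by auto
      define \<tau> where "\<tau> = min (1 / 2) ((R + 1) / (2 * (B + 1)))"
      have \<tau>: "\<tau> > 0" using B(1) R(1) by (simp add: \<tau>_def)
      have \<tau>': "\<tau> \<le> 1 / 2" unfolding \<tau>_def by (rule min.cobounded1)
      have far: "X t \<notin> C" if "0 < t" "t \<le> \<tau>" for t
      proof -
        have "t \<le> (R + 1) / (2 * (B + 1))" using that by (simp add: \<tau>_def)
        then have "B + 1 \<le> (R + 1) / (2 * t)" using that B by (simp add: field_simps)
        also have "\<dots> = cmod (X t)" using Xbig[of t] that \<tau>' by simp
        finally show ?thesis using B(2)[of "X t"] by force
      qed
      have "closed ({\<tau>..1} \<inter> X -` C)"
        using Xcont[OF \<tau>] 2(1) by (intro continuous_closed_preimage) (auto simp: compact_imp_closed)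
      moreover have "{0..1} \<inter> \<Gamma> -` V = {0..1} \<inter> - ({\<tau>..1} \<inter> X -` C)"
      proof (intro set_eqI)
        fix t
        have "t \<in> \<Gamma> -` V \<longleftrightarrow> t \<notin> {\<tau>..1} \<inter> X -` C" if "t \<in> {0..1}"
        proof (cases "t = 0")
          case True
          then show ?thesis using \<tau> 2(2) by (simp add: \<Gamma>_def)
        next
          case False
          then have "t > 0" using that by simp
          then have "t \<in> \<Gamma> -` V \<longleftrightarrow> X t \<notin> C" using 2(2) by (auto simp: \<Gamma>_def)
          then show ?thesis using far[of t] \<open>t > 0\<close> that by fastforce
        qed
        then show "t \<in> {0..1} \<inter> \<Gamma> -` V \<longleftrightarrow> t \<in> {0..1} \<inter> - ({\<tau>..1} \<inter> X -` C)" by blast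
      qed
      ultimately show ?thesis by (auto simp: openin_open intro!: exI[of _ "- ({\<tau>..1} \<inter> X -` C)"])
    qed
    then show "openin (top_of_set {0..1}) {x \<in> topspace (top_of_set {0..1}). \<Gamma> x \<in> V}"
      by (simp add: Int_def vimage_def)
  qed
  moreover have "\<Gamma> t \<in> - Some ` E" if "t \<in> {0..1}" for t using XE[of t] that by (auto simp: \<Gamma>_def)
  ultimately have "pathin (subtopology riemann_sphere (- Some ` E)) \<Gamma>" by (simp add: pathin_subtopology)
  then have "continuable_along \<Gamma> f" by (rule cont) (simp add: \<Gamma>_def)
  then obtain G where G: "\<forall>t\<in>{0..1}. meromorphic_at_point (G t) (\<Gamma> t)" "same_germ (\<Gamma> 0) (G 0) f"
    "\<forall>t\<in>{0..1}. \<forall>\<^sub>F s in at t within {0..1}. same_germ (\<Gamma> s) (G s) (G t)"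
    unfolding continuable_along_def by blast
  have Gm: "G t meromorphic_on {X t}" if "0 < t" "t \<le> 1" for t
    using G(1)[rule_format, of t] that by (simp add: \<Gamma>_def)
  have Gc: "\<forall>\<^sub>F s in at t within {a..1}. germ_eq (X s) (G s) (G t)" if "0 \<le> t" "t \<le> 1" "0 < a" for t a
  proof -
    have "at t within {a..1} \<le> at t within {0..1}" using that by (intro at_le) auto
    then have "\<forall>\<^sub>F s in at t within {a..1}. same_germ (\<Gamma> s) (G s) (G t)"
      using G(3)[rule_format, of t] that by (auto intro: filter_leD)
    moreover have "\<forall>\<^sub>F s in at t within {a..1}. s \<in> {a..1}" by (auto simp: eventually_at_filter)
    ultimately show ?thesis
      by eventually_elim (use that in \<open>auto simp: \<Gamma>_def same_germ_def germ_eq_def\<close>)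
  qed
  have "\<forall>\<^sub>F z in at_infinity. G 0 z = f z" using G(2) by (simp add: \<Gamma>_def same_germ_def)
  then have "\<forall>\<^sub>F z in at_infinity. G 0 z = F z" using F(2) by eventually_elim simp
  from eventually_at_infinity_germ_eq[OF this]
  obtain B where B: "\<And>z. B \<le> cmod z \<Longrightarrow> germ_eq z (G 0) F" by (auto simp: eventually_at_infinity)
  \<comment> \<open>For parameters below \<open>\<tau>\<close> the path is outside the disc of radius \<open>B\<close>.\<close>
  define \<tau> where "\<tau> = min (1 / 2) ((R + 1) / (2 * (\<bar>B\<bar> + 1)))"
  have \<tau>: "\<tau> > 0" using R(1) by (simp add: \<tau>_def)
  have \<tau>': "\<tau> \<le> 1 / 2" unfolding \<tau>_def by (rule min.cobounded1)
  have "\<forall>\<^sub>F s in at_right 0. s < \<tau>" using \<tau> by (intro order_tendstoD(2)[OF tendsto_ident_at])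
  moreover have "\<forall>\<^sub>F s in at_right (0::real). 0 < s" by (simp add: eventually_at_right_less)
  moreover have "\<forall>\<^sub>F s in at_right 0. same_germ (\<Gamma> s) (G s) (G 0)"
    using G(3)[rule_format, of 0] by (simp add: at_within_Icc_at_right)
  ultimately have "\<forall>\<^sub>F s in at_right 0. 0 < s \<and> s < \<tau> \<and> same_germ (\<Gamma> s) (G s) (G 0)"
    by eventually_elim simp
  then obtain s where s: "0 < s" "s < \<tau>" "same_germ (\<Gamma> s) (G s) (G 0)"
    using eventually_happens[of _ "at_right (0::real)"] by (auto simp: trivial_limit_at_right_real)
  have "s \<le> (R + 1) / (2 * (\<bar>B\<bar> + 1))" using s by (simp add: \<tau>_def)
  then have "\<bar>B\<bar> + 1 \<le> (R + 1) / (2 * s)" using s by (simp add: field_simps)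
  then have "germ_eq (X s) (G 0) F" using Xbig[of s] s \<tau>' by (intro B) auto
  moreover have "germ_eq (X s) (G s) (G 0)" using s by (simp add: \<Gamma>_def same_germ_def germ_eq_def)
  ultimately have sF: "germ_eq (X s) (G s) F" by (rule germ_eq_trans[rotated])
  have start: "germ_eq (X (3/4)) (G (3/4)) F"
  proof (rule germ_eq_along_path[where x = X and F = G and a = s and b = "3/4" and t = s])
    show "continuous_on {s..3/4} X" using Xcont[OF s(1)] by (rule continuous_on_subset) auto
    fix t assume t: "t \<in> {s..3/4}"
    then show "G t meromorphic_on {X t}" using s by (intro Gm) auto
    have "at t within {s..3/4} \<le> at t within {s..1}" by (intro at_le) auto
    moreover have "\<forall>\<^sub>F u in at t within {s..1}. germ_eq (X u) (G u) (G t)" using t s by (intro Gc) auto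
    ultimately show "\<forall>\<^sub>F u in at t within {s..3/4}. germ_eq (X u) (G u) (G t)" by (rule filter_leD)
    have "X t \<notin> K" using t s by (intro XK) auto
    then show "F meromorphic_on {X t}" by (intro meromorphic_at_point_subset[OF F(1)]) auto
  qed (use s \<tau>' sF in auto)
  define H where "H t = G (3/4 + t/4)" for t
  show ?thesis
    unfolding continuable_on_segment_def
  proof (intro exI[of _ H] conjI ballI)
    fix t :: real assume t: "t \<in> {0..1}"
    show "H t meromorphic_on {p + complex_of_real t * (q - p)}"
      using Gm[of "3/4 + t/4"] Xseg[of t] t by (simp add: H_def)
    have "filterlim (\<lambda>s. 3/4 + s/4) (at (3/4 + t/4) within {1/2..1}) (at t within {0..1})"
      unfolding filterlim_at by (auto intro!: tendsto_eq_intros simp: eventually_at_filter)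
    moreover have "\<forall>\<^sub>F u in at (3/4 + t/4) within {1/2..1}. germ_eq (X u) (G u) (G (3/4 + t/4))"
      using t by (intro Gc) auto
    ultimately have "\<forall>\<^sub>F s in at t within {0..1}. germ_eq (X (3/4 + s/4)) (G (3/4 + s/4)) (G (3/4 + t/4))"
      by (rule eventually_compose_filterlim[rotated])
    moreover have "\<forall>\<^sub>F s in at t within {0..1::real}. s \<in> {0..1}" by (auto simp: eventually_at_filter)
    ultimately show "\<forall>\<^sub>F s in at t within {0..1}. germ_eq (p + complex_of_real s * (q - p)) (H s) (H t)"
      by eventually_elim (simp add: H_def Xseg)
  next
    show "germ_eq p (H 0) F" using start Xseg[of 0] by (simp add: H_def)
  qed
qed

text \<open>
  Since \<open>E \<subseteq> K\<close>, the germ of the extension at a point of the circle continues along all segments in a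
  slightly larger disc that misses \<open>E\<close>, so by \<open>monodromy_disc\<close> it extends to this disc. The two
  functions agree on an annulus around the circle, which is connected and disjoint from \<open>K\<close>.
\<close>

lemma admissible_Diff_ball:
  assumes adm: "K \<in> admissible_compacta f" and E: "E \<subseteq> K"
    and cont: "\<And>\<gamma>. pathin (subtopology riemann_sphere (- Some ` E)) \<gamma> \<Longrightarrow> \<gamma> 0 = None
        \<Longrightarrow> continuable_along \<gamma> f"
    and s: "s > 0" "cball a s \<inter> E = {}" "sphere a s \<inter> K = {}"
  shows "K - ball a s \<in> admissible_compacta f"
proof -
  have K: "compact K" "connected (- K)" and f: "analytic_germ_at_infinity f" and ext: "extends_to f (- K)"
    using adm by (auto simp: admissible_compacta_iff)
  from ext obtain F where F: "F meromorphic_on - K" "\<forall>\<^sub>F z in at_infinity. F z = f z"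
    by (auto simp: extends_to_def)
  have "compact (dist a ` K)" using K(1) by (intro compact_continuous_image continuous_intros)
  then have "open (- (dist a ` K))" by (simp add: compact_imp_closed open_Compl)
  moreover have "s \<in> - (dist a ` K)" using s(3) by (auto simp: sphere_def)
  ultimately obtain \<delta> where \<delta>: "\<delta> > 0" "ball s \<delta> \<subseteq> - (dist a ` K)" using openE by blast
  have ann: "z \<notin> K" if "\<bar>dist a z - s\<bar> < \<delta>" for z
    using \<delta>(2) that by (auto simp: dist_real_def abs_minus_commute subset_iff)
  define D where "D = ball a (s + \<delta>)"
  have DE: "D \<inter> E = {}"
  proof (rule ccontr)
    assume "D \<inter> E \<noteq> {}"
    then obtain z where z: "z \<in> D" "z \<in> E" by blast
    then have "dist a z > s" using s(2) by (force simp: cball_def)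
    then have "\<bar>dist a z - s\<bar> < \<delta>" using z by (simp add: D_def)
    then show False using ann E z by blast
  qed
  define p where "p = a + complex_of_real s"
  have dp: "dist a p = s" using s by (simp add: p_def dist_norm)
  have pK: "p \<notin> K" using ann[of p] dp \<delta> by simp
  have pD: "p \<in> D" using dp \<delta> by (simp add: D_def)
  have "\<exists>G. G meromorphic_on ball a (s + \<delta>) \<and> germ_eq p G F"
  proof (rule monodromy_disc)
    show "dist p a < s + \<delta>" using dp \<delta> by (simp add: dist_commute)
    show "F meromorphic_on {p}" using pK by (intro meromorphic_at_point_subset[OF F(1)]) auto
    fix q assume "q \<in> ball a (s + \<delta>)"
    then have "closed_segment p q \<subseteq> D" using pD unfolding D_def by (intro closed_segment_subset) auto
    with DE have seg: "closed_segment p q \<inter> E = {}" by blast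
    show "continuable_on_segment p q F" by (rule continuation_on_segment[OF E cont K F pK seg])
  qed
  then obtain G where G: "G meromorphic_on D" "germ_eq p G F" by (auto simp: D_def)
  define U where "U = - K - cball a (s - \<delta>)"
  have Kcl: "closed K" using K(1) by (rule compact_imp_closed)
  have oU: "open U" unfolding U_def using Kcl by (intro open_Diff open_Compl closed_cball)
  have inter: "U \<inter> D = {z. s - \<delta> < norm (z - a) \<and> norm (z - a) < s + \<delta>}"
    using ann by (auto simp: U_def D_def dist_norm norm_minus_commute)
  have FG: "germ_eq z F G" if "z \<in> U" "z \<in> D" for z
  proof (rule germ_eq_on_connected[of "U \<inter> D"])
    show "connected (U \<inter> D)" unfolding inter by (rule connected_annulus) simp
    show "F meromorphic_on U \<inter> D" by (intro meromorphic_on_subset[OF F(1)]) (auto simp: U_def)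
    show "G meromorphic_on U \<inter> D" by (intro meromorphic_on_subset[OF G(1)]) auto
    show "p \<in> U \<inter> D" using pD pK dp \<delta> by (auto simp: U_def)
    show "germ_eq p F G" using G(2) by (rule germ_eq_sym)
  qed (use that in auto)
  obtain H where H: "H meromorphic_on (\<Union>(U, F)\<in>{(U, F), (D, G)}. U)"
    "\<And>V F' z. (V, F') \<in> {(U, F), (D, G)} \<Longrightarrow> z \<in> V \<Longrightarrow> H z = remove_sings F' z"
  proof (rule glue_meromorphic[of "{(U, F), (D, G)}"])
    show "open V" if "(V, F') \<in> {(U, F), (D, G)}" for V F' using that oU by (auto simp: D_def)
    have "F meromorphic_on U" by (intro meromorphic_on_subset[OF F(1)]) (auto simp: U_def)
    then show "F' meromorphic_on V" if "(V, F') \<in> {(U, F), (D, G)}" for V F' using that G(1) by auto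
    show "germ_eq z F1 F2" if "(V, F1) \<in> {(U, F), (D, G)}" "(W, F2) \<in> {(U, F), (D, G)}" "z \<in> V" "z \<in> W" for V F1 W F2 z
      using that FG[of z] germ_eq_sym[OF FG[of z]] by auto
  qed blast
  have UD: "- (K - ball a s) = U \<union> D" using ann \<delta> by (auto simp: U_def D_def; smt (verit))
  have "extends_to f (- (K - ball a s))"
    unfolding extends_to_def
  proof (intro exI[of _ H] conjI)
    show "H meromorphic_on - (K - ball a s)" unfolding UD using H(1) by simp
    have "bounded (- U)" unfolding U_def using compact_imp_bounded[OF K(1)] by (simp add: Compl_Diff_eq)
    from cobounded_eventually_at_infinity[OF this] remove_sings_eq_at_infinity[OF f F(2)]
    show "\<forall>\<^sub>F z in at_infinity. H z = f z" by eventually_elim (use H(2)[of U F] in simp)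
  qed
  moreover have "connected (- (K - ball a s))"
  proof -
    have "z \<notin> K \<or> z \<in> ball a s" if "z \<in> D" for z 
    proof (cases "dist a z < s")
      case False
      then have "\<bar>dist a z - s\<bar> < \<delta>" using that by (simp add: D_def)
      then show ?thesis using ann by simp
    qed simp
    moreover have "ball a s \<subseteq> D" using \<delta>(1) unfolding D_def by (intro subset_ball) simp
    ultimately have "- (K - ball a s) = - K \<union> D" by blast
    moreover have "connected (- K \<union> D)"
      using K(2) pD pK by (intro connected_Un) (auto simp: D_def)
    ultimately show ?thesis by simp
  qed
  moreover have "compact (K - ball a s)" using K(1) by (intro compact_diff) auto
  ultimately show ?thesis using f by (simp add: admissible_compacta_iff)
qed

section \<open>Limits of compacta\<close>

lemma log_capacity_le_of_roots:
  fixes \<zeta> :: "nat \<Rightarrow> complex"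
  assumes "compact K" "m \<ge> 1" "M > 0" "\<And>z. z \<in> K \<Longrightarrow> (\<Prod>j<m. cmod (z - \<zeta> j)) \<le> M ^ m"
  shows "log_capacity K \<le> ereal M"
proof -
  define P where "P = (\<Prod>j<m. [:- \<zeta> j, 1:])"
  have "degree P = m" unfolding P_def by (subst degree_prod_eq_sum_degree) auto
  moreover have "lead_coeff P = 1" unfolding P_def by (simp add: lead_coeff_prod)
  moreover have "cmod (poly P z) \<le> M ^ m" if "z \<in> K" for z
    using assms(4)[OF that] by (simp add: P_def poly_prod prod_norm[symmetric])
  ultimately show ?thesis using assms by (intro log_capacity_le_of_polynomial[of K P m])
qed

text \<open>
  By the maximum modulus principle a polynomial has the same bound on \<open>K\<close> and on \<open>K\<close> with
  its holes filled, and capacity is determined by such bounds.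
\<close>

lemma log_capacity_fill:
  assumes K: "compact K"
  shows "log_capacity (- outside K) = log_capacity K"
proof (rule antisym)
  have cl: "closed K" and bd: "bounded K" using K by (auto simp: compact_imp_closed compact_imp_bounded)
  have comp: "compact (- outside K)"
    using cobounded_outside[OF bd] open_outside[OF cl] by (simp add: compact_eq_bounded_closed closed_Compl)
  show "log_capacity K \<le> log_capacity (- outside K)"
    by (intro log_capacity_mono) (auto simp: outside_def)
  show "log_capacity (- outside K) \<le> log_capacity K"
  proof (rule ccontr)
    assume "\<not> ?thesis"
    then obtain M where M: "log_capacity K < ereal M" "ereal M < log_capacity (- outside K)"
      using ereal_dense2 by (metis not_le)
    have "0 < ereal M" using log_capacity_nonneg M(1) by (rule le_less_trans)
    then have "M > 0" by simp
    obtain m and \<zeta> :: "nat \<Rightarrow> complex" where m: "m \<ge> 1" and \<zeta>: "\<And>z. z \<in> K \<Longrightarrow> (\<Prod>j<m. cmod (z - \<zeta> j)) \<le> M ^ m"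
      using exists_polynomial_of_log_capacity_less[OF K M(1)] by blast
    have "(\<Prod>j<m. cmod (z - \<zeta> j)) \<le> M ^ m" if z: "z \<in> - outside K" for z
    proof (cases "z \<in> K")
      case False
      then have zi: "z \<in> inside K" using z by (simp add: outside_inside)
      have "norm (\<Prod>j<m. z - \<zeta> j) \<le> M ^ m"
      proof (rule maximum_modulus_frontier[of "\<lambda>z. \<Prod>j<m. z - \<zeta> j" "inside K" "M ^ m" z])
        show "bounded (inside K)" using bd by (rule bounded_inside)
        show "(\<lambda>z. \<Prod>j<m. z - \<zeta> j) holomorphic_on interior (inside K)" by (intro holomorphic_intros)
        show "continuous_on (closure (inside K)) (\<lambda>z. \<Prod>j<m. z - \<zeta> j)" by (intro continuous_intros)
        show "norm (\<Prod>j<m. w - \<zeta> j) \<le> M ^ m" if "w \<in> frontier (inside K)" for w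
          using \<zeta>[of w] frontier_inside_subset[OF cl] that by (auto simp: prod_norm[symmetric])
      qed (rule zi)
      then show ?thesis by (simp add: prod_norm[symmetric])
    qed (rule \<zeta>)
    then have "log_capacity (- outside K) \<le> ereal M"
      by (rule log_capacity_le_of_roots[OF comp m \<open>M > 0\<close>])
    then show False using M(2) by simp
  qed
qed

text \<open>
  The lower limit in the sense of Kuratowski.
\<close>

definition limit_set :: "(nat \<Rightarrow> 'a::topological_space set) \<Rightarrow> 'a set" where
  "limit_set L = {z. \<forall>U. open U \<longrightarrow> z \<in> U \<longrightarrow> (\<forall>\<^sub>F i in sequentially. L i \<inter> U \<noteq> {})}"

text \<open>
  Every point outside the lower limit is also outside the upper limit: the sequence converges
  in the sense of Kuratowski.
\<close>

definition set_convergent :: "(nat \<Rightarrow> 'a::topological_space set) \<Rightarrow> bool" where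
  "set_convergent L \<longleftrightarrow>
     (\<forall>z. z \<notin> limit_set L \<longrightarrow> (\<exists>U. open U \<and> z \<in> U \<and> (\<forall>\<^sub>F i in sequentially. L i \<inter> U = {})))"

text \<open>
  By a diagonal argument, each member of a countable basis is either eventually met or eventually
  missed by the subsequence.
\<close>

lemma convergent_subsequence_of_sets:
  fixes K :: "nat \<Rightarrow> 'a::second_countable_topology set"
  obtains r :: "nat \<Rightarrow> nat" where "strict_mono r"
    "set_convergent (K \<circ> r)"
proof -
  obtain \<B> :: "'a set set" where \<B>: "countable \<B>" "topological_basis \<B>"
    using ex_countable_basis by blast
  have ne: "\<B> \<noteq> {}"
    using topological_basisE[OF \<B>(2) open_UNIV UNIV_I] by blast
  define B where "B = from_nat_into \<B>"
  have B: "range B = \<B>" using \<B>(1) ne by (simp add: B_def range_from_nat_into)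
  define P where "P k s \<longleftrightarrow> (\<forall>\<^sub>F i in sequentially. K (s i) \<inter> B k \<noteq> {}) \<or> (\<forall>\<^sub>F i in sequentially. K (s i) \<inter> B k = {})"
    for k :: nat and s :: "nat \<Rightarrow> nat"
  interpret subseqs P
  proof
    fix n :: nat and s :: "nat \<Rightarrow> nat" assume "strict_mono s"
    show "\<exists>r'. strict_mono r' \<and> P n (s \<circ> r')"
    proof (cases "infinite {i. K (s i) \<inter> B n \<noteq> {}}")
      case True
      then obtain r' :: "nat \<Rightarrow> nat" where "strict_mono r'" "\<And>i. r' i \<in> {i. K (s i) \<inter> B n \<noteq> {}}"
        using infinite_enumerate by blast
      then show ?thesis by (intro exI[of _ r']) (auto simp: P_def)
    next
      case False
      then have "\<forall>\<^sub>F i in sequentially. K (s i) \<inter> B n = {}"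
        unfolding eventually_cofinite[symmetric] cofinite_eq_sequentially[symmetric] by (simp add: eventually_cofinite)
      then show ?thesis by (intro exI[of _ id]) (auto simp: P_def strict_mono_id)
    qed
  qed
  have Pd: "P k diagseq" for k
  proof -
    have "P k (diagseq \<circ> ((+) (Suc k)))"
    proof (rule diagseq_holds)
      fix r s :: "nat \<Rightarrow> nat" and n assume r: "strict_mono r" and "P n s"
      then show "P n (s \<circ> r)"
        unfolding P_def comp_def
        using eventually_subseq[OF r, of "\<lambda>i. K (s i) \<inter> B n \<noteq> {}"] eventually_subseq[OF r, of "\<lambda>i. K (s i) \<inter> B n = {}"] by blast
    qed
    moreover define d where "d = diagseq"
    ultimately have "P k (\<lambda>i. d (i + Suc k))" by (simp add: comp_def add.commute)
    then have "P k d"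
      unfolding P_def using eventually_sequentially_seg[of "\<lambda>i. K (d i) \<inter> B k \<noteq> {}" "Suc k"]
        eventually_sequentially_seg[of "\<lambda>i. K (d i) \<inter> B k = {}" "Suc k"] by simp
    then show ?thesis by (simp only: d_def)
  qed
  show ?thesis
  proof (rule that[OF subseq_diagseq], unfold set_convergent_def, intro allI impI)
    fix z assume "z \<notin> limit_set (K \<circ> diagseq)"
    then obtain U where U: "open U" "z \<in> U" "\<not> (\<forall>\<^sub>F i in sequentially. K (diagseq i) \<inter> U \<noteq> {})"
      by (auto simp: limit_set_def)
    obtain b where b: "b \<in> \<B>" "z \<in> b" "b \<subseteq> U" using topological_basisE[OF \<B>(2) U(1,2)] by metis
    then obtain k where k: "b = B k" using B by blast
    have "\<not> (\<forall>\<^sub>F i in sequentially. K (diagseq i) \<inter> B k \<noteq> {})"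
    proof
      assume "\<forall>\<^sub>F i in sequentially. K (diagseq i) \<inter> B k \<noteq> {}"
      then have "\<forall>\<^sub>F i in sequentially. K (diagseq i) \<inter> U \<noteq> {}"
        by eventually_elim (use b k in blast)
      with U(3) show False by simp
    qed
    then have "\<forall>\<^sub>F i in sequentially. K (diagseq i) \<inter> B k = {}" using Pd[of k] by (simp add: P_def)
    then show "\<exists>U. open U \<and> z \<in> U \<and> (\<forall>\<^sub>F i in sequentially. (K \<circ> diagseq) i \<inter> U = {})"
      using b k topological_basis_open[OF \<B>(2) b(1)] by auto
  qed
qed

lemma compact_eventually_misses:
  assumes C: "compact C" "C \<inter> limit_set L = {}"
    and L: "set_convergent L"
  obtains W where "open W" "C \<subseteq> W" "\<forall>\<^sub>F i in sequentially. L i \<inter> W = {}"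
proof -
  have "\<forall>z\<in>C. \<exists>U. open U \<and> z \<in> U \<and> (\<forall>\<^sub>F i in sequentially. L i \<inter> U = {})" using C(2) L unfolding set_convergent_def by blast
  then obtain U where U: "\<And>z. z \<in> C \<Longrightarrow> open (U z)" "\<And>z. z \<in> C \<Longrightarrow> z \<in> U z"
    "\<And>z. z \<in> C \<Longrightarrow> \<forall>\<^sub>F i in sequentially. L i \<inter> U z = {}" by metis
  obtain Z where Z: "Z \<subseteq> C" "finite Z" "C \<subseteq> (\<Union>z\<in>Z. U z)"
    using compactE_image[OF C(1), of C U] U(1,2) by blast
  have "\<forall>\<^sub>F i in sequentially. \<forall>z\<in>Z. L i \<inter> U z = {}"
    using Z(1) U(3) by (intro eventually_ball_finite Z(2)) auto
  then have "\<forall>\<^sub>F i in sequentially. L i \<inter> (\<Union>z\<in>Z. U z) = {}" by eventually_elim blast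
  then show ?thesis using U(1) Z by (intro that[of "\<Union>z\<in>Z. U z"]) auto
qed

lemma compact_eventually_near:
  fixes L :: "nat \<Rightarrow> 'a::metric_space set"
  assumes C: "compact C" "C \<subseteq> limit_set L" and "\<eta> > 0"
  shows "\<forall>\<^sub>F i in sequentially. \<forall>z\<in>C. L i \<inter> ball z \<eta> \<noteq> {}"
proof -
  have "C \<subseteq> (\<Union>z\<in>C. ball z (\<eta> / 2))" using \<open>\<eta> > 0\<close> by auto
  then obtain Z where Z: "Z \<subseteq> C" "finite Z" "C \<subseteq> (\<Union>z\<in>Z. ball z (\<eta> / 2))"
    using compactE_image[OF C(1), of C "\<lambda>z. ball z (\<eta> / 2)"] by blast
  have "\<forall>\<^sub>F i in sequentially. L i \<inter> ball z (\<eta> / 2) \<noteq> {}" if "z \<in> Z" for z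
  proof -
    have "z \<in> limit_set L" using that Z(1) C(2) by blast
    then show ?thesis using \<open>\<eta> > 0\<close> unfolding limit_set_def by auto
  qed
  then have "\<forall>\<^sub>F i in sequentially. \<forall>z\<in>Z. L i \<inter> ball z (\<eta> / 2) \<noteq> {}"
    by (intro eventually_ball_finite Z(2)) auto
  then show ?thesis
  proof eventually_elim
    case (elim i)
    show ?case
    proof
      fix w assume "w \<in> C"
      then obtain z where z: "z \<in> Z" "w \<in> ball z (\<eta> / 2)" using Z(3) by blast
      then obtain v where v: "v \<in> L i" "v \<in> ball z (\<eta> / 2)" using elim by blast
      have "dist w v < \<eta>" using z v dist_triangle_half_r[of z w \<eta> v] by simp
      then show "L i \<inter> ball w \<eta> \<noteq> {}" using v by auto
    qed
  qed
qed

lemma closed_limit_set: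
  assumes "set_convergent L"
  shows "closed (limit_set L)"
  unfolding closed_def
proof (subst open_subopen, intro ballI)
  fix z assume "z \<in> - limit_set L"
  then obtain U where U: "open U" "z \<in> U" "\<forall>\<^sub>F i in sequentially. L i \<inter> U = {}"
    using assms unfolding set_convergent_def by blast
  have "w \<notin> limit_set L" if "w \<in> U" for w
  proof
    assume "w \<in> limit_set L"
    then have "\<forall>\<^sub>F i in sequentially. L i \<inter> U \<noteq> {}" using U(1) that by (auto simp: limit_set_def)
    with U(3) have "\<forall>\<^sub>F i::nat in sequentially. False" by eventually_elim simp
    then show False by simp
  qed
  then show "\<exists>T. open T \<and> z \<in> T \<and> T \<subseteq> - limit_set L" using U by blast
qed

lemma limit_set_subset_closed:
  assumes "closed C" "\<And>i. L i \<subseteq> C" shows "limit_set L \<subseteq> C"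
proof
  fix z assume z: "z \<in> limit_set L"
  show "z \<in> C"
  proof (rule ccontr)
    assume "z \<notin> C"
    then have "\<forall>\<^sub>F i in sequentially. L i \<inter> - C \<noteq> {}" using z assms(1) unfolding limit_set_def by blast
    then show False using assms(2) by (auto simp: disjoint_eq_subset_Compl)
  qed
qed

text \<open>
  The closures of the unions of the tails of the sequence decrease, so the unbounded components of their
  complements increase. On each of these one of the given extensions is available. They exhaust the unbounded
  component of the complement of the limit set, because a path to infinity there has a neighbourhood that
  the sequence eventually misses.
\<close>

lemma extends_to_outside_limit_set:
  fixes L :: "nat \<Rightarrow> complex set"
  assumes f: "analytic_germ_at_infinity f" and ext: "\<And>i. extends_to f (- L i)"
    and R: "\<And>i. L i \<subseteq> cball 0 R"
    and lim: "set_convergent L"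
  shows "extends_to f (outside (limit_set L))"
proof -
  define C where "C n = closure (\<Union>i\<in>{n..}. L i)" for n
  have CR: "C n \<subseteq> cball 0 R" for n unfolding C_def using R by (intro closure_minimal) auto
  have Cb: "bounded (C n)" for n using CR bounded_cball bounded_subset by blast
  have "(\<Union>i\<in>{n..}. L i) \<subseteq> (\<Union>i\<in>{m..}. L i)" if "m \<le> n" for m n using that by force
  then have anti: "C n \<subseteq> C m" if "m \<le> n" for m n using that unfolding C_def by (intro closure_mono)
  have LC: "L n \<subseteq> C n" for n unfolding C_def by (rule order.trans[OF _ closure_subset]) auto
  have "extends_to f (\<Union>(range (\<lambda>n. outside (C n))))"
  proof (rule extends_to_chain_Union[OF f])
    fix U assume "U \<in> range (\<lambda>n. outside (C n))"
    then obtain n where U: "U = outside (C n)" by blast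
    show "open U" unfolding U C_def by (intro open_outside) auto
    show "connected U" unfolding U using Cb by (intro connected_outside) auto
    show "bounded (- U)" unfolding U using Cb by (rule cobounded_outside)
    have "outside (C n) \<subseteq> - L n" using LC[of n] by (auto simp: outside_def)
    then show "extends_to f U" unfolding U using ext by (rule extends_to_subset[rotated])
    fix V assume "V \<in> range (\<lambda>n. outside (C n))"
    then obtain m where V: "V = outside (C m)" by blast
    show "U \<subseteq> V \<or> V \<subseteq> U" unfolding U V using anti outside_mono by (metis linear)
  qed simp
  moreover have "outside (limit_set L) \<subseteq> \<Union>(range (\<lambda>n. outside (C n)))"
  proof
    fix z assume z: "z \<in> outside (limit_set L)"
    have cl: "closed (limit_set L)" using lim by (rule closed_limit_set)
    have bd: "bounded (limit_set L)"
      using limit_set_subset_closed[of "cball 0 R" L] R bounded_cball bounded_subset by (metis closed_cball)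
    define N where "N = - cball (0::complex) R"
    have N: "connected N" "\<not> bounded N"
      unfolding N_def
      by (auto intro!: connected_complement_bounded_convex cobounded_imp_unbounded)
    have "\<not> bounded (outside (limit_set L))" using bd by (rule unbounded_outside)
    then have "\<not> outside (limit_set L) \<subseteq> cball 0 R" using bounded_cball bounded_subset by blast
    then obtain b where b: "b \<in> outside (limit_set L)" "b \<in> N" unfolding N_def by blast
    have "path_connected (outside (limit_set L))"
      using connected_outside[OF bd] open_outside[OF cl] by (simp add: connected_open_path_connected)
    then obtain \<gamma> where \<gamma>: "path \<gamma>" "path_image \<gamma> \<subseteq> outside (limit_set L)" "pathstart \<gamma> = z" "pathfinish \<gamma> = b"
      using z b unfolding path_connected_def by metis
    have "path_image \<gamma> \<inter> limit_set L = {}" using \<gamma>(2) by (auto simp: outside_def)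
    then obtain W where W: "open W" "path_image \<gamma> \<subseteq> W" "\<forall>\<^sub>F i in sequentially. L i \<inter> W = {}"
      using compact_eventually_misses[OF compact_path_image[OF \<gamma>(1)] _ lim] by blast
    then obtain n where n: "\<And>i. i \<ge> n \<Longrightarrow> L i \<inter> W = {}" by (auto simp: eventually_sequentially)
    then have "(\<Union>i\<in>{n..}. L i) \<subseteq> - W" by fastforce
    then have CW: "C n \<subseteq> - W" unfolding C_def using W(1) by (intro closure_minimal) auto
    define T where "T = path_image \<gamma> \<union> N"
    have bT: "b \<in> path_image \<gamma>" "z \<in> path_image \<gamma>" using \<gamma> by (auto simp: path_image_def pathfinish_def pathstart_def)
    have "connected T"
      unfolding T_def using \<gamma>(1) N(1) b bT by (intro connected_Un connected_path_image) auto
    moreover have "T \<subseteq> - C n" using CW W(2) CR[of n] by (auto simp: T_def N_def)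
    moreover have "z \<in> T" using bT by (simp add: T_def)
    ultimately have "T \<subseteq> connected_component_set (- C n) z" by (intro connected_component_maximal)
    moreover have "\<not> bounded T" using N(2) bounded_subset[of T N] by (auto simp: T_def)
    ultimately have "\<not> bounded (connected_component_set (- C n) z)" using bounded_subset by blast
    then have "z \<in> outside (C n)" by (simp add: outside)
    then show "z \<in> \<Union>(range (\<lambda>n. outside (C n)))" by blast
  qed
  ultimately show ?thesis by (rule extends_to_subset)
qed

text \<open>
  The property that makes limits of compacta lower semicontinuous for the capacity away from \<open>E\<close>; it
  excludes small isolated pieces of \<open>L\<close>.
\<close>

definition meets_circles_off :: "complex set \<Rightarrow> complex set \<Rightarrow> bool" where
  "meets_circles_off E L \<longleftrightarrow>
     (\<forall>a s. s > 0 \<longrightarrow> cball a s \<inter> E = {} \<longrightarrow> ball a s \<inter> L \<noteq> {} \<longrightarrow> sphere a s \<inter> L \<noteq> {})"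

lemma meets_circles_offD:
  "meets_circles_off E L \<Longrightarrow> s > 0 \<Longrightarrow> cball a s \<inter> E = {} \<Longrightarrow> ball a s \<inter> L \<noteq> {} \<Longrightarrow> sphere a s \<inter> L \<noteq> {}"
  unfolding meets_circles_off_def by blast

text \<open>
  A monic polynomial adapted to a late member \<open>L i\<close> is estimated at the points of the limit set at distance at
  least \<open>\<epsilon>\<close> from \<open>E\<close>. About these, \<open>L i\<close> meets all circles of radius between a small \<open>\<eta>\<close> and \<open>\<epsilon>\<close>,
  so \<open>polynomial_le_of_spheres_meet\<close> applies.
\<close>

lemma log_capacity_limit_set_le:
  fixes L :: "nat \<Rightarrow> complex set"
  assumes E: "compact E" "polar E" "\<And>i. E \<subseteq> L i"
    and L: "\<And>i. compact (L i)" "\<And>i. L i \<subseteq> cball 0 R"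
    and lim: "set_convergent L"
    and meet: "\<And>i. meets_circles_off E (L i)"
    and M: "0 < M'" "M' < M" and cap: "\<forall>\<^sub>F i in sequentially. log_capacity (L i) < ereal M'"
  shows "log_capacity (limit_set L) \<le> ereal M"
proof (rule log_capacity_le_of_away_from_polar)
  have "closed (limit_set L)" using lim by (rule closed_limit_set)
  moreover have "limit_set L \<subseteq> cball 0 R" using L(2) by (intro limit_set_subset_closed) auto
  ultimately show comp: "compact (limit_set L)" by (metis compact_Int_closed compact_cball inf.absorb_iff2)
  have "e \<in> limit_set L" if "e \<in> E" for e
  proof -
    have "L i \<inter> U \<noteq> {}" if "e \<in> U" for U i using E(3) \<open>e \<in> E\<close> that by blast
    then show ?thesis by (simp add: limit_set_def)
  qed
  then show "E \<subseteq> limit_set L" by blast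
  show "M > 0" using M by simp
  fix \<epsilon> :: real assume "\<epsilon> > 0"
  define S where "S = limit_set L - (\<Union>e\<in>E. ball e \<epsilon>)"
  have Sc: "compact S" unfolding S_def using comp by (intro compact_diff) auto
  define \<kappa> where "\<kappa> = ln (M / M')"
  have "\<kappa> > 0" using M by (simp add: \<kappa>_def)
  \<comment> \<open>With this choice the factor \<open>exp (20 / ln (\<epsilon> / \<eta>))\<close> equals \<open>M / M'\<close>.\<close>
  define \<eta> where "\<eta> = \<epsilon> * exp (- 20 / \<kappa>)"
  have \<eta>: "\<eta> > 0" "\<eta> < \<epsilon>" using \<open>\<epsilon> > 0\<close> \<open>\<kappa> > 0\<close> by (auto simp: \<eta>_def)
  have "\<epsilon> / \<eta> = exp (20 / \<kappa>)" using \<open>\<epsilon> > 0\<close> by (simp add: \<eta>_def exp_minus field_simps)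
  then have ratio: "20 / ln (\<epsilon> / \<eta>) = \<kappa>" using \<open>\<kappa> > 0\<close> by simp
  have "\<forall>\<^sub>F i in sequentially. \<forall>z\<in>S. L i \<inter> ball z \<eta> \<noteq> {}"
    using Sc \<eta> by (intro compact_eventually_near) (auto simp: S_def)
  with cap have "\<forall>\<^sub>F i in sequentially. log_capacity (L i) < ereal M' \<and> (\<forall>z\<in>S. L i \<inter> ball z \<eta> \<noteq> {})"
    by eventually_elim simp
  then obtain i where i: "log_capacity (L i) < ereal M'" "\<And>z. z \<in> S \<Longrightarrow> L i \<inter> ball z \<eta> \<noteq> {}"
    by (auto simp: eventually_sequentially)
  obtain m and \<zeta> :: "nat \<Rightarrow> complex" where m: "m \<ge> 1" and \<zeta>: "\<And>z. z \<in> L i \<Longrightarrow> (\<Prod>j<m. cmod (z - \<zeta> j)) \<le> M' ^ m"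
    using exists_polynomial_of_log_capacity_less[OF L(1) i(1)] by blast
  have "(\<Prod>j<m. cmod (z - \<zeta> j)) \<le> M ^ m" if z: "z \<in> S" for z
  proof -
    have "(\<Prod>j<m. cmod (z - \<zeta> j)) \<le> M' ^ m * exp (real m * (20 / ln (\<epsilon> / \<eta>)))"
    proof (rule polynomial_le_of_spheres_meet[OF \<zeta> _ \<eta>])
      fix s assume s: "\<eta> < s" "s < \<epsilon>"
      show "sphere z s \<inter> L i \<noteq> {}"
      proof (rule meets_circles_offD[OF meet])
        show "s > 0" using s \<eta> by simp
        show "cball z s \<inter> E = {}"
        proof (rule ccontr)
          assume "cball z s \<inter> E \<noteq> {}"
          then obtain e where "e \<in> E" "dist e z \<le> s" by (auto simp: dist_commute)
          then have "z \<in> (\<Union>e\<in>E. ball e \<epsilon>)" using s by force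
          then show False using z by (simp add: S_def)
        qed
        have "ball z \<eta> \<subseteq> ball z s" using s by (intro subset_ball) simp
        then show "ball z s \<inter> L i \<noteq> {}" using i(2)[OF z] by blast
      qed
    qed (use M in auto)
    also have "exp (real m * (20 / ln (\<epsilon> / \<eta>))) = (M / M') ^ m"
      unfolding ratio exp_of_nat_mult \<kappa>_def using M by simp
    also have "M' ^ m * (M / M') ^ m = M ^ m" using M by (simp add: power_divide)
    finally show ?thesis .
  qed
  then have "log_capacity S \<le> ereal M" using Sc m M by (intro log_capacity_le_of_roots) auto
  then show "log_capacity (limit_set L - (\<Union>e\<in>E. ball e \<epsilon>)) \<le> ereal M" by (simp add: S_def)
qed (use E in auto)

section \<open>Existence of a compactum of minimal capacity\<close>

lemma ereal_le_if_le_all_greater: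
  fixes x :: ereal
  assumes "\<And>M. M > c \<Longrightarrow> x \<le> ereal M"
  shows "x \<le> ereal c"
proof (rule ccontr)
  assume "\<not> ?thesis"
  then obtain M where "ereal c < ereal M" "ereal M < x" using ereal_dense2 by (metis not_le)
  with assms[of M] show False by simp
qed

text \<open>
  Pass to \<open>K \<union> E\<close> with its holes filled and then to a minimal admissible subset containing \<open>E\<close>: a circle
  that violates the required property would allow \<open>admissible_Diff_ball\<close> to make it smaller.
\<close>

lemma exists_admissible_spheres_meet:
  assumes E: "compact E" "polar E" and K: "K \<in> admissible_compacta f"
    and cont: "\<And>\<gamma>. pathin (subtopology riemann_sphere (- Some ` E)) \<gamma> \<Longrightarrow> \<gamma> 0 = None
        \<Longrightarrow> continuable_along \<gamma> f"
  obtains L where "L \<in> admissible_compacta f" "E \<subseteq> L" "log_capacity L \<le> log_capacity K"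
    "meets_circles_off E L"
proof -
  have Kc: "compact K" and f: "analytic_germ_at_infinity f" and ext: "extends_to f (- K)"
    using K by (auto simp: admissible_compacta_iff)
  define J where "J = - outside (K \<union> E)"
  have KE: "compact (K \<union> E)" using Kc E by (intro compact_Un)
  have "J \<in> admissible_compacta f"
    unfolding admissible_compacta_iff
  proof (intro conjI f)
    have "bounded (K \<union> E)" "closed (K \<union> E)" using KE by (auto simp only: compact_imp_bounded compact_imp_closed)
    then show "compact J" "connected (- J)"
      unfolding J_def using cobounded_outside open_outside connected_outside[of "K \<union> E"]
      by (auto simp only: compact_eq_bounded_closed closed_Compl double_complement DIM_complex order_refl)
    have "- J \<subseteq> - K" by (auto simp: J_def outside_def)
    with ext show "extends_to f (- J)" by (rule extends_to_subset)
  qed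
  moreover have "E \<subseteq> J" by (auto simp: J_def outside_def)
  ultimately obtain L where L: "L \<in> admissible_compacta f" "E \<subseteq> L" "L \<subseteq> J"
    "\<And>L'. L' \<in> admissible_compacta f \<Longrightarrow> E \<subseteq> L' \<Longrightarrow> L' \<subseteq> L \<Longrightarrow> L' = L"
    using exists_minimal_admissible by blast
  show ?thesis
  proof (rule that[OF L(1,2)])
    have "log_capacity L \<le> log_capacity J" using L(3) by (rule log_capacity_mono)
    also have "\<dots> = log_capacity K"
      unfolding J_def using log_capacity_fill[OF KE] log_capacity_Un_polar[OF Kc E] by simp
    finally show "log_capacity L \<le> log_capacity K" .
    show "meets_circles_off E L"
      unfolding meets_circles_off_def
    proof (intro allI impI)
      fix a and s :: real assume s: "s > 0" "cball a s \<inter> E = {}" "ball a s \<inter> L \<noteq> {}"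
      show "sphere a s \<inter> L \<noteq> {}"
      proof
        assume "sphere a s \<inter> L = {}"
        then have "L - ball a s \<in> admissible_compacta f" by (intro admissible_Diff_ball[OF L(1,2) cont s(1,2)])
        moreover have "E \<subseteq> L - ball a s" using L(2) s(2) ball_subset_cball[of a s] by blast
        ultimately have "L - ball a s = L" by (intro L(4)) auto
        then show False using s(3) by blast
      qed
    qed
  qed
qed

text \<open>
  About a point of \<open>L\<close> at distance \<open>d\<close> from a disc containing \<open>E\<close>, all circles of radius less than
  \<open>d\<close> meet \<open>L\<close>, so \<open>d\<close> is at most a constant times the capacity.
\<close>

lemma spheres_meet_imp_subset_cball:
  assumes L: "compact L" "log_capacity L < ereal M" and E: "E \<subseteq> ball 0 R"
    and meet: "meets_circles_off E L"
  shows "L \<subseteq> cball 0 (R + M * exp 8)"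
proof
  fix z assume z: "z \<in> L"
  have "0 < ereal M" using log_capacity_nonneg L(2) by (rule le_less_trans)
  then have M: "M > 0" by simp
  show "z \<in> cball 0 (R + M * exp 8)"
  proof (cases "cmod z > R")
    case True
    obtain m and \<zeta> :: "nat \<Rightarrow> complex" where m: "m \<ge> 1" and \<zeta>: "\<And>z. z \<in> L \<Longrightarrow> (\<Prod>j<m. cmod (z - \<zeta> j)) \<le> M ^ m"
      using exists_polynomial_of_log_capacity_less[OF L] by blast
    have "cmod z - R \<le> M * exp 8"
    proof (rule radius_le_of_spheres_meet[OF \<zeta> M m])
      show "cmod z - R > 0" using True by simp
      fix s assume s: "0 < s" "s < cmod z - R"
      show "sphere z s \<inter> L \<noteq> {}"
      proof (rule meets_circles_offD[OF meet s(1)])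
        show "ball z s \<inter> L \<noteq> {}" using z centre_in_ball[of z s] s(1) by blast
        show "cball z s \<inter> E = {}"
        proof (rule ccontr)
          assume "cball z s \<inter> E \<noteq> {}"
          then obtain e where e: "e \<in> E" "cmod (z - e) \<le> s" by (auto simp: dist_norm)
          then have "cmod e < R" using E by auto
          then show False using e(2) s(2) norm_triangle_sub[of z e] by simp
        qed
      qed
    qed
    then show ?thesis by simp
  next
    case False
    moreover have "M * exp 8 \<ge> 0" using M by simp
    ultimately show ?thesis by simp
  qed
qed

theorem theorem1:
  fixes E :: "complex set" and f :: "complex \<Rightarrow> complex"
  assumes "compact E" and "polar E" and "f \<in> multivalued_germs E"
  shows "\<exists>S\<in>admissible_compacta f.
           log_capacity S = (INF K\<in>admissible_compacta f. log_capacity K)"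
proof -
  from assms(3) have f: "analytic_germ_at_infinity f"
    and cont: "\<And>\<gamma>. pathin (subtopology riemann_sphere (- Some ` E)) \<gamma> \<Longrightarrow> \<gamma> 0 = None \<Longrightarrow> continuable_along \<gamma> f"
    by (auto simp: multivalued_germs_def)
  let ?A = "admissible_compacta f"
  define c where "c = (INF K\<in>?A. log_capacity K)"
  obtain R where R: "R > 0" "f analytic_on {z. R < cmod z}" using analytic_germ_analytic_outside[OF f] .
  have "cball 0 R \<in> ?A"
    unfolding admissible_compacta_iff
  proof (intro conjI f)
    show "connected (- cball (0::complex) R)" by (intro connected_complement_bounded_convex) auto
    have "f meromorphic_on - cball 0 R"
      using analytic_on_imp_meromorphic_on[OF R(2)] by (rule meromorphic_on_subset) auto
    then show "extends_to f (- cball 0 R)" by (auto simp: extends_to_def)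
  qed simp
  moreover have "log_capacity (cball 0 R) \<le> ereal R"
    by (rule log_capacity_le_of_roots[of _ 1 _ "\<lambda>_. 0"]) (use R(1) in auto)
  ultimately have "c \<le> ereal R" unfolding c_def by (rule INF_lower2)
  moreover have "0 \<le> c" unfolding c_def by (intro INF_greatest log_capacity_nonneg)
  ultimately obtain c0 where c0: "c = ereal c0" "c0 \<ge> 0" by (cases c) auto
  have "\<exists>L. L \<in> ?A \<and> E \<subseteq> L \<and> log_capacity L < ereal (c0 + 1 / real (Suc n)) \<and>
      meets_circles_off E L" for n
  proof -
    have "c < ereal (c0 + 1 / real (Suc n))" using c0 by simp
    then obtain K where K: "K \<in> ?A" "log_capacity K < ereal (c0 + 1 / real (Suc n))"
      unfolding c_def INF_less_iff by blast
    show ?thesis using exists_admissible_spheres_meet[OF assms(1,2) K(1) cont] K(2) by (metis le_less_trans)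
  qed
  then obtain K where K: "\<And>n. K n \<in> ?A" "\<And>n. E \<subseteq> K n" "\<And>n. log_capacity (K n) < ereal (c0 + 1 / real (Suc n))"
    "\<And>n. meets_circles_off E (K n)" by metis
  obtain R0 where R0: "E \<subseteq> ball 0 R0" using compact_imp_bounded[OF assms(1)] bounded_subset_ballD by metis
  define R1 where "R1 = R0 + (c0 + 1) * exp 8"
  have Kc: "compact (K n)" "extends_to f (- K n)" for n using K(1)[of n] by (auto simp: admissible_compacta_iff)
  have KR: "K n \<subseteq> cball 0 R1" for n
    unfolding R1_def
  proof (rule spheres_meet_imp_subset_cball[OF Kc(1) _ R0])
    have "ereal (c0 + 1 / real (Suc n)) \<le> ereal (c0 + 1)" by (simp add: field_simps)
    then show "log_capacity (K n) < ereal (c0 + 1)" using K(3) by (rule less_le_trans[rotated])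
  qed (rule K(4))
  obtain r :: "nat \<Rightarrow> nat" where r: "strict_mono r"
    "set_convergent (K \<circ> r)"
    using convergent_subsequence_of_sets[of K] by blast
  define L where "L = K \<circ> r"
  note lim = r(2)[folded L_def]
  have L: "compact (L i)" "extends_to f (- L i)" "E \<subseteq> L i" "L i \<subseteq> cball 0 R1" for i
    using Kc K(2) KR by (auto simp: L_def)
  have cl: "closed (limit_set L)" using lim by (rule closed_limit_set)
  have sub: "limit_set L \<subseteq> cball 0 R1" using L(4) by (intro limit_set_subset_closed) auto
  then have bd: "bounded (limit_set L)" using bounded_cball bounded_subset by blast
  have comp: "compact (limit_set L)" using cl bd by (simp add: compact_eq_bounded_closed)
  define S where "S = - outside (limit_set L)"
  have SA: "S \<in> ?A"
    unfolding admissible_compacta_iff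
  proof (intro conjI f)
    show "compact S" unfolding S_def
      using cobounded_outside[OF bd] open_outside[OF cl] by (simp add: compact_eq_bounded_closed closed_Compl)
    show "connected (- S)" unfolding S_def using connected_outside[OF bd] by simp
    show "extends_to f (- S)" unfolding S_def using extends_to_outside_limit_set[OF f L(2,4) lim] by simp
  qed
  have "log_capacity S \<le> ereal M" if "M > c0" for M
  proof -
    define M' where "M' = (c0 + M) / 2"
    have M': "c0 < M'" "0 < M'" "M' < M" using that c0(2) by (auto simp: M'_def)
    have "(\<lambda>n. c0 + 1 / real (Suc (r n))) \<longlonglongrightarrow> c0"
    proof -
      have "(\<lambda>n. c0 + 1 / real (Suc n)) \<longlonglongrightarrow> c0" by real_asymp
      from LIMSEQ_subseq_LIMSEQ[OF this r(1)] show ?thesis by (simp add: comp_def)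
    qed
    then have "\<forall>\<^sub>F n in sequentially. c0 + 1 / real (Suc (r n)) < M'" using M'(1) by (rule order_tendstoD(2))
    then have ev: "\<forall>\<^sub>F n in sequentially. log_capacity (L n) < ereal M'"
    proof eventually_elim
      case (elim n)
      have "log_capacity (L n) < ereal (c0 + 1 / real (Suc (r n)))" unfolding L_def comp_def by (rule K(3))
      also have "\<dots> < ereal M'" using elim by simp
      finally show ?case .
    qed
    have "log_capacity (limit_set L) \<le> ereal M"
    proof (rule log_capacity_limit_set_le[OF assms(1,2) L(3,1,4) lim _ M'(2,3) ev])
      show "meets_circles_off E (L i)" for i using K(4) by (simp add: L_def)
    qed
    then show ?thesis unfolding S_def log_capacity_fill[OF comp] .
  qed
  then have "log_capacity S \<le> c" unfolding c0(1) by (rule ereal_le_if_le_all_greater)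
  moreover have "c \<le> log_capacity S" unfolding c_def using SA by (rule INF_lower)
  ultimately show ?thesis using SA unfolding c_def by (intro bexI[of _ S] antisym)
qed

end
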